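(* Let $r\ge3$, let $d\ge2$ be even, and let $n=(r-2)d+1$ and $N=rn-1$. Suppose that the vertex set of $\Delta_N$ is partitioned into $n$ color classes $C_1,\dots,C_n$ with $r$ points each. Then for almost any affine map $f:\Delta_N\to\mathbb{R}^d$, there exist points $x_1,\dots,x_r$ with equal barycentric coordinates from pairwise disjoint rainbow faces $\sigma_1,\dots,\sigma_r$ such that $f(x_1),\dots,f(x_r)$ are the vertices of a regular $r$-gon. This also holds for every Soberón generic continuous map $f:\Delta_N\to\mathbb{R}^d$ when $r$ is an odd prime.
   Context: $\Delta_N$ is the $N$-simplex. "Almost any affine map" means: for Lebesgue-almost every choice of the images of the $N+1$ vertices. A regular $r$-gon in $\mathbb{R}^d$ is a non-degenerate planar regular $r$-gon. A face of $\Delta_N$ is rainbow if its vertex set consists of exactly one point from each color class $C_1,\dots,C_n$. Given pairwise disjoint rainbow faces $\sigma_1,\dots,\sigma_r$, let $v_j^i\in C_i$ ($1\le i\le n$) be the vertices of $\sigma_j$; each $x_j\in\sigma_j$ is uniquely a convex sum $x_j=\sum_{i=1}^nt_{i,j}v_j^i$. The points $x_1\in\sigma_1,\dots,x_r\in\sigma_r$ have equal barycentric coordinates if for each $1\le i\le n$ the number $t_{i,j}=t_i$ is independent of $j$. A continuous map $f:\Delta_{rn-1}\to\mathbb{R}^d$, where $n<(r-1)d+1$ and the vertex set of $\Delta_{rn-1}$ is partitioned into $n$ color classes $C_1,\dots,C_n$ with $r$ points each, is Soberón generic if there do not exist points $x_1,\dots,x_r$ with equal barycentric coordinates from pairwise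 disjoint rainbow faces $\sigma_1,\dots,\sigma_r$ such that $f(x_1)=f(x_2)=\cdots=f(x_r)$. *)

theory Defs
  imports
    "HOL-Homology.Simplices"
    "HOL-Analysis.Analysis"
    "HOL-Computational_Algebra.Primes"
begin

(* The simplex with vertices 0, ..., N is the library's standard_simplex N.  A point is its
   family of barycentric coordinates: x v is the coefficient of x at the vertex v.  The topology
   on the function type nat => real is the product topology, which induces the usual topology
   on the simplex. *)

definition simplex_face :: "nat \<Rightarrow> nat set \<Rightarrow> (nat \<Rightarrow> real) set" where
  "simplex_face N S = {x \<in> standard_simplex N. \<forall>v. v \<notin> S \<longrightarrow> x v = 0}"

definition affine_simplex_map :: "nat \<Rightarrow> (nat \<Rightarrow> 'a::real_vector) \<Rightarrow> (nat \<Rightarrow> real) \<Rightarrow> 'a" where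
  "affine_simplex_map N p x = (\<Sum>v\<le>N. x v *\<^sub>R p v)"

definition color_classes :: "nat \<Rightarrow> nat \<Rightarrow> nat \<Rightarrow> (nat \<Rightarrow> nat set) \<Rightarrow> bool" where
  "color_classes N n r C \<longleftrightarrow>
     (\<Union>i\<in>{1..n}. C i) = {..N} \<and> disjoint_family_on C {1..n} \<and> (\<forall>i\<in>{1..n}. card (C i) = r)"

(* S is the vertex set of a rainbow face. *)
definition rainbow :: "nat \<Rightarrow> nat \<Rightarrow> (nat \<Rightarrow> nat set) \<Rightarrow> nat set \<Rightarrow> bool" where
  "rainbow N n C S \<longleftrightarrow> S \<subseteq> {..N} \<and> (\<forall>i\<in>{1..n}. card (S \<inter> C i) = 1)"

(* x 1, ..., x r are points with equal barycentric coordinates from pairwise disjoint rainbow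
   faces.  S j is the vertex set of the j-th face; its vertex in C i is the unique v in S j \<inter> C i,
   and x j v is the corresponding coefficient, which has to be t i for every j. *)
definition equal_rainbow_points ::
    "nat \<Rightarrow> nat \<Rightarrow> nat \<Rightarrow> (nat \<Rightarrow> nat set) \<Rightarrow> (nat \<Rightarrow> nat \<Rightarrow> real) \<Rightarrow> bool" where
  "equal_rainbow_points N n r C x \<longleftrightarrow>
     (\<exists>S. (\<forall>j\<in>{1..r}. rainbow N n C (S j) \<and> x j \<in> simplex_face N (S j)) \<and>
          disjoint_family_on (\<lambda>j. simplex_face N (S j)) {1..r} \<and>
          (\<exists>t. \<forall>i\<in>{1..n}. \<forall>j\<in>{1..r}. \<forall>v \<in> S j \<inter> C i. x j v = t i))"

(* Continuity of f and the bound n < (r - 1) * d + 1 are not part of this predicate. *)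
definition soberon_generic ::
    "nat \<Rightarrow> nat \<Rightarrow> nat \<Rightarrow> (nat \<Rightarrow> nat set) \<Rightarrow> ((nat \<Rightarrow> real) \<Rightarrow> 'a) \<Rightarrow> bool" where
  "soberon_generic N n r C f \<longleftrightarrow>
     \<not> (\<exists>x. equal_rainbow_points N n r C x \<and> (\<forall>j\<in>{1..r}. \<forall>k\<in>{1..r}. f (x j) = f (x k)))"

(* P is the vertex set of a non-degenerate planar regular r-gon, with centre c and circumradius
   \<rho>, in the plane through c spanned by the orthonormal vectors u and w. *)
definition regular_polygon_vertices :: "nat \<Rightarrow> 'a::real_inner set \<Rightarrow> bool" where
  "regular_polygon_vertices r P \<longleftrightarrow>
     (\<exists>c u w \<rho>. norm u = 1 \<and> norm w = 1 \<and> inner u w = 0 \<and> \<rho> > 0 \<and>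
        P = (\<lambda>k. c + \<rho> *\<^sub>R (cos (2 * pi * real k / real r) *\<^sub>R u +
                             sin (2 * pi * real k / real r) *\<^sub>R w)) ` {..<r})"

end

theory Submission
  imports Defs "HOL-Number_Theory.Cong"
begin

text \<open>Let \<open>\<int>/r\<close> act on the simplex by a vertex permutation cycling each colour class. For \<open>x\<close> in
  the union of the rainbow faces, the translates of \<open>x\<close> have equal barycentric coordinates in disjoint
  rainbow faces. Identify \<open>\<real>\<^sup>d\<close> with \<open>\<complex>\<^sup>d\<^sup>/\<^sup>2\<close> and take the discrete Fourier transform of the values of
  \<open>f\<close> along the orbit of \<open>x\<close>: if every mode except \<open>0\<close> and \<open>1\<close> vanishes, these values are
  \<open>A + \<omega>\<^sup>j B\<close>, the vertices of a regular polygon unless \<open>B = 0\<close>. The unwanted modes are \<open>(r - 2) d\<close>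
  real equations on the \<open>(r - 2) d\<close>-dimensional union of the rainbow faces. For affine \<open>f\<close> the colourful
  Caratheodory theorem solves them, and a generic choice of vertices excludes \<open>B = 0\<close>. For continuous
  \<open>f\<close> and prime \<open>r\<close> the modes are acted on freely, so the nonexistence of a zero would give an
  equivariant labelling of a fine subdivision of an \<open>n\<close>-fold join of \<open>\<int>/r\<close> by the \<open>(n - 1)\<close>-fold join;
  comparing the two chain complexes along the standard resolution rules this out.\<close>

section \<open>Chains on lists and cyclic actions\<close>

text \<open>The unit circle is cut into \<open>2 * r\<close> sectors. Rotation by one step of
  \<open>Z/r\<close> moves a nonzero number two sectors on, so the parity of its sector is invariant
  and picks one of two copies of \<open>Z/r\<close>. Hence the \<open>(r - 2) * d / 2\<close>
  complex modes need \<open>(r - 2) * d = n - 1\<close> copies, one fewer than there are colours.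
  Mode \<open>k\<close> turns by \<open>k\<close> steps at a time and is rescaled to single steps by
  an inverse of \<open>k\<close> modulo \<open>r\<close>; this is where primality enters. The final
  contradiction is arithmetic: the empty simplex is kept as an augmentation, the descent makes its
  coefficient a multiple of \<open>r\<close>, and yet that coefficient is \<open>1\<close>.

  For affine maps the modes are linear, and the sum of a mode over a colour class vanishes because
  the shift multiplies it by a root of unity other than \<open>1\<close>. So the origin is the
  centroid of every class, which is what the colourful Caratheodory theorem needs. The case
  \<open>B = 0\<close> imposes \<open>(r - 1) * d\<close> linear equations on a point with only
  \<open>n - 1\<close> degrees of freedom, and \<open>n - 1 < (r - 1) * d\<close>.\<close>

definition one_minus :: "('c::ab_group_add \<Rightarrow> 'c) \<Rightarrow> 'c \<Rightarrow> 'c" where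
  "one_minus \<sigma> c = c - \<sigma> c"

definition orbit_sum :: "nat \<Rightarrow> ('c::ab_group_add \<Rightarrow> 'c) \<Rightarrow> 'c \<Rightarrow> 'c" where
  "orbit_sum r \<sigma> c = (\<Sum>i<r. (\<sigma> ^^ i) c)"

text \<open>The differentials of the periodic resolution of the integers over the group ring of
  \<open>Z/r\<close>, indexed by list length, so that index \<open>0\<close> belongs to the
  augmentation.\<close>

definition alternating_op :: "nat \<Rightarrow> ('c::ab_group_add \<Rightarrow> 'c) \<Rightarrow> nat \<Rightarrow> 'c \<Rightarrow> 'c" where
  "alternating_op r \<sigma> k =
     (if k = 0 then id else if odd k then one_minus \<sigma> else orbit_sum r \<sigma>)"

lemma additive_frag_extend: "Modules.additive (frag_extend f)"
  by (simp add: Modules.additive_def frag_extend_add)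

lemma additive_funpow:
  fixes \<sigma> :: "'c::ab_group_add \<Rightarrow> 'c"
  shows "Modules.additive \<sigma> \<Longrightarrow> Modules.additive (\<sigma> ^^ i)"
  by (induction i) (auto simp: Modules.additive_def)

lemma funpow_commute_map:
  assumes "\<And>c. L (\<sigma> c) = \<sigma>' (L c)"
  shows "L ((\<sigma> ^^ i) c) = (\<sigma>' ^^ i) (L c)"
  by (induction i) (simp_all add: assms)

lemma alternating_op_commute:
  assumes "Modules.additive L" "\<And>c. L (\<sigma> c) = \<sigma>' (L c)"
  shows "L (alternating_op r \<sigma> k c) = alternating_op r \<sigma>' k (L c)"
  using assms funpow_commute_map[of L \<sigma> \<sigma>', OF assms(2)]
  by (simp add: alternating_op_def one_minus_def orbit_sum_def Modules.additive.diff Modules.additive.sum)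

lemma funpow_diff_eq:
  assumes "(\<sigma> ^^ r) c = c"
  shows "(\<Sum>i<r. (\<sigma> ^^ Suc i) c) = (\<Sum>i<r. (\<sigma> ^^ i) (c::'c::ab_group_add))"
proof -
  have "(\<Sum>i<r. (\<sigma> ^^ Suc i) c - (\<sigma> ^^ i) c) = 0"
    by (subst sum_lessThan_telescope) (simp add: assms)
  then show ?thesis by (simp add: sum_subtractf)
qed

lemma one_minus_orbit_sum:
  assumes "Modules.additive \<sigma>" "(\<sigma> ^^ r) c = c"
  shows "one_minus \<sigma> (orbit_sum r \<sigma> c) = 0"
  using funpow_diff_eq[OF assms(2)] assms(1)
  by (simp add: one_minus_def orbit_sum_def Modules.additive.sum)

lemma orbit_sum_one_minus:
  assumes "Modules.additive \<sigma>" "(\<sigma> ^^ r) c = c"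
  shows "orbit_sum r \<sigma> (one_minus \<sigma> c) = 0"
proof -
  have "(\<sigma> ^^ i) (c - \<sigma> c) = (\<sigma> ^^ i) c - (\<sigma> ^^ Suc i) c" for i
    using additive_funpow[OF assms(1), of i]
    by (simp add: Modules.additive.diff funpow_swap1)
  then show ?thesis
    using funpow_diff_eq[OF assms(2)] by (simp add: one_minus_def orbit_sum_def sum_subtractf)
qed

text \<open>Exactness of the resolution operators lets one descend from the vanishing top chain to the
  bottom, where the norm multiplies by \<open>r\<close>.\<close>

lemma resolution_descent:
  fixes D :: "'c::ab_group_add \<Rightarrow> 'c" and G :: "nat \<Rightarrow> 'c set" and y :: "nat \<Rightarrow> 'c"
  assumes add: "Modules.additive D" "Modules.additive \<sigma>"
    and comm: "\<And>c. D (\<sigma> c) = \<sigma> (D c)"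
    and G: "\<And>k. 0 \<in> G k" "\<And>k a b. a \<in> G k \<Longrightarrow> b \<in> G k \<Longrightarrow> a - b \<in> G k"
    and DG: "\<And>k c. c \<in> G (Suc k) \<Longrightarrow> D c \<in> G k"
    and DD: "\<And>k c. c \<in> G (Suc k) \<Longrightarrow> D (D c) = 0"
    and ex1: "\<And>k c. \<lbrakk>c \<in> G (Suc k); orbit_sum r \<sigma> c = 0\<rbrakk> \<Longrightarrow> \<exists>w\<in>G (Suc k). c = one_minus \<sigma> w"
    and ex2: "\<And>k c. \<lbrakk>c \<in> G (Suc k); one_minus \<sigma> c = 0\<rbrakk> \<Longrightarrow> \<exists>w\<in>G (Suc k). c = orbit_sum r \<sigma> w"
    and y: "\<And>k. y k \<in> G k" "\<And>k. k < n \<Longrightarrow> D (y (Suc k)) = alternating_op r \<sigma> k (y k)"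
    and n: "0 < n" "y n = 0"
  shows "\<exists>w\<in>G 1. y 0 = orbit_sum r \<sigma> (D w)"
proof -
  \<comment> \<open>\<open>H (Suc k)\<close> is the operator that \<open>alternating_op\<close> uses
    in degree \<open>k > 0\<close>, and exactness says that its kernel is the image of
    \<open>H k\<close>. The invariant carried downwards: \<open>y k\<close> lies in the image of
    \<open>H k\<close> up to a boundary.\<close>
  define H where "H k c = (if odd k then orbit_sum r \<sigma> c else one_minus \<sigma> c)" for k :: nat and c
  have H0: "H k 0 = 0" for k
    using add(2) additive_funpow[OF add(2)]
    by (simp add: H_def orbit_sum_def one_minus_def Modules.additive.zero)
  have Hadd: "H k (a - b) = H k a - H k b" for k a b
    using add(2) additive_funpow[OF add(2)]
    by (simp add: H_def orbit_sum_def one_minus_def Modules.additive.diff sum_subtractf)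
  have Hcomm: "D (H k c) = H k (D c)" for k c
    using funpow_commute_map[of D \<sigma> \<sigma>, OF comm] comm add(1)
    by (simp add: H_def one_minus_def orbit_sum_def Modules.additive.diff Modules.additive.sum)
  have "\<exists>w\<in>G k. \<exists>u\<in>G (Suc k). y k = H k w + D u" if "1 \<le> k" "k \<le> n" for k
    using that(2,1)
  proof (induction k rule: inc_induct)
    case base
    then show ?case
      using G(1) H0 Modules.additive.zero[OF add(1)] n(2)
      by (intro bexI[of _ 0]) (auto intro!: exI[of _ 0])
  next
    case (step k)
    then obtain w u where wu: "w \<in> G (Suc k)" "u \<in> G (Suc (Suc k))" "y (Suc k) = H (Suc k) w + D u"
      by auto
    have alt: "alternating_op r \<sigma> k (y k) = H (Suc k) (y k)"
      using step by (auto simp: alternating_op_def H_def)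
    have "H (Suc k) (y k) = H (Suc k) (D w)"
      using y(2)[of k] step alt wu DD[OF wu(2)]
      by (simp add: Modules.additive.add[OF add(1)] Hcomm)
    then have *: "H (Suc k) (y k - D w) = 0"
      by (simp add: Hadd)
    have "y k - D w \<in> G k" using y DG wu(1) G(2) by blast
    then have "\<exists>v\<in>G k. y k - D w = H k v"
      using * ex1[of _ "k - 1"] ex2[of _ "k - 1"] step.prems
      by (cases "odd k") (auto simp: H_def)
    then show ?case using wu(1) by (metis diff_add_cancel)
  qed
  from this[of 1] n obtain w u where wu: "w \<in> G 1" "u \<in> G 2" "y 1 = orbit_sum r \<sigma> w + D u"
    by (auto simp: H_def numeral_2_eq_2)
  have "y 0 = D (y 1)" using y(2)[of 0] n by (simp add: alternating_op_def)
  also have "\<dots> = H 1 (D w)"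
    using wu DD[of u 1] Hcomm[of 1 w]
    by (simp add: Modules.additive.add[OF add(1)] H_def numeral_2_eq_2)
  finally show ?thesis using wu by (auto simp: H_def)
qed

section \<open>Linear maps of integer chains and exactness for free cyclic actions\<close>

definition frag_map :: "('x \<Rightarrow> 'y) \<Rightarrow> ('x \<Rightarrow>\<^sub>0 int) \<Rightarrow> ('y \<Rightarrow>\<^sub>0 int)" where
  "frag_map s = frag_extend (\<lambda>x. frag_of (s x))"

lemma frag_map_of [simp]: "frag_map s (frag_of x) = frag_of (s x)"
  by (simp add: frag_map_def)

lemma additive_frag_map: "Modules.additive (frag_map s)"
  unfolding frag_map_def by (rule additive_frag_extend)

lemma frag_extend_extend:
  "frag_extend f (frag_extend g c) = frag_extend (\<lambda>x. frag_extend f (g x)) c"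
  using subset_UNIV by (induction c rule: frag_induction) (auto simp: frag_extend_diff)

lemma frag_extend_ident: "frag_extend frag_of c = c"
  using frag_expansion by metis

lemma frag_map_funpow:
  fixes s :: "'x \<Rightarrow> 'x"
  shows "(frag_map s ^^ i) c = frag_map (s ^^ i) c"
proof (induction i)
  case 0
  show ?case by (simp add: frag_map_def frag_extend_ident)
next
  case (Suc i)
  then show ?case by (simp add: frag_map_def frag_extend_extend)
qed

lemma frag_map_comm:
  assumes "\<And>x. f (s x) = frag_map s' (f x)"
  shows "frag_extend f (frag_map s c) = frag_map s' (frag_extend f c)"
  unfolding frag_map_def frag_extend_extend
  by (rule frag_extend_eq) (use assms in \<open>simp add: frag_map_def\<close>)

lemma frag_linear_eq:
  assumes "Modules.additive f" "Modules.additive g" "Poly_Mapping.keys c \<subseteq> X"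
    and "\<And>x. x \<in> X \<Longrightarrow> f (frag_of x) = g (frag_of x)"
  shows "f c = g c"
  using assms(3) by (induction c rule: frag_induction)
    (auto simp: Modules.additive.zero[OF assms(1)] Modules.additive.zero[OF assms(2)] assms(4)
        Modules.additive.diff[OF assms(1)] Modules.additive.diff[OF assms(2)])

lemma keys_diff_subset: "Poly_Mapping.keys a \<subseteq> X \<Longrightarrow> Poly_Mapping.keys b \<subseteq> X \<Longrightarrow> Poly_Mapping.keys (a - b) \<subseteq> X"
  using keys_diff by fastforce

lemma keys_sum_subset:
  "(\<And>i. i \<in> I \<Longrightarrow> Poly_Mapping.keys (f i) \<subseteq> X) \<Longrightarrow> Poly_Mapping.keys (sum f I) \<subseteq> X"
proof (induction I rule: infinite_finite_induct)
  case (insert x F)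
  then show ?case using Poly_Mapping.keys_add[of "f x" "sum f F"] by fastforce
qed auto

lemma keys_frag_extend_subset:
  assumes "Poly_Mapping.keys c \<subseteq> X" "\<And>x. x \<in> X \<Longrightarrow> Poly_Mapping.keys (f x) \<subseteq> Y"
  shows "Poly_Mapping.keys (frag_extend f c) \<subseteq> Y"
  using keys_frag_extend[of f c] assms by fastforce

text \<open>A free cyclic action, with freeness witnessed by an equivariant map \<open>g\<close> to \<open>\<int>/r\<close>.\<close>

locale cyclic_set =
  fixes X :: "'x set" and s :: "'x \<Rightarrow> 'x" and r :: nat and g :: "'x \<Rightarrow> nat"
  assumes closed: "x \<in> X \<Longrightarrow> s x \<in> X"
    and period: "x \<in> X \<Longrightarrow> (s ^^ r) x = x"
    and g_less: "x \<in> X \<Longrightarrow> g x < r"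
    and g_step: "x \<in> X \<Longrightarrow> g (s x) = Suc (g x) mod r"
begin

lemma funpow_closed: "x \<in> X \<Longrightarrow> (s ^^ i) x \<in> X"
  by (induction i) (auto simp: closed)

lemma g_funpow: "x \<in> X \<Longrightarrow> g ((s ^^ i) x) = (g x + i) mod r"
  by (induction i) (auto simp: g_less g_step funpow_closed mod_Suc_eq)

text \<open>The stretch of the orbit from \<open>x\<close> up to level \<open>r - 1\<close> of
  \<open>g\<close>. Extended linearly, it is a contracting homotopy for both exactness statements
  below.\<close>

definition partial_orbit :: "'x \<Rightarrow> 'x \<Rightarrow>\<^sub>0 int" where
  "partial_orbit x = (\<Sum>i<r - g x. frag_of ((s ^^ i) x))"

definition slice :: "nat \<Rightarrow> 'x \<Rightarrow> 'x \<Rightarrow>\<^sub>0 int" where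
  "slice j x = (if g x = j then frag_of x else 0)"

lemma orbit_sum_frag_of: "orbit_sum r (frag_map s) (frag_of x) = (\<Sum>i<r. frag_of ((s ^^ i) x))"
  by (simp add: orbit_sum_def frag_map_funpow)

lemma keys_partial_orbit: "x \<in> X \<Longrightarrow> Poly_Mapping.keys (partial_orbit x) \<subseteq> X"
  unfolding partial_orbit_def by (rule keys_sum_subset) (auto simp: funpow_closed)

lemma keys_slice: "x \<in> X \<Longrightarrow> Poly_Mapping.keys (slice j x) \<subseteq> X"
  by (auto simp: slice_def)

lemma additive_one_minus: "Modules.additive (one_minus (frag_map s))"
  using additive_frag_map[of s] by (simp add: Modules.additive_def one_minus_def)

lemma additive_orbit_sum: "Modules.additive (orbit_sum r (frag_map s))"
  using additive_funpow[OF additive_frag_map[of s]]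
  by (simp add: Modules.additive_def orbit_sum_def sum.distrib)

text \<open>An orbit meets level \<open>0\<close> exactly once, after \<open>r - g x\<close> steps;
  for \<open>g x = 0\<close> this is a full turn, which the period undoes.\<close>

lemma slice_orbit:
  assumes x: "x \<in> X"
  shows "frag_extend (slice 0) (orbit_sum r (frag_map s) (frag_of x)) = frag_of ((s ^^ (r - g x)) x)"
proof -
  let ?j = "(r - g x) mod r"
  have gr: "g x < r" using g_less x by blast
  have *: "(g x + i) mod r = 0 \<longleftrightarrow> i = ?j" if "i < r" for i
  proof
    assume "(g x + i) mod r = 0"
    then obtain q where q: "g x + i = r * q" by (auto simp: mod_eq_0_iff_dvd)
    have "q < 2"
    proof (rule ccontr)
      assume "\<not> q < 2"
      then have "r * 2 \<le> r * q" by simp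
      then show False using q gr that by linarith
    qed
    then have "q = 0 \<or> q = 1" by auto
    then show "i = ?j" using q gr that by auto
  next
    assume "i = ?j"
    then show "(g x + i) mod r = 0" using gr by (cases "g x = 0") auto
  qed
  have "frag_extend (slice 0) (orbit_sum r (frag_map s) (frag_of x))
      = (\<Sum>i<r. if i = ?j then frag_of ((s ^^ i) x) else 0)"
    unfolding orbit_sum_frag_of
    by (subst frag_extend_sum) (auto simp: slice_def g_funpow[OF x] * intro!: sum.cong)
  also have "\<dots> = frag_of ((s ^^ ?j) x)" using gr by (simp add: sum.delta)
  also have "(s ^^ ?j) x = (s ^^ (r - g x)) x"
    using gr period[OF x] by (cases "g x = 0") auto
  finally show ?thesis .
qed

text \<open>Applied to a partial orbit, \<open>one_minus\<close> telescopes to \<open>x\<close>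
  minus the point of its orbit on level \<open>0\<close>, and this error is determined by the orbit
  sum.\<close>

lemma orbit_sum_eq_0:
  assumes c: "Poly_Mapping.keys c \<subseteq> X" "orbit_sum r (frag_map s) c = 0"
  shows "\<exists>w. Poly_Mapping.keys w \<subseteq> X \<and> c = one_minus (frag_map s) w"
proof (intro exI conjI)
  let ?P = "frag_extend partial_orbit" and ?R = "frag_extend (slice 0)"
  show "Poly_Mapping.keys (?P c) \<subseteq> X"
    using c(1) keys_partial_orbit by (rule keys_frag_extend_subset)
  have 1: "c - one_minus (frag_map s) (?P c) = ?R (orbit_sum r (frag_map s) c)"
  proof (rule frag_linear_eq[OF _ _ c(1)])
    show "Modules.additive (\<lambda>c. c - one_minus (frag_map s) (?P c))"
      "Modules.additive (\<lambda>c. ?R (orbit_sum r (frag_map s) c))"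
      using additive_one_minus additive_orbit_sum
      by (auto simp: Modules.additive_def frag_extend_add)
    fix x assume x: "x \<in> X"
    have "one_minus (frag_map s) (partial_orbit x)
        = (\<Sum>i<r - g x. frag_of ((s ^^ i) x) - frag_of ((s ^^ Suc i) x))"
      by (simp add: one_minus_def partial_orbit_def sum_subtractf
          Modules.additive.sum[OF additive_frag_map])
    also have "\<dots> = frag_of x - frag_of ((s ^^ (r - g x)) x)"
      by (subst sum_lessThan_telescope') simp
    finally show "frag_of x - one_minus (frag_map s) (?P (frag_of x))
       = ?R (orbit_sum r (frag_map s) (frag_of x))"
      using slice_orbit[OF x] by simp
  qed
  then show "c = one_minus (frag_map s) (?P c)" using c(2) by simp
qed

text \<open>The difference \<open>partial_orbit x - partial_orbit (s x)\<close> is \<open>x\<close>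
  alone, except on level \<open>r - 1\<close>, where the passage to level \<open>0\<close> subtracts
  a whole orbit. Hence the witness is the part of \<open>c\<close> on level
  \<open>r - 1\<close>.\<close>

lemma one_minus_eq_0:
  assumes c: "Poly_Mapping.keys c \<subseteq> X" "one_minus (frag_map s) c = 0"
  shows "\<exists>w. Poly_Mapping.keys w \<subseteq> X \<and> c = orbit_sum r (frag_map s) w"
proof (intro exI conjI)
  let ?P = "frag_extend partial_orbit" and ?R = "frag_extend (slice (r - 1))"
  show "Poly_Mapping.keys (?R c) \<subseteq> X"
    using c(1) keys_slice by (rule keys_frag_extend_subset)
  have 1: "c - orbit_sum r (frag_map s) (?R c) = ?P (one_minus (frag_map s) c)"
  proof (rule frag_linear_eq[OF _ _ c(1)])
    show "Modules.additive (\<lambda>c. c - orbit_sum r (frag_map s) (?R c))"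
      "Modules.additive (\<lambda>c. ?P (one_minus (frag_map s) c))"
      using additive_one_minus additive_orbit_sum
      by (auto simp: Modules.additive_def frag_extend_add)
    fix x assume x: "x \<in> X"
    have gr: "g x < r" using g_less x by blast
    have shift: "partial_orbit (s x) = (\<Sum>i<r - g (s x). frag_of ((s ^^ Suc i) x))"
      by (simp add: partial_orbit_def funpow_swap1)
    show "frag_of x - orbit_sum r (frag_map s) (?R (frag_of x)) = ?P (one_minus (frag_map s) (frag_of x))"
    proof (cases "g x = r - 1")
      case True
      then have "g (s x) = 0" "r - g x = 1" using g_step[OF x] gr by auto
      then have "?P (one_minus (frag_map s) (frag_of x)) = frag_of x - (\<Sum>i<r. frag_of ((s ^^ Suc i) x))"
        using shift by (simp add: one_minus_def frag_extend_diff partial_orbit_def)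
      also have "(\<Sum>i<r. frag_of ((s ^^ Suc i) x)) = (\<Sum>i<r. frag_of ((s ^^ i) x))"
        using funpow_diff_eq[where \<sigma> = "frag_map s" and c = "frag_of x"] period[OF x]
        by (simp add: frag_map_funpow del: funpow.simps)
      finally show ?thesis using True by (simp add: slice_def orbit_sum_frag_of)
    next
      case False
      then have g: "g (s x) = Suc (g x)" using g_step[OF x] gr by simp
      have "r - g x = Suc (r - g (s x))" using gr g by simp
      then have "partial_orbit x = frag_of x + partial_orbit (s x)"
        unfolding shift by (simp add: partial_orbit_def sum.lessThan_Suc_shift del: sum.lessThan_Suc)
      then show ?thesis using False additive_orbit_sum
        by (simp add: slice_def one_minus_def frag_extend_diff Modules.additive.zero)
    qed
  qed
  then show "c = orbit_sum r (frag_map s) (?R c)" using c(2) by simp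
qed

end

section \<open>Augmented chains of ordered simplices, cones and subdivision\<close>

abbreviation keys where "keys \<equiv> Poly_Mapping.keys"

definition cone_over :: "'a \<Rightarrow> ('a list \<Rightarrow>\<^sub>0 int) \<Rightarrow> ('a list \<Rightarrow>\<^sub>0 int)" where
  "cone_over v = frag_map ((#) v)"

primrec face_sum :: "'a list \<Rightarrow> 'a list \<Rightarrow>\<^sub>0 int" where
  "face_sum [] = 0"
| "face_sum (x # xs) = frag_of xs - cone_over x (face_sum xs)"

abbreviation boundary :: "('a list \<Rightarrow>\<^sub>0 int) \<Rightarrow> ('a list \<Rightarrow>\<^sub>0 int)" where
  "boundary \<equiv> frag_extend face_sum"

lemma additive_cone_over: "Modules.additive (cone_over v)"
  unfolding cone_over_def by (rule additive_frag_map)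

lemma cone_diff: "cone_over v (a - b) = cone_over v a - cone_over v b"
  by (rule Modules.additive.diff[OF additive_cone_over])

lemma cone_0 [simp]: "cone_over v 0 = 0"
  by (rule Modules.additive.zero[OF additive_cone_over])

lemma cone_frag_of [simp]: "cone_over v (frag_of xs) = frag_of (v # xs)"
  by (simp add: cone_over_def)

lemma keys_cone: "keys (cone_over v c) \<subseteq> (#) v ` keys c"
  unfolding cone_over_def frag_map_def by (rule keys_frag_extend_subset[OF order_refl]) auto

text \<open>The cone formula needs no exception in the lowest degree because the empty list counts
  as a simplex, the face of every one-element list.\<close>

lemma boundary_cone: "boundary (cone_over v c) = c - cone_over v (boundary c)"
  using subset_UNIV by (induction c rule: frag_induction)
    (auto simp: frag_extend_diff cone_diff)

lemma boundary_face_sum: "boundary (face_sum xs) = 0"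
  by (induction xs) (auto simp: frag_extend_diff boundary_cone)

lemma boundary_boundary: "boundary (boundary c) = 0"
  unfolding frag_extend_extend by (simp add: boundary_face_sum frag_extend_eq_0)

lemma cone_frag_map: "frag_map (map s) (cone_over v c) = cone_over (s v) (frag_map (map s) c)"
  using subset_UNIV by (induction c rule: frag_induction)
    (auto simp: frag_map_def cone_over_def frag_extend_diff)

lemma face_sum_map: "face_sum (map s xs) = frag_map (map s) (face_sum xs)"
  by (induction xs)
    (auto simp: cone_frag_map Modules.additive.diff[OF additive_frag_map]
        Modules.additive.zero[OF additive_frag_map])

lemma boundary_frag_map:
  fixes s :: "'a \<Rightarrow> 'a"
  shows "boundary (frag_map (map s) c) = frag_map (map s) (boundary c)"
  by (rule frag_map_comm) (rule face_sum_map)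

lemma keys_face_sum: "ys \<in> keys (face_sum xs) \<Longrightarrow> Suc (length ys) = length xs \<and> set ys \<subseteq> set xs"
proof (induction xs arbitrary: ys)
  case (Cons x xs)
  have "keys (face_sum (x # xs)) \<subseteq> {xs} \<union> (#) x ` keys (face_sum xs)"
    using keys_cone[of x "face_sum xs"] keys_diff[of "frag_of xs" "cone_over x (face_sum xs)"] by auto
  then consider "ys = xs" | ws where "ys = x # ws" "ws \<in> keys (face_sum xs)"
    using Cons.prems by blast
  then show ?case using Cons.IH by cases auto
qed simp

lemma sorted_wrt_face_sum: "sorted_wrt P xs \<Longrightarrow> ys \<in> keys (face_sum xs) \<Longrightarrow> sorted_wrt P ys"
proof (induction xs arbitrary: ys)
  case (Cons x xs)
  have "keys (face_sum (x # xs)) \<subseteq> {xs} \<union> (#) x ` keys (face_sum xs)"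
    using keys_cone[of x "face_sum xs"] keys_diff[of "frag_of xs" "cone_over x (face_sum xs)"] by auto
  then consider "ys = xs" | ws where "ys = x # ws" "ws \<in> keys (face_sum xs)"
    using Cons.prems by blast
  then show ?case
    using Cons.IH Cons.prems(1) keys_face_sum[of _ xs] by cases (auto dest: subsetD)
qed simp

text \<open>Barycentric subdivision, with an arbitrary assignment \<open>b\<close> of new vertices to faces.\<close>

primrec subdivide :: "('a list \<Rightarrow> 'b) \<Rightarrow> nat \<Rightarrow> 'a list \<Rightarrow> 'b list \<Rightarrow>\<^sub>0 int" where
  "subdivide b 0 xs = frag_of []"
| "subdivide b (Suc k) xs = cone_over (b xs) (frag_extend (subdivide b k) (face_sum xs))"

definition chains_of_length :: "nat \<Rightarrow> ('a list \<Rightarrow>\<^sub>0 int) set" where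
  "chains_of_length k = {c. keys c \<subseteq> {xs. length xs = k}}"

lemma subdivide_chains_of_length: "frag_extend (subdivide b k) c \<in> chains_of_length k"
proof (induction k arbitrary: c)
  case 0
  show ?case unfolding chains_of_length_def mem_Collect_eq
    by (rule keys_frag_extend_subset[OF order_refl]) auto
next
  case (Suc k)
  have "keys (subdivide b (Suc k) xs) \<subseteq> {xs. length xs = Suc k}" for xs
    using keys_cone[of "b xs" "frag_extend (subdivide b k) (face_sum xs)"] Suc[of "face_sum xs"]
    unfolding chains_of_length_def by fastforce
  then show ?case unfolding chains_of_length_def mem_Collect_eq
    by (intro keys_frag_extend_subset[OF order_refl])
qed

text \<open>By induction the subdivided boundary of a simplex is a cycle, so coning it off has the
  right boundary. The recursion depth matches the simplex only if it equals its length, hence the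
  restriction on \<open>c\<close>.\<close>

lemma boundary_subdivide:
  assumes "c \<in> chains_of_length (Suc k)"
  shows "boundary (frag_extend (subdivide b (Suc k)) c) = frag_extend (subdivide b k) (boundary c)"
  using assms
proof (induction k arbitrary: c)
  case 0
  have "boundary (subdivide b (Suc 0) xs) = frag_extend (subdivide b 0) (face_sum xs)"
    if "length xs = Suc 0" for xs
    using that by (auto simp: length_Suc_conv)
  then show ?case using 0 unfolding frag_extend_extend
    by (intro frag_extend_eq) (auto simp: chains_of_length_def)
next
  case (Suc k)
  have "boundary (subdivide b (Suc (Suc k)) xs) = frag_extend (subdivide b (Suc k)) (face_sum xs)"
    if "length xs = Suc (Suc k)" for xs
  proof -
    have "face_sum xs \<in> chains_of_length (Suc k)"
      using keys_face_sum[of _ xs] that by (auto simp: chains_of_length_def)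
    then have "boundary (frag_extend (subdivide b (Suc k)) (face_sum xs)) = 0"
      using Suc.IH[of "face_sum xs"] by (simp add: boundary_face_sum del: subdivide.simps)
    moreover have "boundary (subdivide b (Suc (Suc k)) xs)
        = frag_extend (subdivide b (Suc k)) (face_sum xs)
          - cone_over (b xs) (boundary (frag_extend (subdivide b (Suc k)) (face_sum xs)))"
      by (subst subdivide.simps(2)) (rule boundary_cone)
    ultimately show ?thesis by simp
  qed
  then show ?case using Suc.prems unfolding frag_extend_extend
    by (intro frag_extend_eq) (auto simp: chains_of_length_def simp del: subdivide.simps)
qed

lemma subdivide_map:
  fixes s :: "'a \<Rightarrow> 'a" and s' :: "'b \<Rightarrow> 'b"
  assumes "\<And>xs. b (map s xs) = s' (b xs)"
  shows "subdivide b k (map s xs) = frag_map (map s') (subdivide b k xs)"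
proof (induction k arbitrary: xs)
  case (Suc k)
  then show ?case
    by (simp add: face_sum_map cone_frag_map assms frag_map_comm)
qed simp

lemma subdivide_frag_map:
  fixes s :: "'a \<Rightarrow> 'a" and s' :: "'b \<Rightarrow> 'b"
  assumes "\<And>xs. b (map s xs) = s' (b xs)"
  shows "frag_extend (subdivide b k) (frag_map (map s) c)
       = frag_map (map s') (frag_extend (subdivide b k) c)"
  by (rule frag_map_comm, rule subdivide_map, rule assms)

lemma keys_subdivide_Suc:
  assumes "zs \<in> keys (subdivide b (Suc k) xs)"
  obtains ys ws where "zs = b xs # ws" "ys \<in> keys (face_sum xs)" "ws \<in> keys (subdivide b k ys)"
proof -
  obtain ws where ws: "zs = b xs # ws" "ws \<in> keys (frag_extend (subdivide b k) (face_sum xs))"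
    using assms keys_cone[of "b xs" "frag_extend (subdivide b k) (face_sum xs)"] by auto
  then show thesis
    using keys_frag_extend[of "subdivide b k" "face_sum xs"] that by blast
qed

text \<open>With set-valued \<open>b\<close> the new vertices form decreasing chains of sets;
  \<open>V\<close> will be the property of being a face of the join.\<close>

lemma keys_subdivide_flag:
  assumes mono: "\<And>ys xs. set ys \<subseteq> set xs \<Longrightarrow> b ys \<subseteq> b xs"
    and V: "\<And>ys. \<lbrakk>set ys \<subseteq> set xs; ys \<noteq> []\<rbrakk> \<Longrightarrow> V (b ys)"
    and "length xs = k" "zs \<in> keys (subdivide b k xs)"
  shows "length zs = k \<and> sorted_wrt (\<supseteq>) zs \<and> (\<forall>A\<in>set zs. A \<subseteq> b xs \<and> V A)"
  using V assms(3,4)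
proof (induction k arbitrary: xs zs)
  case (Suc k)
  obtain ys ws where z: "zs = b xs # ws" "ys \<in> keys (face_sum xs)" "ws \<in> keys (subdivide b k ys)"
    using keys_subdivide_Suc Suc.prems(3) by blast
  have ys: "length ys = k" "set ys \<subseteq> set xs" using keys_face_sum[OF z(2)] Suc.prems(2) by auto
  have "V (b ys')" if "set ys' \<subseteq> set ys" "ys' \<noteq> []" for ys'
    using Suc.prems(1) ys(2) that by blast
  from Suc.IH[OF this ys(1) z(3)] show ?case
    using z(1) mono[OF ys(2)] Suc.prems(1)[of xs] Suc.prems(2) by (cases xs) auto
qed simp

section \<open>Discarding degenerate flags\<close>

definition drop_repeats :: "'a list \<Rightarrow> 'a list \<Rightarrow>\<^sub>0 int" where
  "drop_repeats xs = (if distinct xs then frag_of xs else 0)"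

abbreviation normalise :: "('a list \<Rightarrow>\<^sub>0 int) \<Rightarrow> ('a list \<Rightarrow>\<^sub>0 int)" where
  "normalise \<equiv> frag_extend drop_repeats"

lemma normalise_cone: "normalise (cone_over v (normalise c)) = normalise (cone_over v c)"
  using subset_UNIV by (induction c rule: frag_induction)
    (auto simp: frag_extend_diff cone_diff drop_repeats_def)

text \<open>In a decreasing list equal entries are adjacent, so the two faces that omit one of them
  cancel and all other faces still repeat an entry. For a list such as \<open>A, B, A\<close> this
  would fail.\<close>

lemma normalise_face_sum:
  assumes "sorted_wrt (\<supseteq>) xs" "\<not> distinct xs"
  shows "normalise (face_sum xs) = 0"
  using assms
proof (induction xs)
  case (Cons x ys)
  show ?case
  proof (cases "distinct ys")
    case False
    then have "normalise (cone_over x (face_sum ys)) = 0"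
      using Cons normalise_cone[of x "face_sum ys"] by simp
    then show ?thesis using False by (simp add: frag_extend_diff drop_repeats_def[of ys])
  next
    case True
    then have "x \<in> set ys" using Cons.prems by simp
    then obtain y zs where ys: "ys = y # zs" by (cases ys) auto
    \<comment> \<open>\<open>y\<close> is squeezed between two copies of \<open>x\<close>.\<close>
    have "y = x" using Cons.prems(1) \<open>x \<in> set ys\<close> ys by auto
    have "normalise (cone_over x (cone_over x c)) = 0" for c
      using subset_UNIV by (induction c rule: frag_induction)
        (auto simp: frag_extend_diff cone_diff drop_repeats_def)
    then show ?thesis using ys \<open>y = x\<close>
      by (simp add: cone_diff frag_extend_diff)
  qed
qed simp

text \<open>Degenerate flags span a subcomplex, so the boundary descends to the quotient represented
  by \<open>normalise\<close>.\<close>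

lemma normalise_boundary_normalise:
  assumes "keys c \<subseteq> {xs. sorted_wrt (\<supseteq>) xs}"
  shows "normalise (boundary (normalise c)) = normalise (boundary c)"
proof (rule frag_linear_eq[OF _ _ assms])
  show "Modules.additive (\<lambda>c. normalise (boundary (normalise c)))"
    "Modules.additive (\<lambda>c. normalise (boundary c))"
    by (auto simp: Modules.additive_def frag_extend_add)
  show "normalise (boundary (normalise (frag_of xs))) = normalise (boundary (frag_of xs))"
    if "xs \<in> {xs. sorted_wrt (\<supseteq>) xs}" for xs
    using normalise_face_sum[of xs] that by (auto simp: drop_repeats_def)
qed

lemma normalise_frag_map:
  fixes s :: "'a \<Rightarrow> 'a"
  assumes "inj s"
  shows "normalise (frag_map (map s) c) = frag_map (map s) (normalise c)"
  by (rule frag_map_comm)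
    (use assms in \<open>auto simp: drop_repeats_def distinct_map inj_on_def
       Modules.additive.zero[OF additive_frag_map]\<close>)

lemma length_flag_le_card:
  assumes "sorted_wrt (\<supseteq>) xs" "distinct xs" "\<And>A. A \<in> set xs \<Longrightarrow> A \<noteq> {} \<and> finite A" "xs \<noteq> []"
  shows "length xs \<le> card (hd xs)"
  using assms
proof (induction xs)
  case (Cons x ys)
  show ?case
  proof (cases ys)
    case Nil
    then show ?thesis using Cons.prems(3)[of x] by (simp add: Suc_le_eq card_gt_0_iff)
  next
    case (Cons y zs)
    then have "length ys \<le> card y" using Cons.IH Cons.prems by simp
    moreover have "y \<subset> x" using Cons.prems Cons by auto
    then have "card y < card x" using Cons.prems(3)[of x] by (simp add: psubset_card_mono)
    ultimately show ?thesis by simp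
  qed
qed simp

section \<open>A combinatorial Borsuk--Ulam theorem for cyclic groups\<close>

text \<open>A label \<open>(c, g)\<close> with \<open>g < r\<close> is the element \<open>g\<close> of the \<open>c\<close>-th copy of \<open>\<int>/r\<close> in a join; labels
  with \<open>g \<ge> r\<close> are fixed and serve as a junk value for points that need no label.\<close>

definition rotate_label :: "nat \<Rightarrow> nat \<times> nat \<Rightarrow> nat \<times> nat" where
  "rotate_label r = (\<lambda>(c, g). (c, if g < r then Suc g mod r else g))"

lemma rotate_label_funpow:
  "g < r \<Longrightarrow> (rotate_label r ^^ i) (c, g) = (c, (g + i) mod r)"
  "\<not> g < r \<Longrightarrow> (rotate_label r ^^ i) (c, g) = (c, g)"
  by (induction i) (auto simp: rotate_label_def mod_Suc_eq)

lemma rotate_label_period: "rotate_label r ^^ r = id"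
proof
  fix l :: "nat \<times> nat"
  obtain c g where l: "l = (c, g)" by (cases l)
  show "(rotate_label r ^^ r) l = id l"
    unfolding l by (cases "g < r") (auto simp: rotate_label_funpow)
qed

lemma inj_rotate_label: "0 < r \<Longrightarrow> inj (rotate_label r)"
proof (rule injI)
  fix x y assume r: "0 < r" and eq: "rotate_label r x = rotate_label r y"
  have "(rotate_label r ^^ (r - 1)) (rotate_label r l) = l" for l
  proof -
    have "(rotate_label r ^^ Suc (r - 1)) l = l" using r by (simp only: Suc_diff_1 rotate_label_period id_apply)
    then show ?thesis by (simp only: funpow_Suc_right comp_apply)
  qed
  then show "x = y" using eq by metis
qed

text \<open>Nonempty faces of the join of \<open>m\<close> copies of \<open>\<int>/r\<close>.\<close>

definition join_face :: "nat \<Rightarrow> nat \<Rightarrow> (nat \<times> nat) set \<Rightarrow> bool" where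
  "join_face m r A \<longleftrightarrow> A \<noteq> {} \<and> A \<subseteq> {..<m} \<times> {..<r} \<and> inj_on fst A"

text \<open>The equivariant map to \<open>Z/r\<close> that witnesses freeness: rotation preserves
  the set of copies met by a face, hence its smallest member, and only turns the value
  there.\<close>

definition first_value :: "(nat \<times> nat) set \<Rightarrow> nat" where
  "first_value A = (THE g. ((LEAST c. c \<in> fst ` A), g) \<in> A)"

lemma join_face_finite: "join_face m r A \<Longrightarrow> finite A \<and> card A \<le> m"
proof -
  assume A: "join_face m r A"
  then have "fst ` A \<subseteq> {..<m}" "inj_on fst A" by (auto simp: join_face_def)
  moreover have "finite A"
    using A finite_subset[of A "{..<m} \<times> {..<r}"] by (simp add: join_face_def)
  ultimately show ?thesis using card_inj_on_le[of fst A "{..<m}"] by simp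
qed

lemma join_face_eq: "join_face m r A \<Longrightarrow> (c, g) \<in> A \<Longrightarrow> (c, g') \<in> A \<Longrightarrow> g = g'"
  using inj_onD[of fst A "(c, g)" "(c, g')"] by (simp add: join_face_def)

lemma join_face_rotate:
  assumes "join_face m r A"
  shows "join_face m r (rotate_label r ` A)"
proof -
  have "rotate_label r ` A \<subseteq> {..<m} \<times> {..<r}"
    using assms by (auto simp: join_face_def rotate_label_def)
  moreover have "inj_on fst (rotate_label r ` A)"
  proof (rule inj_onI)
    fix x y assume x: "x \<in> rotate_label r ` A" and y: "y \<in> rotate_label r ` A" and eq: "fst x = fst y"
    obtain c g where g: "(c, g) \<in> A" "x = rotate_label r (c, g)" using x by auto
    obtain c' g' where g': "(c', g') \<in> A" "y = rotate_label r (c', g')" using y by auto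
    have "c = c'" using eq g g' by (simp add: rotate_label_def)
    then show "x = y" using join_face_eq[OF assms, of c g g'] g g' by simp
  qed
  ultimately show ?thesis using assms by (simp add: join_face_def)
qed

lemma inj_image_rotate_label: "0 < r \<Longrightarrow> inj ((`) (rotate_label r))"
  using inj_image_eq_iff[OF inj_rotate_label, of r] by (intro injI) blast

lemma first_value_eqI:
  assumes "join_face m r A" "((LEAST c. c \<in> fst ` A), g) \<in> A"
  shows "first_value A = g"
  unfolding first_value_def
  by (rule the_equality, rule assms(2), rule join_face_eq[OF assms(1) _ assms(2)])

lemma first_value_mem:
  assumes "join_face m r A"
  shows "((LEAST c. c \<in> fst ` A), first_value A) \<in> A"
proof -
  have "(LEAST c. c \<in> fst ` A) \<in> fst ` A"
    by (rule LeastI_ex) (use assms in \<open>auto simp: join_face_def\<close>)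
  then obtain g where "((LEAST c. c \<in> fst ` A), g) \<in> A" by force
  then show ?thesis using first_value_eqI[OF assms] by simp
qed

lemma first_value_rotate:
  assumes "join_face m r A"
  shows "first_value (rotate_label r ` A) = Suc (first_value A) mod r"
proof (rule first_value_eqI[OF join_face_rotate[OF assms]])
  have "fst ` rotate_label r ` A = fst ` A"
    unfolding image_image by (rule image_cong) (auto simp: rotate_label_def)
  moreover have "rotate_label r ((LEAST c. c \<in> fst ` A), first_value A)
      = ((LEAST c. c \<in> fst ` A), Suc (first_value A) mod r)"
    using first_value_mem[OF assms] assms by (auto simp: rotate_label_def join_face_def)
  ultimately show "((LEAST c. c \<in> fst ` rotate_label r ` A), Suc (first_value A) mod r) \<in> rotate_label r ` A"
    using imageI[OF first_value_mem[OF assms], of "rotate_label r"] by (simp only:)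
qed

definition flags :: "nat \<Rightarrow> nat \<Rightarrow> nat \<Rightarrow> (nat \<times> nat) set list set" where
  "flags m r k = {zs. length zs = k \<and> sorted_wrt (\<supseteq>) zs \<and> distinct zs \<and> (\<forall>A\<in>set zs. join_face m r A)}"

text \<open>A strict chain of \<open>n\<close> nonempty sets has a top with at least
  \<open>n\<close> elements, while a face has at most one vertex in each of the \<open>m\<close>
  copies.\<close>

lemma flags_empty: "m < n \<Longrightarrow> flags m r n = {}"
proof (rule ccontr)
  assume n: "m < n" and "flags m r n \<noteq> {}"
  then obtain zs where zs: "length zs = n" "sorted_wrt (\<supseteq>) zs" "distinct zs"
    "\<forall>A\<in>set zs. join_face m r A" by (auto simp: flags_def)
  have "zs \<noteq> []" using zs n by auto
  then have "join_face m r (hd zs)" using zs(4) by simp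
  have fin: "A \<noteq> {} \<and> finite A" if "A \<in> set zs" for A
    using zs(4) that join_face_finite[of m r A] by (auto simp: join_face_def)
  have "length zs \<le> card (hd zs)"
    using zs(2,3) fin \<open>zs \<noteq> []\<close> by (rule length_flag_le_card)
  then have "n \<le> card (hd zs)" using zs(1) by simp
  also have "\<dots> \<le> m" using join_face_finite[OF \<open>join_face m r (hd zs)\<close>] by blast
  finally show False using n by simp
qed

lemma cyclic_set_flags:
  assumes "0 < r"
  shows "cyclic_set (flags m r (Suc k)) (map (image (rotate_label r))) r (\<lambda>zs. first_value (hd zs))"
proof
  fix zs assume zs: "zs \<in> flags m r (Suc k)"
  then obtain A ws where A: "zs = A # ws" "join_face m r A"
    by (auto simp: flags_def length_Suc_conv)
  note inj = inj_image_rotate_label[OF assms]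
  show "map (image (rotate_label r)) zs \<in> flags m r (Suc k)"
  proof -
    have "sorted_wrt (\<lambda>A B. rotate_label r ` B \<subseteq> rotate_label r ` A) zs"
      by (rule sorted_wrt_mono_rel[of _ "(\<supseteq>)"]) (use zs in \<open>auto simp: flags_def\<close>)
    moreover have "inj_on ((`) (rotate_label r)) (set zs)"
      using inj by (rule inj_on_subset) simp
    ultimately show ?thesis
      using zs by (simp add: flags_def sorted_wrt_map distinct_map join_face_rotate)
  qed
  have "(map (image (rotate_label r)) ^^ i) zs = map (image (rotate_label r ^^ i)) zs" for i
    by (induction i) (auto simp: image_image)
  then show "(map (image (rotate_label r)) ^^ r) zs = zs"
    by (simp add: rotate_label_period)
  show "first_value (hd zs) < r"
    using first_value_mem[OF A(2)] A by (auto simp: join_face_def)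
  show "first_value (hd (map (image (rotate_label r)) zs)) = Suc (first_value (hd zs)) mod r"
    using first_value_rotate[OF A(2)] A(1) by simp
qed

text \<open>The labels would carry a resolution of length \<open>n\<close> into a join of
  \<open>m < n\<close> copies. Since labels along a simplex may repeat in any order, the comparison
  is made in flags of label sets: inclusion orders them, and rotation respects inclusion.\<close>

theorem no_join_labelling:
  fixes z :: "nat \<Rightarrow> 'p list \<Rightarrow>\<^sub>0 int" and s :: "'p \<Rightarrow> 'p" and lab :: "'p \<Rightarrow> nat \<times> nat"
  assumes r: "2 \<le> r" and m: "m < n"
    and z0: "z 0 = frag_of []"
    and zlen: "\<And>k. k \<le> n \<Longrightarrow> z k \<in> chains_of_length k"
    and zbd: "\<And>k. k < n \<Longrightarrow> boundary (z (Suc k)) = alternating_op r (frag_map (map s)) k (z k)"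
    and lab_step: "\<And>x. lab (s x) = rotate_label r (lab x)"
    and lab: "\<And>k xs. \<lbrakk>k \<le> n; xs \<in> keys (z k); xs \<noteq> []\<rbrakk> \<Longrightarrow> join_face m r (lab ` set xs)"
  shows False
proof -
  \<comment> \<open>Subdividing with label sets as new vertices amounts to the simplicial map
    \<open>lab\<close> followed by barycentric subdivision of the join.\<close>
  define b where "b xs = lab ` set xs" for xs
  define \<sigma> where "\<sigma> = frag_map (map (image (rotate_label r)))"
  define G :: "nat \<Rightarrow> ((nat \<times> nat) set list \<Rightarrow>\<^sub>0 int) set" where "G k = {c. keys c \<subseteq> flags m r k}" for k
  define Z where "Z k = frag_extend (subdivide b k) (z k)" for k
  define y where "y k = (if k \<le> n then normalise (Z k) else 0)" for k
  have bmap: "b (map s xs) = rotate_label r ` b xs" for xs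
    by (simp add: b_def lab_step image_image)
  have inj: "inj ((`) (rotate_label r))"
    using r by (simp add: inj_image_rotate_label)
  have keysZ: "keys (Z k) \<subseteq> {zs. length zs = k \<and> sorted_wrt (\<supseteq>) zs \<and> (\<forall>A\<in>set zs. join_face m r A)}"
    if k: "k \<le> n" for k
    unfolding Z_def
  proof (rule keys_frag_extend_subset[OF order_refl], rule subsetI)
    fix xs zs assume xs: "xs \<in> keys (z k)" and zs: "zs \<in> keys (subdivide b k xs)"
    have "join_face m r (b ys)" if ys: "set ys \<subseteq> set xs" "ys \<noteq> []" for ys
    proof -
      have "xs \<noteq> []" using ys by auto
      then have "join_face m r (b xs)" using lab[OF k xs] by (simp add: b_def)
      moreover have "b ys \<subseteq> b xs" "b ys \<noteq> {}" using ys by (auto simp: b_def)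
      ultimately show ?thesis unfolding join_face_def
        using inj_on_subset[of fst "b xs" "b ys"] by auto
    qed
    moreover have "b ys \<subseteq> b xs" if "set ys \<subseteq> set xs" for ys xs
      using that by (auto simp: b_def)
    moreover have "length xs = k" using zlen[OF k] xs by (auto simp: chains_of_length_def)
    ultimately have "length zs = k \<and> sorted_wrt (\<supseteq>) zs \<and> (\<forall>A\<in>set zs. A \<subseteq> b xs \<and> join_face m r A)"
      using zs by (intro keys_subdivide_flag) auto
    then show "zs \<in> {zs. length zs = k \<and> sorted_wrt (\<supseteq>) zs \<and> (\<forall>A\<in>set zs. join_face m r A)}"
      by simp
  qed
  have norm_flags: "keys (normalise c) \<subseteq> flags m r k"
    if "keys c \<subseteq> {zs. length zs = k \<and> sorted_wrt (\<supseteq>) zs \<and> (\<forall>A\<in>set zs. join_face m r A)}" for c k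
    by (rule keys_frag_extend_subset[OF that]) (auto simp: drop_repeats_def flags_def)
  have bd_flags: "keys (boundary c) \<subseteq> {zs. length zs = k \<and> sorted_wrt (\<supseteq>) zs \<and> (\<forall>A\<in>set zs. join_face m r A)}"
    if "c \<in> G (Suc k)" for c k
  proof (rule keys_frag_extend_subset[of _ "flags m r (Suc k)"])
    show "keys c \<subseteq> flags m r (Suc k)" using that by (simp add: G_def)
    show "keys (face_sum xs) \<subseteq> {zs. length zs = k \<and> sorted_wrt (\<supseteq>) zs \<and> (\<forall>A\<in>set zs. join_face m r A)}"
      if "xs \<in> flags m r (Suc k)" for xs
    proof
      fix zs assume zs: "zs \<in> keys (face_sum xs)"
      have "sorted_wrt (\<supseteq>) xs" using that by (simp add: flags_def)
      then have "sorted_wrt (\<supseteq>) zs" using zs by (rule sorted_wrt_face_sum)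
      then show "zs \<in> {zs. length zs = k \<and> sorted_wrt (\<supseteq>) zs \<and> (\<forall>A\<in>set zs. join_face m r A)}"
        using keys_face_sum[OF zs] that by (auto simp: flags_def)
    qed
  qed
  have "\<exists>w\<in>G 1. y 0 = orbit_sum r \<sigma> (normalise (boundary w))"
  proof (rule resolution_descent[where G = G and n = n and D = "\<lambda>c. normalise (boundary c)"])
    show "Modules.additive (\<lambda>c. normalise (boundary c))"
      by (simp add: Modules.additive_def frag_extend_add)
    show "Modules.additive \<sigma>" unfolding \<sigma>_def by (rule additive_frag_map)
    show "normalise (boundary (\<sigma> c)) = \<sigma> (normalise (boundary c))" for c
      unfolding \<sigma>_def by (simp add: boundary_frag_map normalise_frag_map[OF inj])
    show "0 \<in> G k" for k by (simp add: G_def)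
    show "a - b \<in> G k" if "a \<in> G k" "b \<in> G k" for k a b
      using that unfolding G_def mem_Collect_eq by (rule keys_diff_subset)
    show "normalise (boundary c) \<in> G k" if "c \<in> G (Suc k)" for k c
      unfolding G_def mem_Collect_eq by (rule norm_flags[OF bd_flags[OF that]])
    show "normalise (boundary (normalise (boundary c))) = 0" if "c \<in> G (Suc k)" for k c
    proof -
      have "keys (boundary c) \<subseteq> {zs. sorted_wrt (\<supseteq>) zs}" using bd_flags[OF that] by blast
      then show ?thesis by (simp only: normalise_boundary_normalise boundary_boundary frag_extend_0)
    qed
    show "\<exists>w\<in>G (Suc k). c = one_minus \<sigma> w" if c: "c \<in> G (Suc k)" "orbit_sum r \<sigma> c = 0" for k c
    proof -
      have "0 < r" and keysc: "keys c \<subseteq> flags m r (Suc k)" using r c(1) by (auto simp: G_def)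
      from cyclic_set.orbit_sum_eq_0[OF cyclic_set_flags[OF this(1)] keysc c(2)[unfolded \<sigma>_def]]
      show ?thesis by (auto simp: G_def \<sigma>_def)
    qed
    show "\<exists>w\<in>G (Suc k). c = orbit_sum r \<sigma> w" if c: "c \<in> G (Suc k)" "one_minus \<sigma> c = 0" for k c
    proof -
      have "0 < r" and keysc: "keys c \<subseteq> flags m r (Suc k)" using r c(1) by (auto simp: G_def)
      from cyclic_set.one_minus_eq_0[OF cyclic_set_flags[OF this(1)] keysc c(2)[unfolded \<sigma>_def]]
      show ?thesis by (auto simp: G_def \<sigma>_def)
    qed
    show "y k \<in> G k" for k
      unfolding y_def G_def by (simp add: norm_flags[OF keysZ])
    show "normalise (boundary (y (Suc k))) = alternating_op r \<sigma> k (y k)" if k: "k < n" for k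
    proof -
      have "normalise (boundary (y (Suc k))) = normalise (boundary (Z (Suc k)))"
      proof -
        have "keys (Z (Suc k)) \<subseteq> {zs. sorted_wrt (\<supseteq>) zs}" using keysZ[of "Suc k"] k by auto
        then show ?thesis using k by (simp add: y_def normalise_boundary_normalise)
      qed
      also have "\<dots> = normalise (frag_extend (subdivide b k) (boundary (z (Suc k))))"
        using zlen[of "Suc k"] k unfolding Z_def by (subst boundary_subdivide) auto
      also have "\<dots> = alternating_op r \<sigma> k (y k)"
      proof -
        have "normalise (frag_extend (subdivide b k) (alternating_op r (frag_map (map s)) k (z k)))
            = alternating_op r \<sigma> k (normalise (frag_extend (subdivide b k) (z k)))"
        proof (rule alternating_op_commute)
          show "Modules.additive (\<lambda>c. normalise (frag_extend (subdivide b k) c))"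
            by (simp add: Modules.additive_def frag_extend_add)
          show "normalise (frag_extend (subdivide b k) (frag_map (map s) c))
              = \<sigma> (normalise (frag_extend (subdivide b k) c))" for c
            unfolding \<sigma>_def
            by (simp add: subdivide_frag_map[where b = b and s = s and s' = "image (rotate_label r)", OF bmap]
                normalise_frag_map[OF inj])
        qed
        then show ?thesis using k zbd by (simp add: y_def Z_def)
      qed
      finally show ?thesis .
    qed
    show "0 < n" using m by simp
    have "keys (y n) = {}" using norm_flags[OF keysZ[of n]] flags_empty[OF m] by (simp add: y_def)
    then show "y n = 0" by simp
  qed
  then obtain w where w: "w \<in> G 1" "y 0 = orbit_sum r \<sigma> (normalise (boundary w))" by blast
  define u where "u = normalise (boundary w)"
  have "keys u \<subseteq> flags m r 0"
    unfolding u_def by (rule norm_flags[OF bd_flags]) (use w(1) in simp)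
  \<comment> \<open>Only the empty flag has length \<open>0\<close>, and rotation fixes it. So the
    orbit sum multiplies by \<open>r\<close>, although \<open>y 0\<close> has coefficient
    \<open>1\<close> there.\<close>
  then have "keys u \<subseteq> {[]}" by (auto simp: flags_def)
  then have "\<sigma> u = id u"
  proof (rule frag_linear_eq[rotated 2])
    show "Modules.additive \<sigma>" unfolding \<sigma>_def by (rule additive_frag_map)
  qed (simp_all add: \<sigma>_def Modules.additive_def)
  then have "\<sigma> u = u" by simp
  then have "(\<sigma> ^^ i) u = u" for i by (induction i) simp_all
  then have "y 0 = (\<Sum>i<r. u)" using w(2) by (simp add: orbit_sum_def u_def)
  moreover have "poly_mapping.lookup (y 0) [] = 1" by (simp add: y_def Z_def z0 drop_repeats_def)
  ultimately have "poly_mapping.lookup (\<Sum>i<r. u) [] = 1" by (simp only:)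
  then have "int r * poly_mapping.lookup u [] = 1" by (simp add: lookup_sum)
  then have "int r dvd int 1" by (metis dvd_triv_left of_nat_1)
  then have "r dvd 1" by (simp only: int_dvd_int_iff)
  then show False using r by simp
qed

section \<open>Subdividing the complex of rainbow faces\<close>

definition barycentre :: "(nat \<Rightarrow> real) list \<Rightarrow> nat \<Rightarrow> real" where
  "barycentre xs v = (\<Sum>i<length xs. (xs ! i) v) / real (length xs)"

text \<open>An induction principle in which \<open>Q\<close> stands for membership in a convex set;
  used for faces of the simplex and for coordinate-wise balls.\<close>

lemma subdivide_barycentre_convex:
  assumes Q: "\<And>ys. ys \<noteq> [] \<Longrightarrow> (\<And>y. y \<in> set ys \<Longrightarrow> Q y) \<Longrightarrow> Q (barycentre ys)"
    and "\<And>x. x \<in> set xs \<Longrightarrow> Q x" "length xs = k"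
    and "zs \<in> keys (subdivide barycentre k xs)" "z \<in> set zs"
  shows "Q z"
  using assms(2-)
proof (induction k arbitrary: xs zs z)
  case 0
  then show ?case by simp
next
  case (Suc k)
  obtain ys ws where z: "zs = barycentre xs # ws" "ys \<in> keys (face_sum xs)"
    "ws \<in> keys (subdivide barycentre k ys)"
    using keys_subdivide_Suc Suc.prems(3) by blast
  have ys: "length ys = k" "set ys \<subseteq> set xs" using keys_face_sum[OF z(2)] Suc.prems(2) by auto
  show ?case
  proof (cases "z = barycentre xs")
    case True
    have "xs \<noteq> []" using Suc.prems(2) by auto
    then have "Q (barycentre xs)" using Suc.prems(1) by (rule Q)
    then show ?thesis using True by simp
  next
    case False
    then have "z \<in> set ws" using z(1) Suc.prems(4) by simp
    then show ?thesis using Suc.IH[OF _ ys(1) z(3)] Suc.prems(1) ys(2) by blast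
  qed
qed

text \<open>Diameter is measured coordinate by coordinate, where averages are easy to estimate;
  \<open>dist_fun_le_of_coordinates\<close> later converts to the metric of the function
  space.\<close>

definition within_mesh :: "real \<Rightarrow> (nat \<Rightarrow> real) set \<Rightarrow> bool" where
  "within_mesh \<delta> A \<longleftrightarrow> (\<forall>x\<in>A. \<forall>y\<in>A. \<forall>v. \<bar>x v - y v\<bar> \<le> \<delta>)"

text \<open>\<open>x\<close> is itself one of the \<open>k\<close> points averaged and contributes
  \<open>0\<close>, which is the source of the factor \<open>(k - 1) / k\<close>.\<close>

lemma barycentre_dist_vertex:
  assumes "within_mesh \<delta> (set xs)" "x \<in> set xs" "length xs = k"
  shows "\<bar>x v - barycentre xs v\<bar> \<le> (1 - 1 / real k) * \<delta>"
proof -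
  obtain i where i: "i < k" "x = xs ! i" using assms(2,3) by (metis in_set_conv_nth)
  then have k: "0 < real k" by simp
  have "x v - barycentre xs v = (\<Sum>j<k. x v - (xs ! j) v) / real k"
    using k assms(3) by (simp add: barycentre_def sum_subtractf field_simps)
  also have "(\<Sum>j<k. x v - (xs ! j) v) = (\<Sum>j\<in>{..<k} - {i}. x v - (xs ! j) v)"
    using i by (subst sum.remove[of _ i]) auto
  finally have eq: "\<bar>x v - barycentre xs v\<bar> = \<bar>\<Sum>j\<in>{..<k} - {i}. x v - (xs ! j) v\<bar> / real k"
    using k by simp
  have "\<bar>\<Sum>j\<in>{..<k} - {i}. x v - (xs ! j) v\<bar> \<le> (\<Sum>j\<in>{..<k} - {i}. \<delta>)"
    by (rule sum_norm_le[where 'a = real, unfolded real_norm_def])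
      (use assms in \<open>auto simp: within_mesh_def\<close>)
  also have "(\<Sum>j\<in>{..<k} - {i}. \<delta>) = (real k - 1) * \<delta>"
    using i by (simp add: of_nat_diff)
  finally have "\<bar>x v - barycentre xs v\<bar> \<le> (real k - 1) * \<delta> / real k"
    using k unfolding eq by (intro divide_right_mono) simp_all
  then show ?thesis using k by (simp add: field_simps)
qed

text \<open>Either one of the two new vertices is the barycentre of the whole simplex, which is
  close to every convex combination of its vertices, or both come from a proper face, where
  induction gives an even smaller factor.\<close>

lemma within_mesh_subdivide:
  assumes "within_mesh \<delta> (set xs)" "0 \<le> \<delta>" "length xs = k" "zs \<in> keys (subdivide barycentre k xs)"
  shows "within_mesh ((1 - 1 / real k) * \<delta>) (set zs)"
  using assms(1,3,4)
proof (induction k arbitrary: xs zs)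
  case 0
  then show ?case by (simp add: within_mesh_def)
next
  case (Suc k)
  let ?\<eta> = "(1 - 1 / real (Suc k)) * \<delta>"
  obtain ys ws where z: "zs = barycentre xs # ws" "ys \<in> keys (face_sum xs)"
    "ws \<in> keys (subdivide barycentre k ys)"
    using keys_subdivide_Suc Suc.prems(3) by blast
  have ys: "length ys = k" "set ys \<subseteq> set xs" using keys_face_sum[OF z(2)] Suc.prems(2) by auto
  have "within_mesh \<delta> (set ys)" using Suc.prems(1) ys(2) unfolding within_mesh_def by blast
  then have ws: "within_mesh ((1 - 1 / real k) * \<delta>) (set ws)" by (rule Suc.IH) (use ys z in auto)
  have near: "\<bar>w v - barycentre xs v\<bar> \<le> ?\<eta>" if "w \<in> set ws" for w v
  proof (rule subdivide_barycentre_convex[where Q = "\<lambda>w. \<bar>w v - barycentre xs v\<bar> \<le> ?\<eta>"])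
    show "\<bar>y v - barycentre xs v\<bar> \<le> ?\<eta>" if "y \<in> set ys" for y
      using barycentre_dist_vertex[OF Suc.prems(1) _ Suc.prems(2)] ys(2) that by blast
    show "\<bar>barycentre us v - barycentre xs v\<bar> \<le> ?\<eta>"
      if us: "us \<noteq> []" "\<And>y. y \<in> set us \<Longrightarrow> \<bar>y v - barycentre xs v\<bar> \<le> ?\<eta>" for us
    proof -
      let ?l = "length us"
      have l: "0 < real ?l" using us(1) by simp
      have "barycentre us v - barycentre xs v = (\<Sum>i<?l. (us ! i) v - barycentre xs v) / real ?l"
        using l by (simp add: barycentre_def[of us] sum_subtractf field_simps)
      moreover have "\<bar>\<Sum>i<?l. (us ! i) v - barycentre xs v\<bar> \<le> (\<Sum>i<?l. ?\<eta>)"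
        by (rule sum_norm_le[where 'a = real, unfolded real_norm_def]) (use us(2) in simp)
      moreover have "(\<Sum>i<?l. ?\<eta>) = real ?l * ?\<eta>" by simp
      ultimately show ?thesis using l
        by (simp only: abs_divide abs_of_nonneg[OF less_imp_le[OF l]] pos_divide_le_eq mult.commute)
    qed
  qed (use ys z that in auto)
  have le: "(1 - 1 / real k) * \<delta> \<le> ?\<eta>" if "ws \<noteq> []"
  proof (rule mult_right_mono)
    have "length ws = k" using subdivide_chains_of_length[of barycentre k "frag_of ys"] z(3)
      by (auto simp: chains_of_length_def)
    then have "0 < k" using that by auto
    then show "1 - 1 / real k \<le> 1 - 1 / real (Suc k)" by (simp add: frac_le)
  qed (use assms(2) in simp)
  have nonneg: "0 \<le> ?\<eta>" using assms(2) by simp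
  show ?case unfolding within_mesh_def
  proof (intro ballI allI)
    fix x y v assume "x \<in> set zs" "y \<in> set zs"
    then consider "x = barycentre xs" "y = barycentre xs" | "x = barycentre xs" "y \<in> set ws"
      | "x \<in> set ws" "y = barycentre xs" | "x \<in> set ws" "y \<in> set ws"
      using z(1) by auto
    then show "\<bar>x v - y v\<bar> \<le> ?\<eta>"
    proof cases
      case 1
      then show ?thesis using nonneg by simp
    next
      case 2
      then show ?thesis using near[of y v] by (simp add: abs_minus_commute)
    next
      case 3
      then show ?thesis using near[of x v] by simp
    next
      case 4
      then have "\<bar>x v - y v\<bar> \<le> (1 - 1 / real k) * \<delta>" using ws unfolding within_mesh_def by blast
      also have "\<dots> \<le> ?\<eta>" by (rule le) (use 4 in auto)
      finally show ?thesis .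
    qed
  qed
qed

lemma barycentre_simplex_face:
  assumes "ys \<noteq> []" "\<And>y. y \<in> set ys \<Longrightarrow> y \<in> simplex_face N S"
  shows "barycentre ys \<in> simplex_face N S"
proof -
  let ?l = "length ys"
  have l: "0 < real ?l" using assms(1) by simp
  have y: "ys ! i \<in> standard_simplex N" "v \<notin> S \<Longrightarrow> (ys ! i) v = 0" if "i < ?l" for i v
    using assms(2)[OF nth_mem[OF that]] by (auto simp: simplex_face_def)
  have y01: "0 \<le> (ys ! i) v" "(ys ! i) v \<le> 1" and yN: "v > N \<Longrightarrow> (ys ! i) v = 0"
    and y1: "(\<Sum>v\<le>N. (ys ! i) v) = 1" if "i < ?l" for i v
    using y(1)[OF that] by (auto simp: standard_simplex_def)
  have "(\<Sum>i<?l. (ys ! i) v) \<le> (\<Sum>i<?l. 1)" for v by (rule sum_mono) (use y01 in simp)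
  then have "barycentre ys v \<le> 1" for v using l by (simp add: barycentre_def)
  moreover have "0 \<le> barycentre ys v" for v
    using y01 by (auto simp: barycentre_def intro!: divide_nonneg_nonneg sum_nonneg)
  moreover have "(\<Sum>v\<le>N. barycentre ys v) = 1"
  proof -
    have "(\<Sum>v\<le>N. barycentre ys v) = (\<Sum>v\<le>N. \<Sum>i<?l. (ys ! i) v) / real ?l"
      by (simp add: barycentre_def sum_divide_distrib)
    also have "(\<Sum>v\<le>N. \<Sum>i<?l. (ys ! i) v) = (\<Sum>i<?l. 1)"
      by (subst sum.swap) (simp add: y1)
    finally show ?thesis using l by simp
  qed
  ultimately show ?thesis
    by (simp add: simplex_face_def standard_simplex_def barycentre_def y(2) yN)
qed

section \<open>The cyclic shift on the complex of rainbow faces\<close>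

locale rainbow_shift =
  fixes N n r :: nat and C :: "nat \<Rightarrow> nat set" and \<tau> :: "nat \<Rightarrow> nat"
  assumes classes: "color_classes N n r C"
    and r: "2 \<le> r"
    and \<tau>_class: "i \<in> {1..n} \<Longrightarrow> v \<in> C i \<Longrightarrow> \<tau> v \<in> C i"
    and \<tau>_outside: "N < v \<Longrightarrow> \<tau> v = v"
    and \<tau>_period: "(\<tau> ^^ r) v = v"
    and \<tau>_free: "v \<le> N \<Longrightarrow> 0 < j \<Longrightarrow> j < r \<Longrightarrow> (\<tau> ^^ j) v \<noteq> v"
begin

definition shift :: "(nat \<Rightarrow> real) \<Rightarrow> nat \<Rightarrow> real" where
  "shift x v = x (\<tau> v)"

text \<open>Geometrically the join of the \<open>n\<close> colour classes, each a discrete set of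
  \<open>r\<close> points.\<close>

definition rainbow_complex :: "(nat \<Rightarrow> real) set" where
  "rainbow_complex = {x. \<exists>S. rainbow N n C S \<and> x \<in> simplex_face N S}"

definition vertex_point :: "nat \<Rightarrow> nat \<Rightarrow> real" where
  "vertex_point v = (\<lambda>u. if u = v then 1 else 0)"

lemma class_subset: "i \<in> {1..n} \<Longrightarrow> C i \<subseteq> {..N}"
  using classes by (auto simp: color_classes_def)

lemma class_eq: "i \<in> {1..n} \<Longrightarrow> j \<in> {1..n} \<Longrightarrow> v \<in> C i \<Longrightarrow> v \<in> C j \<Longrightarrow> i = j"
  using classes unfolding color_classes_def disjoint_family_on_def by blast

lemma class_nonempty: "i \<in> {1..n} \<Longrightarrow> C i \<noteq> {}"
proof -
  assume "i \<in> {1..n}"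
  then have "card (C i) = r" using classes unfolding color_classes_def by blast
  then show ?thesis using r by auto
qed

lemma class_ex: "v \<le> N \<Longrightarrow> \<exists>i\<in>{1..n}. v \<in> C i"
  using classes unfolding color_classes_def by blast

lemma \<tau>_funpow_class: "i \<in> {1..n} \<Longrightarrow> v \<in> C i \<Longrightarrow> (\<tau> ^^ j) v \<in> C i"
  by (induction j) (auto intro: \<tau>_class)

lemma \<tau>_inverse: "(\<tau> ^^ (r - 1)) (\<tau> v) = v" "\<tau> ((\<tau> ^^ (r - 1)) v) = v"
proof -
  have "(\<tau> ^^ Suc (r - 1)) v = v" using r \<tau>_period[of v] by simp
  then show "(\<tau> ^^ (r - 1)) (\<tau> v) = v" "\<tau> ((\<tau> ^^ (r - 1)) v) = v"
    by (simp only: funpow_Suc_right comp_apply, simp only: funpow.simps(2) comp_apply)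
qed

text \<open>The shift precomposes coordinates with \<open>\<tau>\<close>, so vertices move by the
  inverse of \<open>\<tau>\<close>, which the period writes as the power
  \<open>r - 1\<close>.\<close>

lemma shift_vertex_point: "shift (vertex_point v) = vertex_point ((\<tau> ^^ (r - 1)) v)"
proof
  fix u
  have "\<tau> u = v \<longleftrightarrow> u = (\<tau> ^^ (r - 1)) v" using \<tau>_inverse(1)[of u] \<tau>_inverse(2)[of v] by auto
  then show "shift (vertex_point v) u = vertex_point ((\<tau> ^^ (r - 1)) v) u"
    by (simp only: shift_def vertex_point_def)
qed

lemma rainbow_range:
  assumes "\<And>i. i \<in> {1..n} \<Longrightarrow> w i \<in> C i"
  shows "rainbow N n C (w ` {1..n})"
proof -
  have "w ` {1..n} \<inter> C i = {w i}" if "i \<in> {1..n}" for i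
    using assms class_eq that by blast
  moreover have "w ` {1..n} \<subseteq> {..N}" using assms class_subset by blast
  ultimately show ?thesis by (simp add: rainbow_def)
qed

lemma vertex_point_face: "v \<in> S \<Longrightarrow> v \<le> N \<Longrightarrow> vertex_point v \<in> simplex_face N S"
  by (auto simp: simplex_face_def vertex_point_def)

definition base_point :: "nat \<Rightarrow> nat" where
  "base_point i = (SOME v. v \<in> C i)"

lemma base_point: "i \<in> {1..n} \<Longrightarrow> base_point i \<in> C i"
  unfolding base_point_def using class_nonempty by (simp add: some_in_eq)

fun rainbow_list :: "nat \<Rightarrow> (nat \<Rightarrow> real) list \<Rightarrow> bool" where
  "rainbow_list 0 xs \<longleftrightarrow> xs = []"
| "rainbow_list (Suc k) xs \<longleftrightarrow> (\<exists>v ys. xs = vertex_point v # ys \<and> v \<in> C (Suc k) \<and> rainbow_list k ys)"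

lemma rainbow_list_shift: "k \<le> n \<Longrightarrow> rainbow_list k xs \<Longrightarrow> rainbow_list k (map shift xs)"
proof (induction k arbitrary: xs)
  case (Suc k)
  then obtain v ys where xs: "xs = vertex_point v # ys" "v \<in> C (Suc k)" "rainbow_list k ys" by auto
  have "rainbow_list k (map shift ys)" using Suc.IH[OF _ xs(3)] Suc.prems(1) by simp
  moreover have "(\<tau> ^^ (r - 1)) v \<in> C (Suc k)" using xs Suc.prems by (intro \<tau>_funpow_class) auto
  moreover have "map shift xs = vertex_point ((\<tau> ^^ (r - 1)) v) # map shift ys"
    by (simp only: xs(1) list.map shift_vertex_point)
  ultimately show ?case unfolding rainbow_list.simps by (intro exI conjI)
qed simp

lemma rainbow_list_length: "rainbow_list k xs \<Longrightarrow> length xs = k"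
  by (induction k arbitrary: xs) auto

lemma rainbow_list_vertices:
  "k \<le> n \<Longrightarrow> rainbow_list k xs \<Longrightarrow>
    \<exists>w. (\<forall>i\<in>{1..n}. w i \<in> C i) \<and> set xs \<subseteq> vertex_point ` w ` {1..k}"
proof (induction k arbitrary: xs)
  case 0
  then show ?case using base_point by (auto intro!: exI[of _ base_point])
next
  case (Suc k)
  then obtain v ys where xs: "xs = vertex_point v # ys" "v \<in> C (Suc k)" "rainbow_list k ys" by auto
  obtain w where w: "\<forall>i\<in>{1..n}. w i \<in> C i" "set ys \<subseteq> vertex_point ` w ` {1..k}"
    using Suc.IH[OF _ xs(3)] Suc.prems(1) by auto
  let ?w = "w(Suc k := v)"
  have eq: "?w ` {1..Suc k} = insert v (w ` {1..k})"
    by (simp add: atLeastAtMostSuc_conv image_insert del: fun_upd_apply) (auto simp: image_iff)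
  have "\<forall>i\<in>{1..n}. ?w i \<in> C i" using w(1) xs(2) by simp
  moreover have "set xs \<subseteq> vertex_point ` ?w ` {1..Suc k}"
    unfolding eq using w(2) xs(1) by auto
  ultimately show ?case by blast
qed

lemma rainbow_list_face:
  assumes "k \<le> n" "rainbow_list k xs"
  shows "\<exists>S. rainbow N n C S \<and> set xs \<subseteq> simplex_face N S"
proof -
  obtain w where w: "\<forall>i\<in>{1..n}. w i \<in> C i" "set xs \<subseteq> vertex_point ` w ` {1..k}"
    using rainbow_list_vertices[OF assms] by blast
  have "vertex_point (w i) \<in> simplex_face N (w ` {1..n})" if "i \<in> {1..k}" for i
    using that assms(1) w(1) class_subset[of i] by (intro vertex_point_face) auto
  then have "set xs \<subseteq> simplex_face N (w ` {1..n})" using w(2) by auto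
  then show ?thesis using rainbow_range[of w] w(1) by blast
qed

text \<open>The equivariant resolution of a point inside the complex of rainbow faces: each step
  cones off the previous cycle with a vertex of the next colour.\<close>

primrec resolution_chain :: "nat \<Rightarrow> (nat \<Rightarrow> real) list \<Rightarrow>\<^sub>0 int" where
  "resolution_chain 0 = frag_of []"
| "resolution_chain (Suc k) = cone_over (vertex_point (base_point (Suc k)))
     (alternating_op r (frag_map (map shift)) k (resolution_chain k))"

lemma shift_funpow: "(shift ^^ i) x v = x ((\<tau> ^^ i) v)"
  by (induction i arbitrary: v) (simp_all add: shift_def funpow_swap1[of \<tau>])

lemma shift_period: "(frag_map (map shift) ^^ r) c = c"
proof -
  have map: "(map shift ^^ i) xs = map (shift ^^ i) xs" for i xs
    by (induction i) simp_all
  have "(shift ^^ r) x = x" for x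
    by (rule ext) (simp only: shift_funpow \<tau>_period)
  then have "(map shift ^^ r) xs = xs" for xs
    unfolding map by (simp only: map_idI)
  then show ?thesis unfolding frag_map_funpow by (simp only: frag_map_def frag_extend_ident)
qed

text \<open>Coning inverts the boundary on cycles only. The chain coned off is a cycle because
  consecutive operators compose to \<open>0\<close>, and in the lowest degree because the shift
  fixes the empty list.\<close>

lemma boundary_resolution_chain:
  "boundary (resolution_chain (Suc k)) = alternating_op r (frag_map (map shift)) k (resolution_chain k)"
proof (induction k)
  case 0
  show ?case by (simp add: alternating_op_def)
next
  case (Suc k)
  let ?\<sigma> = "frag_map (map shift)"
  let ?e = "resolution_chain k"
  have "boundary (alternating_op r ?\<sigma> (Suc k) (resolution_chain (Suc k)))
      = alternating_op r ?\<sigma> (Suc k) (boundary (resolution_chain (Suc k)))"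
    by (rule alternating_op_commute[where L = boundary], rule additive_frag_extend, rule boundary_frag_map)
  also have "\<dots> = alternating_op r ?\<sigma> (Suc k) (alternating_op r ?\<sigma> k ?e)"
    by (simp only: Suc.IH)
  also have "\<dots> = 0"
  proof -
    consider "k = 0" | "k \<noteq> 0" "odd k" | "k \<noteq> 0" "even k" by blast
    then show ?thesis
    proof cases
      case 1
      have "frag_map (map shift) (frag_of []) = frag_of []" by (simp only: frag_map_of list.map)
      then show ?thesis unfolding 1 by (simp add: alternating_op_def one_minus_def)
    next
      case 2
      have "orbit_sum r ?\<sigma> (one_minus ?\<sigma> ?e) = 0"
        by (rule orbit_sum_one_minus[OF additive_frag_map shift_period])
      then show ?thesis using 2 by (simp add: alternating_op_def)
    next
      case 3
      have "one_minus ?\<sigma> (orbit_sum r ?\<sigma> ?e) = 0"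
        by (rule one_minus_orbit_sum[OF additive_frag_map shift_period])
      then show ?thesis using 3 by (simp add: alternating_op_def)
    qed
  qed
  finally have zero: "boundary (alternating_op r ?\<sigma> (Suc k) (resolution_chain (Suc k))) = 0" .
  show ?case unfolding resolution_chain.simps(2)[of "Suc k"] boundary_cone zero cone_0 diff_zero ..
qed

lemma keys_alternating_op:
  assumes "\<And>xs. xs \<in> X \<Longrightarrow> map shift xs \<in> X" "keys c \<subseteq> X"
  shows "keys (alternating_op r (frag_map (map shift)) k c) \<subseteq> X"
proof -
  have step: "keys (frag_map (map shift) c) \<subseteq> X" if "keys c \<subseteq> X" for c
    unfolding frag_map_def by (rule keys_frag_extend_subset[OF that]) (simp add: assms(1))
  have "keys ((frag_map (map shift) ^^ i) c) \<subseteq> X" for i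
  proof (induction i)
    case (Suc i)
    show ?case unfolding funpow.simps(2) comp_apply by (rule step[OF Suc])
  qed (simp only: funpow_0 assms(2))
  then have "keys (orbit_sum r (frag_map (map shift)) c) \<subseteq> X"
    unfolding orbit_sum_def by (intro keys_sum_subset)
  moreover have "keys (one_minus (frag_map (map shift)) c) \<subseteq> X"
    unfolding one_minus_def by (rule keys_diff_subset[OF assms(2) step[OF assms(2)]])
  ultimately show ?thesis using assms(2) by (simp add: alternating_op_def)
qed

lemma keys_resolution_chain: "k \<le> n \<Longrightarrow> keys (resolution_chain k) \<subseteq> {xs. rainbow_list k xs}"
proof (induction k)
  case (Suc k)
  let ?c = "alternating_op r (frag_map (map shift)) k (resolution_chain k)"
  have "keys ?c \<subseteq> {xs. rainbow_list k xs}"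
    by (rule keys_alternating_op) (use Suc rainbow_list_shift in auto)
  moreover have "base_point (Suc k) \<in> C (Suc k)" using Suc.prems by (intro base_point) simp
  ultimately have "rainbow_list (Suc k) (vertex_point (base_point (Suc k)) # ys)" if "ys \<in> keys ?c" for ys
    using that by auto
  then show ?case unfolding resolution_chain.simps(2)
    using keys_cone[of "vertex_point (base_point (Suc k))" ?c] by blast
qed simp

section \<open>Iterated subdivision of the resolution\<close>

definition fine_chain :: "nat \<Rightarrow> nat \<Rightarrow> (nat \<Rightarrow> real) list \<Rightarrow>\<^sub>0 int" where
  "fine_chain q k = (frag_extend (subdivide barycentre k) ^^ q) (resolution_chain k)"

definition fine_cell :: "nat \<Rightarrow> nat \<Rightarrow> (nat \<Rightarrow> real) list \<Rightarrow> bool" where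
  "fine_cell q k xs \<longleftrightarrow> length xs = k \<and> within_mesh ((1 - 1 / real k) ^ q) (set xs) \<and>
     (\<exists>S. rainbow N n C S \<and> set xs \<subseteq> simplex_face N S)"

lemma keys_fine_chain: "k \<le> n \<Longrightarrow> keys (fine_chain q k) \<subseteq> {xs. fine_cell q k xs}"
proof (induction q)
  case 0
  have "fine_cell 0 k xs" if "rainbow_list k xs" for xs
  proof -
    obtain S where S: "rainbow N n C S" "set xs \<subseteq> simplex_face N S"
      using rainbow_list_face[OF 0 \<open>rainbow_list k xs\<close>] by blast
    have "\<bar>x v - y v\<bar> \<le> 1" if "x \<in> set xs" "y \<in> set xs" for x y v
    proof -
      have "x \<in> standard_simplex N" "y \<in> standard_simplex N"
        using that S(2) by (auto simp: simplex_face_def)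
      then have "0 \<le> x v \<and> x v \<le> 1" "0 \<le> y v \<and> y v \<le> 1"
        by (simp_all add: standard_simplex_def)
      then show ?thesis by linarith
    qed
    then show ?thesis using S rainbow_list_length[OF that] by (auto simp: fine_cell_def within_mesh_def)
  qed
  then show ?case using keys_resolution_chain[OF 0] by (auto simp: fine_chain_def)
next
  case (Suc q)
  have "fine_cell (Suc q) k zs" if xs: "fine_cell q k xs" and zs: "zs \<in> keys (subdivide barycentre k xs)" for xs zs
  proof -
    obtain S where S: "rainbow N n C S" "set xs \<subseteq> simplex_face N S" and len: "length xs = k"
      and mesh: "within_mesh ((1 - 1 / real k) ^ q) (set xs)"
      using xs unfolding fine_cell_def by blast
    have "0 \<le> (1 - 1 / real k) ^ q" by (cases "k = 0") simp_all
    then have "within_mesh ((1 - 1 / real k) ^ Suc q) (set zs)"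
      using within_mesh_subdivide[OF mesh _ len zs] by simp
    moreover have "z \<in> simplex_face N S" if "z \<in> set zs" for z
      by (rule subdivide_barycentre_convex[where Q = "\<lambda>x. x \<in> simplex_face N S", OF barycentre_simplex_face _ len zs that])
        (use S(2) in auto)
    moreover have "length zs = k"
      using subdivide_chains_of_length[of barycentre k "frag_of xs"] zs by (auto simp: chains_of_length_def)
    ultimately show ?thesis using S(1) unfolding fine_cell_def by blast
  qed
  then have "keys (subdivide barycentre k xs) \<subseteq> {xs. fine_cell (Suc q) k xs}" if "fine_cell q k xs" for xs
    using that by blast
  moreover have "fine_chain (Suc q) k = frag_extend (subdivide barycentre k) (fine_chain q k)"
    by (simp only: fine_chain_def funpow.simps(2) comp_apply)
  ultimately show ?case
    using keys_frag_extend_subset[OF Suc.IH[OF Suc.prems], of "subdivide barycentre k"] by simp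
qed

lemma barycentre_shift: "barycentre (map shift xs) = shift (barycentre xs)"
  by (rule ext) (simp add: barycentre_def shift_def)

lemma boundary_fine_chain:
  assumes "k < n"
  shows "boundary (fine_chain q (Suc k)) = alternating_op r (frag_map (map shift)) k (fine_chain q k)"
proof (induction q)
  case 0
  show ?case by (simp only: fine_chain_def funpow_0 boundary_resolution_chain)
next
  case (Suc q)
  have chain: "fine_chain q (Suc k) \<in> chains_of_length (Suc k)"
    using keys_fine_chain[of "Suc k" q] assms by (auto simp: chains_of_length_def fine_cell_def)
  have Suc_eq: "fine_chain (Suc q) k = frag_extend (subdivide barycentre k) (fine_chain q k)" for k
    by (simp only: fine_chain_def funpow.simps(2) comp_apply)
  have "boundary (fine_chain (Suc q) (Suc k)) = frag_extend (subdivide barycentre k) (boundary (fine_chain q (Suc k)))"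
    unfolding Suc_eq by (rule boundary_subdivide[OF chain])
  also have "\<dots> = alternating_op r (frag_map (map shift)) k (frag_extend (subdivide barycentre k) (fine_chain q k))"
    unfolding Suc.IH
    by (rule alternating_op_commute[where L = "frag_extend (subdivide barycentre k)"], rule additive_frag_extend,
        rule subdivide_frag_map[where b = barycentre and s = shift and s' = shift, OF barycentre_shift])
  finally show ?case by (simp only: Suc_eq)
qed

text \<open>The link from geometry to combinatorics: it suffices that labels span a face of the join
  on sets of small mesh, since iterated subdivision makes all cells small.\<close>

theorem no_fine_labelling:
  fixes lab :: "(nat \<Rightarrow> real) \<Rightarrow> nat \<times> nat"
  assumes m: "m < n" and \<delta>: "0 < \<delta>"
    and lab_shift: "\<And>x. lab (shift x) = rotate_label r (lab x)"
    and lab: "\<And>S A. \<lbrakk>rainbow N n C S; A \<subseteq> simplex_face N S; A \<noteq> {}; within_mesh \<delta> A\<rbrakk> \<Longrightarrow> join_face m r (lab ` A)"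
  shows False
proof -
  have n: "0 < real n" using m by simp
  \<comment> \<open>Shrinking is slowest for the longest cells, so the factor
    \<open>1 - 1 / n\<close> gives one \<open>q\<close> for all lengths
    \<open>k \<le> n\<close>.\<close>
  then obtain q where q: "(1 - 1 / real n) ^ q < \<delta>"
    using real_arch_pow_inv[OF \<delta>, of "1 - 1 / real n"] by auto
  show False
  proof (rule no_join_labelling[where z = "fine_chain q" and s = shift and lab = lab, OF r m])
    have "(frag_extend (subdivide barycentre 0) ^^ q) (frag_of []) = frag_of []"
      by (induction q) simp_all
    then show "fine_chain q 0 = frag_of []" by (simp add: fine_chain_def)
    show "fine_chain q k \<in> chains_of_length k" if "k \<le> n" for k
      using keys_fine_chain[OF that] by (auto simp: chains_of_length_def fine_cell_def)
    show "boundary (fine_chain q (Suc k)) = alternating_op r (frag_map (map shift)) k (fine_chain q k)"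
      if "k < n" for k using that by (rule boundary_fine_chain)
    show "lab (shift x) = rotate_label r (lab x)" for x by (rule lab_shift)
    show "join_face m r (lab ` set xs)" if k: "k \<le> n" "xs \<in> keys (fine_chain q k)" "xs \<noteq> []" for k xs
    proof -
      have "fine_cell q k xs" using keys_fine_chain[OF k(1)] k(2) by blast
      then obtain S where S: "rainbow N n C S" "set xs \<subseteq> simplex_face N S" "length xs = k"
        "within_mesh ((1 - 1 / real k) ^ q) (set xs)" unfolding fine_cell_def by blast
      have "0 < k" using S(3) k(3) by auto
      then have "1 - 1 / real k \<le> 1 - 1 / real n" "0 \<le> 1 - 1 / real k"
        using k(1) by (simp_all add: frac_le)
      then have "(1 - 1 / real k) ^ q \<le> (1 - 1 / real n) ^ q" by (rule power_mono)
      then have "(1 - 1 / real k) ^ q \<le> \<delta>" using q by simp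
      then have "within_mesh \<delta> (set xs)" using S(4) unfolding within_mesh_def by (meson order_trans)
      then show ?thesis using lab[OF S(1,2)] k(3) by simp
    qed
  qed
qed

end

section \<open>The colourful Caratheodory theorem\<close>

text \<open>Elimination of one unknown. It serves twice: for a linear dependence in the Caratheodory
  argument, and for a functional killing given rows in the null-set argument.\<close>

lemma homogeneous_system:
  fixes a :: "'i \<Rightarrow> 'j \<Rightarrow> real"
  assumes "finite I" "finite J" "card I < card J"
  shows "\<exists>x. (\<exists>j\<in>J. x j \<noteq> 0) \<and> (\<forall>i\<in>I. (\<Sum>j\<in>J. a i j * x j) = 0)"
  using assms
proof (induction I arbitrary: J a rule: finite_induct)
  case empty
  then obtain j where "j \<in> J" by fastforce
  then show ?case by (intro exI[of _ "\<lambda>_. 1"]) auto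
next
  case (insert i0 I)
  show ?case
  proof (cases "\<forall>j\<in>J. a i0 j = 0")
    case True
    have "card I < card J" using insert by simp
    then obtain x where "\<exists>j\<in>J. x j \<noteq> 0" "\<forall>i\<in>I. (\<Sum>j\<in>J. a i j * x j) = 0"
      using insert.IH[of J a] insert.prems by blast
    then show ?thesis using True by (intro exI[of _ x]) simp
  next
    case False
    then obtain j0 where j0: "j0 \<in> J" "a i0 j0 \<noteq> 0" by blast
    define J' where "J' = J - {j0}"
    define b where "b i j = a i j - a i j0 * a i0 j / a i0 j0" for i j
    have J': "finite J'" "card I < card J'" using insert j0 by (auto simp: J'_def)
    obtain y where y: "\<exists>j\<in>J'. y j \<noteq> 0" "\<forall>i\<in>I. (\<Sum>j\<in>J'. b i j * y j) = 0"
      using insert.IH[OF J', of b] by blast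
    define c where "c = - (\<Sum>j\<in>J'. a i0 j * y j) / a i0 j0"
    define x where "x = y(j0 := c)"
    have split: "(\<Sum>j\<in>J. a i j * x j) = a i j0 * c + (\<Sum>j\<in>J'. a i j * y j)" for i
    proof -
      have "(\<Sum>j\<in>J. a i j * x j) = a i j0 * x j0 + (\<Sum>j\<in>J'. a i j * x j)"
        unfolding J'_def using insert.prems(1) j0(1) by (rule sum.remove)
      also have "(\<Sum>j\<in>J'. a i j * x j) = (\<Sum>j\<in>J'. a i j * y j)"
        by (rule sum.cong) (auto simp: x_def J'_def)
      finally show ?thesis by (simp add: x_def)
    qed
    have "(\<Sum>j\<in>J. a i0 j * x j) = 0" unfolding split using j0(2) by (simp add: c_def)
    moreover have "(\<Sum>j\<in>J. a i j * x j) = 0" if "i \<in> I" for i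
    proof -
      have "(\<Sum>j\<in>J'. b i j * y j) = (\<Sum>j\<in>J'. a i j * y j) - a i j0 / a i0 j0 * (\<Sum>j\<in>J'. a i0 j * y j)"
        unfolding b_def sum_distrib_left sum_subtractf[symmetric]
        by (rule sum.cong) (auto simp: algebra_simps)
      then show ?thesis using y(2) that unfolding split c_def by simp
    qed
    moreover have "\<exists>j\<in>J. x j \<noteq> 0" using y(1) by (auto simp: x_def J'_def)
    ultimately show ?thesis by (intro exI[of _ x]) simp
  qed
qed

lemma compact_standard_simplex: "compact (standard_simplex p)"
  using compactin_standard_simplex[of p]
  by (simp add: euclidean_product_topology)

text \<open>Barany's argument: take a rainbow simplex nearest to the origin and its nearest point
  \<open>z\<close>. If \<open>z\<close> is nonzero, it can be written without one colour, and
  exchanging that colour for a vertex at a non-acute angle to \<open>z\<close> contradicts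
  minimality.\<close>

theorem colourful_caratheodory:
  fixes a :: "nat \<Rightarrow> 'k \<Rightarrow> real" and C :: "nat \<Rightarrow> nat set"
  assumes I: "finite I" "card I = p"
    and C: "\<And>i. i \<le> p \<Longrightarrow> finite (C i) \<and> C i \<noteq> {}"
    and zero: "\<And>i k. i \<le> p \<Longrightarrow> k \<in> I \<Longrightarrow> (\<Sum>v\<in>C i. a v k) = 0"
  shows "\<exists>\<sigma> t. (\<forall>i\<le>p. \<sigma> i \<in> C i) \<and> t \<in> standard_simplex p \<and> (\<forall>k\<in>I. (\<Sum>i\<le>p. t i * a (\<sigma> i) k) = 0)"
proof -
  define P where "P = PiE {..p} C"
  define z where "z \<sigma> t k = (\<Sum>i\<le>p. t i * a (\<sigma> i) k)" for \<sigma> and t :: "nat \<Rightarrow> real" and k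
  define val where "val \<sigma> t = (\<Sum>k\<in>I. (z \<sigma> t k)\<^sup>2)" for \<sigma> t
  have P: "finite P" "P \<noteq> {}" using C by (auto simp: P_def PiE_eq_empty_iff intro!: finite_PiE)
  have "\<exists>t\<in>standard_simplex p. \<forall>t'\<in>standard_simplex p. val \<sigma> t \<le> val \<sigma> t'" for \<sigma>
    unfolding val_def z_def
    by (intro continuous_attains_inf compact_standard_simplex nonempty_standard_simplex continuous_intros
        continuous_on_subset[OF continuous_on_product_coordinates]) auto
  then obtain T where T: "\<And>\<sigma>. T \<sigma> \<in> standard_simplex p"
    "\<And>\<sigma> t'. t' \<in> standard_simplex p \<Longrightarrow> val \<sigma> (T \<sigma>) \<le> val \<sigma> t'" by metis
  define m where "m = Min ((\<lambda>\<sigma>. val \<sigma> (T \<sigma>)) ` P)"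
  have "m \<in> (\<lambda>\<sigma>. val \<sigma> (T \<sigma>)) ` P" unfolding m_def using P by (intro Min_in) auto
  then obtain \<sigma> t where \<sigma>: "\<sigma> \<in> P" and t: "t \<in> standard_simplex p" and m: "val \<sigma> t = m"
    using T(1) by auto
  have min: "m \<le> val \<sigma>' t'" if "\<sigma>' \<in> P" "t' \<in> standard_simplex p" for \<sigma>' t'
  proof -
    have "m \<le> val \<sigma>' (T \<sigma>')" unfolding m_def using P(1) that(1) by (intro Min_le) auto
    then show ?thesis using T(2)[OF that(2), of \<sigma>'] by linarith
  qed
  \<comment> \<open>Optimality in the direction of a vertex: no vertex of an optimal simplex lies
    strictly on the origin's side of the hyperplane through \<open>z\<close> orthogonal to
    \<open>z\<close>.\<close>
  have first_order: "m \<le> (\<Sum>k\<in>I. a (\<sigma>' i) k * z \<sigma>' t' k)"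
    if opt: "\<sigma>' \<in> P" "t' \<in> standard_simplex p" "val \<sigma>' t' = m" "i \<le> p" for \<sigma>' t' i
  proof (rule ccontr)
    define g where "g k = a (\<sigma>' i) k - z \<sigma>' t' k" for k
    define b where "b = (\<Sum>k\<in>I. g k * z \<sigma>' t' k)"
    define q where "q = (\<Sum>k\<in>I. (g k)\<^sup>2)"
    assume "\<not> m \<le> (\<Sum>k\<in>I. a (\<sigma>' i) k * z \<sigma>' t' k)"
    moreover have "b = (\<Sum>k\<in>I. a (\<sigma>' i) k * z \<sigma>' t' k) - m"
      using opt(3) by (simp add: b_def g_def val_def left_diff_distrib sum_subtractf power2_eq_square)
    ultimately have b: "b < 0" by simp
    have q: "0 \<le> q" unfolding q_def by (intro sum_nonneg) simp
    \<comment> \<open>Moving by \<open>e\<close> towards the vertex changes the value by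
      \<open>e * (2 * b + e * q)\<close>. This choice gives \<open>e * q \<le> - b\<close>, so the
      change is negative.\<close>
    define e where "e = min 1 (- b / (q + 1))"
    have "0 < - b / (q + 1)" using b q by (intro divide_pos_pos) auto
    then have e: "0 < e" "e \<le> 1" by (auto simp: e_def)
    define te where "te j = (1 - e) * t' j + e * (if j = i then 1 else 0)" for j
    have "te \<in> standard_simplex p" unfolding te_def
      by (rule convex_standard_simplex) (use opt e in auto)
    then have "m \<le> val \<sigma>' te" by (rule min[OF opt(1)])
    moreover have "z \<sigma>' te k = z \<sigma>' t' k + e * g k" for k
    proof -
      have "z \<sigma>' te k = (\<Sum>j\<le>p. (1 - e) * (t' j * a (\<sigma>' j) k) + e * (if j = i then a (\<sigma>' j) k else 0))"
        unfolding z_def te_def by (rule sum.cong) (auto simp: algebra_simps)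
      also have "\<dots> = (1 - e) * z \<sigma>' t' k + e * a (\<sigma>' i) k"
        using opt(4) unfolding z_def by (simp add: sum.distrib flip: sum_distrib_left)
      finally show ?thesis by (simp add: g_def algebra_simps)
    qed
    then have "val \<sigma>' te = val \<sigma>' t' + 2 * e * b + e\<^sup>2 * q"
      by (simp add: val_def b_def q_def power2_sum power_mult_distrib sum.distrib sum_distrib_left algebra_simps)
    ultimately have "0 \<le> e * (2 * b + e * q)" using opt(3) by (simp add: algebra_simps power2_eq_square)
    then have "0 \<le> 2 * b + e * q" using e by (simp add: zero_le_mult_iff)
    moreover have "e * q \<le> - b"
    proof -
      have "e * q \<le> - b / (q + 1) * (q + 1)" using q e by (intro mult_mono) (auto simp: e_def)
      then show ?thesis using q by simp
    qed
    ultimately show False using b by linarith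
  qed
  have "m = 0"
  proof (rule ccontr)
    assume "m \<noteq> 0"
    moreover have "0 \<le> m" unfolding m[symmetric] val_def by (intro sum_nonneg) simp
    ultimately have mpos: "0 < m" by simp
    \<comment> \<open>The same nearest point with one weight zero: if all weights are positive, all
      \<open>p + 1\<close> vertices lie on the hyperplane through \<open>z\<close>, where they are
      affinely dependent.\<close>
    have "\<exists>t'\<in>standard_simplex p. (\<forall>k\<in>I. z \<sigma> t' k = z \<sigma> t k) \<and> (\<exists>i\<le>p. t' i = 0)"
    proof (cases "\<exists>i\<le>p. t i = 0")
      case True
      then show ?thesis using t by blast
    next
      case False
      have t0: "0 \<le> t i" and t_out: "p < i \<Longrightarrow> t i = 0" and t1: "sum t {..p} = 1" for i
        using t by (auto simp: standard_simplex_def)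
      have tpos: "0 < t i" if "i \<le> p" for i using False t0[of i] that by (auto simp: order_less_le)
      define c where "c i = (\<Sum>k\<in>I. a (\<sigma> i) k * z \<sigma> t k) - m" for i
      have c0: "0 \<le> c i" if "i \<le> p" for i using first_order[OF \<sigma> t m that] by (simp add: c_def)
      have "(\<Sum>i\<le>p. t i * c i) = (\<Sum>i\<le>p. (\<Sum>k\<in>I. t i * (a (\<sigma> i) k * z \<sigma> t k)) - t i * m)"
        by (rule sum.cong) (simp_all add: c_def right_diff_distrib sum_distrib_left)
      also have "\<dots> = (\<Sum>i\<le>p. \<Sum>k\<in>I. t i * (a (\<sigma> i) k * z \<sigma> t k)) - m"
        by (simp only: sum_subtractf sum_distrib_right[symmetric] t1 mult_1)
      also have "(\<Sum>i\<le>p. \<Sum>k\<in>I. t i * (a (\<sigma> i) k * z \<sigma> t k)) = (\<Sum>k\<in>I. \<Sum>i\<le>p. t i * (a (\<sigma> i) k * z \<sigma> t k))"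
        by (rule sum.swap)
      also have "(\<Sum>k\<in>I. \<Sum>i\<le>p. t i * (a (\<sigma> i) k * z \<sigma> t k)) = val \<sigma> t"
        unfolding val_def power2_eq_square
        by (rule sum.cong) (simp_all add: z_def[of \<sigma> t] sum_distrib_right mult.assoc)
      finally have "(\<Sum>i\<le>p. t i * c i) = 0" using m by simp
      then have "\<forall>i\<in>{..p}. t i * c i = 0"
        by (subst (asm) sum_nonneg_eq_0_iff) (use t0 c0 in auto)
      then have c_eq: "c i = 0" if "i \<le> p" for i using tpos[OF that] that by force
      \<comment> \<open>\<open>p + 1\<close> vectors in dimension \<open>p\<close> satisfy a linear
        relation. Pairing it with \<open>z\<close>, which gives \<open>m\<close> on every vertex,
        shows that its coefficients sum to \<open>0\<close>.\<close>
      obtain \<tau> where \<tau>: "\<exists>i\<in>{..p}. \<tau> i \<noteq> 0" "\<forall>k\<in>I. (\<Sum>i\<le>p. a (\<sigma> i) k * \<tau> i) = 0"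
        using homogeneous_system[of I "{..p}" "\<lambda>k i. a (\<sigma> i) k"] I by auto
      have "m * (\<Sum>i\<le>p. \<tau> i) = (\<Sum>i\<le>p. \<tau> i * (\<Sum>k\<in>I. a (\<sigma> i) k * z \<sigma> t k))"
        unfolding sum_distrib_left[of m] using c_eq by (intro sum.cong) (auto simp: c_def)
      also have "\<dots> = (\<Sum>i\<le>p. \<Sum>k\<in>I. a (\<sigma> i) k * \<tau> i * z \<sigma> t k)"
        by (simp only: sum_distrib_left mult_ac)
      also have "\<dots> = (\<Sum>k\<in>I. (\<Sum>i\<le>p. a (\<sigma> i) k * \<tau> i) * z \<sigma> t k)"
        unfolding sum_distrib_right by (rule sum.swap)
      also have "\<dots> = 0" using \<tau>(2) by simp
      finally have \<tau>sum: "(\<Sum>i\<le>p. \<tau> i) = 0" using mpos by simp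
      define Q where "Q = {i. i \<le> p \<and> 0 < \<tau> i}"
      have "Q \<noteq> {}"
      proof
        assume "Q = {}"
        then have "\<forall>i\<in>{..p}. 0 \<le> - \<tau> i" by (force simp: Q_def)
        moreover have "(\<Sum>i\<le>p. - \<tau> i) = 0" using \<tau>sum by (simp add: sum_negf)
        ultimately have "\<forall>i\<in>{..p}. - \<tau> i = 0" by (subst (asm) sum_nonneg_eq_0_iff) auto
        then show False using \<tau>(1) by auto
      qed
      moreover have "finite Q" by (simp add: Q_def)
      ultimately have "Min ((\<lambda>i. t i / \<tau> i) ` Q) \<in> (\<lambda>i. t i / \<tau> i) ` Q" by (intro Min_in) auto
      then obtain i0 where i0: "i0 \<in> Q" and lm: "Min ((\<lambda>i. t i / \<tau> i) ` Q) = t i0 / \<tau> i0" by blast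
      \<comment> \<open>The longest step along the relation that keeps all weights nonnegative; it
        brings the weight of \<open>i0\<close> to \<open>0\<close>.\<close>
      define l where "l = t i0 / \<tau> i0"
      have lmin: "l \<le> t i / \<tau> i" if "i \<in> Q" for i
        unfolding l_def lm[symmetric] using \<open>finite Q\<close> that by (intro Min_le) auto
      have l0: "0 \<le> l" using i0 t0[of i0] by (auto simp: l_def Q_def)
      define t' where "t' i = (if i \<le> p then t i - l * \<tau> i else 0)" for i
      have t'0: "0 \<le> t' i" for i
      proof (cases "i \<in> Q")
        case True
        then have "l * \<tau> i \<le> t i" using lmin[OF True] by (simp add: Q_def pos_le_divide_eq)
        then show ?thesis by (simp add: t'_def)
      next
        case False
        then have "l * \<tau> i \<le> 0" if "i \<le> p" using l0 that by (intro mult_nonneg_nonpos) (auto simp: Q_def)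
        then show ?thesis using t0[of i] unfolding t'_def by (cases "i \<le> p") force+
      qed
      have t'1: "(\<Sum>i\<le>p. t' i) = 1"
        using t1 \<tau>sum by (simp add: t'_def sum_subtractf flip: sum_distrib_left)
      have "t' i \<le> 1" for i
      proof (cases "i \<le> p")
        case True
        then show ?thesis using member_le_sum[of i "{..p}" t'] t'0 t'1 by auto
      qed (simp add: t'_def)
      then have "t' \<in> standard_simplex p" using t'0 t'1 by (auto simp: standard_simplex_def t'_def)
      moreover have "z \<sigma> t' k = z \<sigma> t k" if "k \<in> I" for k
      proof -
        have "z \<sigma> t' k = z \<sigma> t k - l * (\<Sum>i\<le>p. a (\<sigma> i) k * \<tau> i)"
          unfolding z_def sum_distrib_left sum_subtractf[symmetric]
          by (rule sum.cong) (auto simp: t'_def algebra_simps)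
        then show ?thesis using \<tau>(2) that by simp
      qed
      moreover have "t' i0 = 0" "i0 \<le> p" using i0 by (auto simp: t'_def l_def Q_def)
      ultimately show ?thesis by blast
    qed
    then obtain t' i0 where t': "t' \<in> standard_simplex p" "\<And>k. k \<in> I \<Longrightarrow> z \<sigma> t' k = z \<sigma> t k"
      and i0: "i0 \<le> p" "t' i0 = 0" by blast
    have "(\<Sum>v\<in>C i0. \<Sum>k\<in>I. a v k * z \<sigma> t k) = (\<Sum>k\<in>I. (\<Sum>v\<in>C i0. a v k) * z \<sigma> t k)"
      by (subst sum.swap) (simp add: sum_distrib_right)
    also have "\<dots> = 0" using zero[OF i0(1)] by simp
    finally have total: "(\<Sum>v\<in>C i0. \<Sum>k\<in>I. a v k * z \<sigma> t k) = 0" .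
    have "\<not> (\<forall>v\<in>C i0. 0 < (\<Sum>k\<in>I. a v k * z \<sigma> t k))"
    proof
      assume "\<forall>v\<in>C i0. 0 < (\<Sum>k\<in>I. a v k * z \<sigma> t k)"
      then have "0 < (\<Sum>v\<in>C i0. \<Sum>k\<in>I. a v k * z \<sigma> t k)"
        using sum_pos[of "C i0" "\<lambda>v. \<Sum>k\<in>I. a v k * z \<sigma> t k"] C[OF i0(1)] by blast
      then show False using total by simp
    qed
    then obtain v where v: "v \<in> C i0" "(\<Sum>k\<in>I. a v k * z \<sigma> t k) \<le> 0" by (auto simp: not_less)
    \<comment> \<open>Colour \<open>i0\<close> has weight \<open>0\<close>, so the exchange leaves
      the point and its value unchanged, while the new vertex violates the first-order
      condition.\<close>
    define \<sigma>' where "\<sigma>' = \<sigma>(i0 := v)"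
    have \<sigma>': "\<sigma>' \<in> P" using \<sigma> v(1) i0(1) by (auto simp: P_def \<sigma>'_def PiE_iff extensional_def)
    have z': "z \<sigma>' t' k = z \<sigma> t k" if "k \<in> I" for k
    proof -
      have "z \<sigma>' t' k = z \<sigma> t' k" unfolding z_def
        by (rule sum.cong) (auto simp: \<sigma>'_def i0(2))
      then show ?thesis using t'(2)[OF that] by simp
    qed
    then have "val \<sigma>' t' = m" using m by (simp add: val_def)
    from first_order[OF \<sigma>' t'(1) this i0(1)]
    have "m \<le> (\<Sum>k\<in>I. a v k * z \<sigma> t k)" using z' by (simp add: \<sigma>'_def)
    then show False using v(2) mpos by linarith
  qed
  then have "\<forall>k\<in>I. (z \<sigma> t k)\<^sup>2 = 0"
    using m I(1) sum_nonneg_eq_0_iff[of I "\<lambda>k. (z \<sigma> t k)\<^sup>2"] by (simp add: val_def)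
  then have "\<forall>k\<in>I. (\<Sum>i\<le>p. t i * a (\<sigma> i) k) = 0" by (simp add: z_def)
  moreover have "\<forall>i\<le>p. \<sigma> i \<in> C i" using \<sigma> by (auto simp: P_def)
  ultimately show ?thesis using t by blast
qed

section \<open>Zeros of equivariant maps on the complex of rainbow faces\<close>

text \<open>The sectors have angle \<open>pi / r\<close>, half a rotation step, so that rotation
  preserves parity and sectors of equal parity never touch along a ray.\<close>

definition sector :: "nat \<Rightarrow> complex \<Rightarrow> nat" where
  "sector r z = nat \<lfloor>real r * Arg2pi z / pi\<rfloor>"

lemma sector_iff:
  assumes "0 < r"
  shows "sector r z = q \<longleftrightarrow> real q * pi \<le> real r * Arg2pi z \<and> real r * Arg2pi z < (real q + 1) * pi"
proof -
  have "0 \<le> real r * Arg2pi z / pi" using Arg2pi_ge_0[of z] by simp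
  then have "sector r z = q \<longleftrightarrow> \<lfloor>real r * Arg2pi z / pi\<rfloor> = int q"
    unfolding sector_def by (auto simp: nat_eq_iff)
  also have "\<dots> \<longleftrightarrow> real q \<le> real r * Arg2pi z / pi \<and> real r * Arg2pi z / pi < real q + 1"
    by (simp add: floor_eq_iff)
  finally show ?thesis by (simp add: pos_le_divide_eq pos_divide_less_eq)
qed

lemma sector_bounds:
  assumes "0 < r"
  shows "real (sector r z) * pi \<le> real r * Arg2pi z" "real r * Arg2pi z < (real (sector r z) + 1) * pi"
  using sector_iff[OF assms, of z "sector r z"] by auto

lemma sector_less:
  assumes "0 < r"
  shows "sector r z < 2 * r"
proof -
  have "real (sector r z) * pi < real r * (2 * pi)"
    using sector_bounds(1)[OF assms, of z] Arg2pi_lt_2pi[of z] assms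
    by (meson le_less_trans mult_strict_left_mono of_nat_0_less_iff)
  then have "real (sector r z) < real (2 * r)" by simp
  then show ?thesis by (simp only: of_nat_less_iff)
qed

text \<open>Rotation adds \<open>2 * pi\<close> to \<open>r * Arg2pi z\<close>, that is, two
  sectors; the second case is the jump of \<open>Arg2pi\<close> at the positive real axis.\<close>

lemma sector_rotate:
  assumes r: "0 < r" and z: "z \<noteq> 0"
  shows "sector r (cis (2 * pi / real r) * z) = (sector r z + 2) mod (2 * r)"
proof -
  let ?q = "sector r z" and ?\<theta> = "Arg2pi z" and ?\<phi> = "2 * pi / real r"
  have q: "real ?q * pi \<le> real r * ?\<theta>" "real r * ?\<theta> < (real ?q + 1) * pi"
    using sector_bounds[OF r] by auto
  have \<theta>: "0 \<le> ?\<theta>" "?\<theta> < 2 * pi" by (rule Arg2pi_ge_0, rule Arg2pi_lt_2pi)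
  have \<phi>: "real r * ?\<phi> = 2 * pi" "0 < ?\<phi>" "?\<phi> \<le> 2 * pi" using r by (auto simp: divide_le_eq)
  have zcis: "z = of_real (norm z) * cis ?\<theta>" using Arg2pi_eq[of z] by (simp add: cis_conv_exp)
  have rot: "of_real (norm z) * cis (?\<theta> + ?\<phi>) = cis ?\<phi> * z"
    by (subst (3) zcis) (simp add: cis_mult[symmetric] mult_ac)
  have arg: "Arg2pi (cis ?\<phi> * z) = a" if "cis a = cis (?\<theta> + ?\<phi>)" "0 \<le> a" "a < 2 * pi" for a
    by (rule Arg2pi_unique[of "norm z"]) (use that rot z in \<open>simp_all add: cis_conv_exp\<close>)
  have expand: "real r * (?\<theta> + ?\<phi>) = real r * ?\<theta> + 2 * pi" using \<phi>(1) by (simp add: distrib_left)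
  show ?thesis
  proof (cases "?\<theta> + ?\<phi> < 2 * pi")
    case True
    have a: "Arg2pi (cis ?\<phi> * z) = ?\<theta> + ?\<phi>" by (rule arg) (use True \<theta> \<phi> in auto)
    have s: "sector r (cis ?\<phi> * z) = ?q + 2"
      unfolding sector_iff[OF r] a expand using q by (simp add: distrib_right)
    then show ?thesis using sector_less[OF r, of "cis ?\<phi> * z"] by simp
  next
    case False
    have a: "Arg2pi (cis ?\<phi> * z) = ?\<theta> + ?\<phi> - 2 * pi"
    proof (rule arg)
      show "cis (?\<theta> + ?\<phi> - 2 * pi) = cis (?\<theta> + ?\<phi>)" by (simp flip: cis_divide)
    qed (use False \<theta> \<phi> in auto)
    have "real r * (2 * pi) \<le> real r * ?\<theta> + 2 * pi"
      unfolding expand[symmetric] using False by (intro mult_left_mono) auto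
    then have "2 * real r * pi < (real ?q + 3) * pi" using q by (simp add: distrib_right)
    then have "2 * real r < real ?q + 3" by simp
    then have qr: "2 * r \<le> ?q + 2" by linarith
    have exp2: "real r * (?\<theta> + ?\<phi> - 2 * pi) = real r * ?\<theta> + 2 * pi - 2 * real r * pi"
      using expand by (simp add: right_diff_distrib)
    have s: "sector r (cis ?\<phi> * z) = ?q + 2 - 2 * r"
      unfolding sector_iff[OF r] a exp2 using q qr by (simp add: of_nat_diff algebra_simps)
    have "?q + 2 - 2 * r < 2 * r" using sector_less[OF r, of z] r by linarith
    then show ?thesis using s qr by (simp add: le_mod_geq)
  qed
qed

lemma sector_rotate_power:
  assumes r: "0 < r" and z: "z \<noteq> 0"
  shows "sector r (cis (2 * pi / real r) ^ k * z) = (sector r z + 2 * k) mod (2 * r)"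
proof (induction k)
  case 0
  then show ?case using sector_less[OF r, of z] by simp
next
  case (Suc k)
  have "sector r (cis (2 * pi / real r) ^ Suc k * z)
      = sector r (cis (2 * pi / real r) * (cis (2 * pi / real r) ^ k * z))"
    by (simp add: mult.assoc)
  also have "\<dots> = ((sector r z + 2 * k) mod (2 * r) + 2) mod (2 * r)"
    by (subst sector_rotate[OF r]) (use z Suc in simp_all)
  also have "\<dots> = (sector r z + 2 * Suc k) mod (2 * r)"
    by (simp only: mod_add_left_eq) (simp add: algebra_simps)
  finally show ?case .
qed

lemma cos_le_cos_gap:
  assumes "0 \<le> a" "a \<le> pi" "a \<le> t" "t \<le> 2 * pi - a"
  shows "cos t \<le> cos a"
proof (cases "t \<le> pi")
  case True
  then show ?thesis using assms by (intro cos_monotone_0_pi_le) auto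
next
  case False
  have "cos (2 * pi - t) \<le> cos a" using assms False by (intro cos_monotone_0_pi_le) auto
  then show ?thesis by (simp add: cos_diff)
qed

text \<open>Sectors of equal parity are separated by a sector of the other parity.\<close>

lemma sector_separated:
  assumes r: "0 < r" and \<epsilon>: "0 \<le> \<epsilon>" "\<epsilon> \<le> norm z" "\<epsilon> \<le> norm w"
    and par: "sector r z mod 2 = sector r w mod 2" and ne: "sector r z < sector r w"
  shows "2 * \<epsilon>\<^sup>2 * (1 - cos (pi / real r)) \<le> (norm (z - w))\<^sup>2"
proof -
  let ?a = "Arg2pi z" and ?b = "Arg2pi w" and ?p = "sector r z" and ?q = "sector r w"
  have p: "real ?p * pi \<le> real r * ?a" "real r * ?a < (real ?p + 1) * pi"
    and q: "real ?q * pi \<le> real r * ?b" "real r * ?b < (real ?q + 1) * pi"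
    using sector_bounds[OF r] by auto
  \<comment> \<open>At least one whole sector lies between the two on either way round the circle;
    the second bound concerns the way across the positive real axis.\<close>
  have gap: "?p + 2 \<le> ?q" "?q + 2 \<le> ?p + 2 * r"
    using par ne sector_less[OF r, of w] by presburger+
  have "(real ?p + 2) * pi \<le> real ?q * pi" using gap(1) by (intro mult_right_mono) auto
  then have 1: "pi \<le> real r * (?b - ?a)" using p q by (simp add: algebra_simps)
  have "(real ?q + 2) * pi \<le> (real ?p + 2 * real r) * pi" using gap(2) by (intro mult_right_mono) auto
  then have 2: "real r * (?b - ?a) \<le> 2 * real r * pi - pi" using p q by (simp add: algebra_simps)
  have c: "cos (?b - ?a) \<le> cos (pi / real r)"
  proof (rule cos_le_cos_gap)
    show "pi / real r \<le> pi" using r by (simp add: divide_le_eq)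
    show "pi / real r \<le> ?b - ?a" using 1 r by (simp add: pos_divide_le_eq mult.commute)
    have "?b - ?a \<le> (2 * real r * pi - pi) / real r"
      using 2 r by (simp add: pos_le_divide_eq mult.commute)
    then show "?b - ?a \<le> 2 * pi - pi / real r" using r by (simp add: diff_divide_distrib)
  qed simp
  have re: "Re z = norm z * cos ?a" "Im z = norm z * sin ?a" "Re w = norm w * cos ?b" "Im w = norm w * sin ?b"
    by (simp_all add: cos_Arg2pi sin_Arg2pi)
  have "(norm (z - w))\<^sup>2 = (norm z)\<^sup>2 + (norm w)\<^sup>2 - 2 * (Re z * Re w + Im z * Im w)"
    by (simp add: cmod_power2 power2_diff)
  also have "Re z * Re w + Im z * Im w = norm z * norm w * cos (?b - ?a)"
    by (simp add: re cos_diff algebra_simps)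
  also have "(norm z)\<^sup>2 + (norm w)\<^sup>2 - 2 * (norm z * norm w * cos (?b - ?a))
     = (norm z - norm w)\<^sup>2 + 2 * (norm z * norm w) * (1 - cos (?b - ?a))"
    by (simp add: power2_diff algebra_simps)
  also have "\<dots> \<ge> 2 * (norm z * norm w) * (1 - cos (?b - ?a))" by simp
  finally have main: "2 * (norm z * norm w) * (1 - cos (?b - ?a)) \<le> (norm (z - w))\<^sup>2" .
  have "2 * \<epsilon>\<^sup>2 * (1 - cos (pi / real r)) \<le> 2 * (norm z * norm w) * (1 - cos (?b - ?a))"
    using c \<epsilon> by (intro mult_mono) (auto simp: power2_eq_square intro: mult_mono)
  then show ?thesis using main by linarith
qed

lemma sector_eq_of_near:
  assumes r: "0 < r" and \<epsilon>: "0 \<le> \<epsilon>" "\<epsilon> \<le> norm z" "\<epsilon> \<le> norm w"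
    and par: "sector r z mod 2 = sector r w mod 2"
    and near: "(norm (z - w))\<^sup>2 < 2 * \<epsilon>\<^sup>2 * (1 - cos (pi / real r))"
  shows "sector r z = sector r w"
proof (rule ccontr)
  assume "sector r z \<noteq> sector r w"
  then consider "sector r z < sector r w" | "sector r w < sector r z" by linarith
  then show False
  proof cases
    case 1
    then show False using sector_separated[OF r \<epsilon> par] near by linarith
  next
    case 2
    then show False using sector_separated[OF r \<epsilon>(1,3,2) par[symmetric]] near
      by (simp add: norm_minus_commute)
  qed
qed

section \<open>Compactness and uniform continuity on the simplex\<close>

lemma closed_simplex_face: "closed (simplex_face N S)"
proof -
  have "simplex_face N S = standard_simplex N \<inter> (\<Inter>v\<in>-S. {x. x v = 0})"
    by (auto simp: simplex_face_def)
  moreover have "closed {x :: nat \<Rightarrow> real. x v = 0}" for v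
    by (intro closed_Collect_eq continuous_on_product_coordinates continuous_on_const)
  ultimately show ?thesis
    using compact_imp_closed[OF compact_standard_simplex] by (auto intro!: closed_Int closed_INT)
qed

lemma simplex_face_subset: "simplex_face N S \<subseteq> standard_simplex N"
  by (auto simp: simplex_face_def)

lemma dist_fun_le_of_coordinates:
  fixes x y :: "nat \<Rightarrow> real"
  assumes "\<And>v. \<bar>x v - y v\<bar> \<le> \<delta>"
  shows "dist x y \<le> 2 * \<delta> + (1 / 2) ^ k"
proof -
  let ?D = "{dist (x (from_nat i)) (y (from_nat i)) |i. i \<le> k}"
  have "?D = (\<lambda>i. dist (x (from_nat i)) (y (from_nat i))) ` {..k}" by auto
  then have "finite ?D" "?D \<noteq> {}" by simp_all
  then have "Max ?D \<le> \<delta>" using assms by (subst Max_le_iff) (auto simp: dist_real_def)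
  then show ?thesis using dist_fun_le_dist_first_terms[of x y k] by linarith
qed

lemma uniform_mesh:
  fixes \<Phi> :: "nat \<Rightarrow> (nat \<Rightarrow> real) \<Rightarrow> complex"
  assumes cont: "\<And>l. l < M \<Longrightarrow> continuous_on (standard_simplex N) (\<Phi> l)" and "0 < e"
  shows "\<exists>\<delta>>0. \<forall>l<M. \<forall>x\<in>standard_simplex N. \<forall>y\<in>standard_simplex N.
    (\<forall>v. \<bar>x v - y v\<bar> \<le> \<delta>) \<longrightarrow> norm (\<Phi> l x - \<Phi> l y) < e"
  using cont
proof (induction M)
  case 0
  then show ?case by (intro exI[of _ 1]) simp
next
  case (Suc M)
  then obtain \<delta>1 where \<delta>1: "\<delta>1 > 0" "\<forall>l<M. \<forall>x\<in>standard_simplex N. \<forall>y\<in>standard_simplex N.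
    (\<forall>v. \<bar>x v - y v\<bar> \<le> \<delta>1) \<longrightarrow> norm (\<Phi> l x - \<Phi> l y) < e" by fastforce
  have "uniformly_continuous_on (standard_simplex N) (\<Phi> M)"
    using Suc.prems compact_standard_simplex by (intro compact_uniformly_continuous) auto
  then obtain d where d: "d > 0" "\<And>x y. \<lbrakk>x \<in> standard_simplex N; y \<in> standard_simplex N; dist x y < d\<rbrakk>
      \<Longrightarrow> dist (\<Phi> M x) (\<Phi> M y) < e"
    using \<open>0 < e\<close> unfolding uniformly_continuous_on_def by (metis dist_commute)
  obtain k where k: "(1 / 2 :: real) ^ k < d / 2"
    using real_arch_pow_inv[of "d / 2" "1 / 2"] d(1) by auto
  define \<delta> where "\<delta> = min \<delta>1 (d / 4)"
  have "norm (\<Phi> M x - \<Phi> M y) < e"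
    if "x \<in> standard_simplex N" "y \<in> standard_simplex N" "\<forall>v. \<bar>x v - y v\<bar> \<le> \<delta>" for x y
  proof -
    have "dist x y \<le> 2 * \<delta> + (1 / 2) ^ k" by (rule dist_fun_le_of_coordinates) (use that in auto)
    also have "2 * \<delta> \<le> d / 2" by (simp add: \<delta>_def)
    finally have "dist x y < d" using k by linarith
    then show ?thesis using d(2) that by (simp add: dist_norm)
  qed
  moreover have "norm (\<Phi> l x - \<Phi> l y) < e"
    if "l < M" "x \<in> standard_simplex N" "y \<in> standard_simplex N" "\<forall>v. \<bar>x v - y v\<bar> \<le> \<delta>" for l x y
  proof -
    have "\<forall>v. \<bar>x v - y v\<bar> \<le> \<delta>1" using that(4) by (auto simp: \<delta>_def)
    then show ?thesis using \<delta>1(2) that by blast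
  qed
  moreover have "0 < \<delta>" using \<delta>1(1) d(1) by (simp add: \<delta>_def)
  ultimately show ?case by (intro exI[of _ \<delta>]) (auto simp: less_Suc_eq)
qed

context rainbow_shift
begin

lemma finite_rainbow: "finite {S. rainbow N n C S}"
  by (rule finite_subset[of _ "Pow {..N}"]) (auto simp: rainbow_def)

lemma compact_rainbow_complex: "compact rainbow_complex"
proof -
  have "rainbow_complex = (\<Union>S\<in>{S. rainbow N n C S}. simplex_face N S)"
    by (auto simp: rainbow_complex_def)
  moreover have "compact (simplex_face N S)" for S
    using compact_Int_closed[OF compact_standard_simplex closed_simplex_face, of N N S]
      simplex_face_subset[of N S] by (simp add: Int_absorb1)
  ultimately show ?thesis by (simp only: compact_UN[OF finite_rainbow])
qed

lemma rainbow_complex_subset: "rainbow_complex \<subseteq> standard_simplex N"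
  using simplex_face_subset by (auto simp: rainbow_complex_def)

lemma rainbow_complex_nonempty:
  assumes "0 < n"
  shows "rainbow_complex \<noteq> {}"
proof -
  have "rainbow N n C (base_point ` {1..n})" by (rule rainbow_range) (rule base_point)
  moreover have "vertex_point (base_point 1) \<in> simplex_face N (base_point ` {1..n})"
    using assms base_point[of 1] class_subset[of 1] by (intro vertex_point_face) auto
  ultimately show ?thesis by (auto simp: rainbow_complex_def)
qed

text \<open>Without a common zero, at each point of the complex some coordinate has modulus at least
  a fixed \<open>\<epsilon>\<close>. Its index and sector would label small sets by faces of a join
  of \<open>2 * M < n\<close> copies of \<open>Z/r\<close>.\<close>

theorem equivariant_zero:
  fixes \<Phi> :: "nat \<Rightarrow> (nat \<Rightarrow> real) \<Rightarrow> complex" and k :: "nat \<Rightarrow> nat"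
  assumes M: "2 * M < n"
    and coprime: "\<And>l. l < M \<Longrightarrow> coprime (k l) r"
    and shift: "\<And>l x. l < M \<Longrightarrow> \<Phi> l (shift x) = cis (2 * pi / real r) ^ k l * \<Phi> l x"
    and cont: "\<And>l. l < M \<Longrightarrow> continuous_on (standard_simplex N) (\<Phi> l)"
  shows "\<exists>x\<in>rainbow_complex. \<forall>l<M. \<Phi> l x = 0"
proof (rule ccontr)
  assume contra: "\<not> ?thesis"
  have r0: "0 < r" using r by simp
  \<comment> \<open>The shift turns \<open>\<Phi> l\<close> by \<open>k l\<close> steps, whereas
    \<open>rotate_label\<close> makes a single one; an inverse modulo \<open>r\<close> reconciles
    the two.\<close>
  have "\<exists>k'. [k l * k' = 1] (mod r)" if "l < M" for l
    using cong_solve_coprime_nat[OF coprime[OF that]] by simp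
  then have "\<exists>k'. \<forall>l. l < M \<longrightarrow> [k l * k' l = 1] (mod r)" by (intro choice) blast
  then obtain k' where k': "\<And>l. l < M \<Longrightarrow> [k l * k' l = 1] (mod r)" by blast
  define h where "h x = (\<Sum>l<M. norm (\<Phi> l x))" for x
  have conth: "continuous_on rainbow_complex h" unfolding h_def
    by (intro continuous_on_sum continuous_on_norm continuous_on_subset[OF cont rainbow_complex_subset]) auto
  have "rainbow_complex \<noteq> {}" using M by (intro rainbow_complex_nonempty) simp
  from continuous_attains_inf[OF compact_rainbow_complex this conth]
  obtain x0 where x0: "x0 \<in> rainbow_complex" "\<And>x. x \<in> rainbow_complex \<Longrightarrow> h x0 \<le> h x" by blast
  obtain l0 where l0: "l0 < M" "\<Phi> l0 x0 \<noteq> 0" using contra x0(1) by auto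
  have "norm (\<Phi> l0 x0) \<le> h x0" unfolding h_def by (rule member_le_sum) (use l0 in auto)
  moreover have "0 < norm (\<Phi> l0 x0)" using l0(2) by simp
  ultimately have hpos: "0 < h x0" by linarith
  define \<epsilon> where "\<epsilon> = h x0 / real M"
  have \<epsilon>: "0 < \<epsilon>" using hpos l0(1) by (simp add: \<epsilon>_def)
  have large: "\<exists>l<M. \<epsilon> \<le> norm (\<Phi> l x)" if "x \<in> rainbow_complex" for x
  proof (rule ccontr)
    assume "\<not> ?thesis"
    then have "norm (\<Phi> l x) < \<epsilon>" if "l < M" for l using that by (simp add: not_le)
    then have "h x < (\<Sum>l<M. \<epsilon>)" 
      unfolding h_def using l0(1) by (intro sum_strict_mono) auto
    also have "\<dots> = h x0" using l0(1) by (simp add: \<epsilon>_def)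
    finally show False using x0(2)[OF that] by simp
  qed
  have gap: "0 < 1 - cos (pi / real r)"
  proof -
    have "0 < pi / real r" "pi / real r \<le> pi" using r by (simp_all add: divide_le_eq)
    then have "cos (pi / real r) < cos 0" by (intro cos_monotone_0_pi) simp_all
    then show ?thesis by simp
  qed
  define e where "e = sqrt (2 * \<epsilon>\<^sup>2 * (1 - cos (pi / real r)))"
  have "0 < 2 * \<epsilon>\<^sup>2 * (1 - cos (pi / real r))" using \<epsilon> gap by (intro mult_pos_pos) auto
  then have e: "0 < e" "e\<^sup>2 = 2 * \<epsilon>\<^sup>2 * (1 - cos (pi / real r))"
    unfolding e_def by (simp only: real_sqrt_gt_zero, simp only: real_sqrt_pow2 less_imp_le)
  from uniform_mesh[where \<Phi> = \<Phi> and M = M and N = N, OF _ e(1)] cont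
  obtain \<delta> where \<delta>: "\<delta> > 0" "\<forall>l<M. \<forall>x\<in>standard_simplex N. \<forall>y\<in>standard_simplex N.
    (\<forall>v. \<bar>x v - y v\<bar> \<le> \<delta>) \<longrightarrow> norm (\<Phi> l x - \<Phi> l y) < e"
    by blast
  define big where "big x l \<longleftrightarrow> l < M \<and> \<epsilon> \<le> norm (\<Phi> l x)" for x l
  \<comment> \<open>The least index is an equivariant choice because the shift preserves all
    moduli.\<close>
  define sel where "sel x = (LEAST l. big x l)" for x
  define q where "q x = sector r (\<Phi> (sel x) x)" for x
  \<comment> \<open>Parity selects one of the two copies that belong to coordinate
    \<open>sel x\<close>, and half the sector number gives the element in it. Points without a large
    coordinate, possible only off the complex, get a label fixed by rotation.\<close>
  define lab where "lab x = (if \<exists>l. big x l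
      then (2 * sel x + q x mod 2, (k' (sel x) * (q x div 2)) mod r) else (0, r))" for x
  have big_shift: "big (shift x) = big x" for x
  proof
    fix l
    have "norm (\<Phi> l (shift x)) = norm (\<Phi> l x)" if "l < M"
      unfolding shift[OF that] by (simp add: norm_mult norm_power)
    then show "big (shift x) l = big x l" unfolding big_def by (cases "l < M") simp_all
  qed
  then have sel_shift: "sel (shift x) = sel x" for x by (simp add: sel_def)
  have lab_shift: "lab (shift x) = rotate_label r (lab x)" for x
  proof (cases "\<exists>l. big x l")
    case False
    then show ?thesis by (simp add: lab_def big_shift rotate_label_def)
  next
    case True
    let ?l = "sel x"
    have l: "big x ?l" unfolding sel_def using True by (rule LeastI_ex)
    then have lM: "?l < M" and nz: "\<Phi> ?l x \<noteq> 0" using \<epsilon> by (auto simp: big_def)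
    have qs: "q (shift x) = (q x + 2 * k ?l) mod (2 * r)"
      unfolding q_def sel_shift shift[OF lM] by (rule sector_rotate_power[OF r0 nz])
    have "q (shift x) mod 2 = q x mod 2" unfolding qs by (simp add: mod_mod_cancel)
    moreover have "q (shift x) div 2 = (q x div 2 + k ?l) mod r"
    proof -
      have "q (shift x) div 2 = ((q x + 2 * k ?l) div 2) mod r"
        unfolding qs by (subst mod_mult2_eq) simp
      then show ?thesis by (simp add: add.commute)
    qed
    moreover have "(k' ?l * ((q x div 2 + k ?l) mod r)) mod r = Suc ((k' ?l * (q x div 2)) mod r) mod r"
    proof -
      have "[k' ?l * ((q x div 2 + k ?l) mod r) = k' ?l * (q x div 2 + k ?l)] (mod r)"
        by (simp add: cong_def mod_mult_right_eq)
      also have "k' ?l * (q x div 2 + k ?l) = k' ?l * (q x div 2) + k ?l * k' ?l"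
        by (simp add: algebra_simps)
      also have "[\<dots> = (k' ?l * (q x div 2)) mod r + 1] (mod r)"
        by (rule cong_add[OF _ k'[OF lM]]) (simp add: cong_def)
      finally show ?thesis by (simp add: cong_def)
    qed
    ultimately show ?thesis using True r0
      by (simp add: lab_def big_shift sel_shift rotate_label_def)
  qed
  show False
  proof (rule no_fine_labelling[where lab = lab, OF M \<delta>(1) lab_shift])
    fix S A assume S: "rainbow N n C S" "A \<subseteq> simplex_face N S" and A: "A \<noteq> {}" "within_mesh \<delta> A"
    have big: "big x (sel x)" if "x \<in> A" for x
    proof -
      have "x \<in> rainbow_complex" using S that by (auto simp: rainbow_complex_def)
      then have "\<exists>l. big x l" using large by (auto simp: big_def)
      then show ?thesis unfolding sel_def by (rule LeastI_ex)
    qed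
    have lab_eq: "lab x = (2 * sel x + q x mod 2, (k' (sel x) * (q x div 2)) mod r)" if "x \<in> A" for x
      using big[OF that] by (auto simp: lab_def)
    have "lab ` A \<subseteq> {..<2 * M} \<times> {..<r}"
    proof
      fix y assume "y \<in> lab ` A"
      then obtain x where x: "x \<in> A" "y = lab x" by blast
      have "sel x < M" using big[OF x(1)] by (simp add: big_def)
      moreover have "q x mod 2 < 2" by simp
      ultimately have "2 * sel x + q x mod 2 < 2 * M" by linarith
      then show "y \<in> {..<2 * M} \<times> {..<r}" using x lab_eq r0 by simp
    qed
    \<comment> \<open>Nearby points may select different coordinates, but then their labels lie in
      different copies. If coordinate and parity agree, closeness forces the same sector.\<close>
    moreover have "inj_on fst (lab ` A)"
    proof (rule inj_onI)
      fix a b assume "a \<in> lab ` A" "b \<in> lab ` A" and eq: "fst a = fst b"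
      then obtain x y where x: "x \<in> A" "a = lab x" and y: "y \<in> A" "b = lab y" by blast
      have eq': "2 * sel x + q x mod 2 = 2 * sel y + q y mod 2" using eq x y lab_eq by simp
      have s: "sel x = sel y" using arg_cong[OF eq', of "\<lambda>c. c div 2"] by simp
      then have p: "q x mod 2 = q y mod 2" using eq' by simp
      have "norm (\<Phi> (sel x) x - \<Phi> (sel x) y) < e"
      proof -
        have "x \<in> standard_simplex N" "y \<in> standard_simplex N"
          using x(1) y(1) S(2) simplex_face_subset by blast+
        moreover have "\<forall>v. \<bar>x v - y v\<bar> \<le> \<delta>" using A(2) x(1) y(1) by (simp add: within_mesh_def)
        ultimately show ?thesis using \<delta>(2) big[OF x(1)] by (simp add: big_def)
      qed
      then have "(norm (\<Phi> (sel x) x - \<Phi> (sel x) y))\<^sup>2 < 2 * \<epsilon>\<^sup>2 * (1 - cos (pi / real r))"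
        unfolding e(2)[symmetric] by (intro power_strict_mono) auto
      moreover have "\<epsilon> \<le> norm (\<Phi> (sel x) x)" "\<epsilon> \<le> norm (\<Phi> (sel x) y)"
        using big[OF x(1)] big[OF y(1)] s by (auto simp: big_def)
      ultimately have "sector r (\<Phi> (sel x) x) = sector r (\<Phi> (sel x) y)"
        using sector_eq_of_near[OF r0 less_imp_le[OF \<epsilon>]] p s by (simp add: q_def)
      then have "q x = q y" using s by (simp add: q_def)
      then show "a = b" using x y s lab_eq by simp
    qed
    ultimately show "join_face (2 * M) r (lab ` A)" using A(1) by (simp add: join_face_def)
  qed
qed

end

section \<open>Fourier modes and regular polygons\<close>

lemma unity_root_power:
  assumes "0 < r"
  shows "cis (2 * pi / real r) ^ r = 1"
  using assms by (simp add: Complex.DeMoivre)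

lemma sum_unity_root_powers:
  fixes z :: complex
  assumes "z ^ r = 1" "z \<noteq> 1"
  shows "(\<Sum>k<r. z ^ k) = 0"
  using assms by (simp add: geometric_sum)

lemma unity_root_inj:
  assumes "0 < r" "i < r" "j < r" "cis (2 * pi / real r) ^ i = cis (2 * pi / real r) ^ j"
  shows "i = j"
proof -
  have "inj_on (\<lambda>k. cis (2 * pi * real k / real r)) {..<r}"
    using Complex.bij_betw_roots_unity[OF assms(1)] by (simp add: bij_betw_def)
  moreover have "cis (2 * pi * real k / real r) = cis (2 * pi / real r) ^ k" for k
    by (simp add: Complex.DeMoivre mult_ac)
  ultimately show ?thesis using assms(2-4) by (simp add: inj_on_def)
qed

text \<open>Discrete Fourier inversion, by orthogonality of the powers of \<open>\<omega>\<close>;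
  all but two terms vanish.\<close>

lemma two_mode_inversion:
  fixes y :: "nat \<Rightarrow> complex"
  assumes r: "2 \<le> r" and \<omega>: "\<omega> = cis (2 * pi / real r)"
    and vanish: "\<And>k. 2 \<le> k \<Longrightarrow> k < r \<Longrightarrow> (\<Sum>j<r. inverse \<omega> ^ (j * k) * y j) = 0"
  shows "\<exists>A B. \<forall>j<r. y j = A + \<omega> ^ j * B"
proof -
  have r0: "0 < r" using r by simp
  define Y where "Y k = (\<Sum>j<r. inverse \<omega> ^ (j * k) * y j)" for k
  have nz: "\<omega> \<noteq> 0" by (simp add: \<omega>)
  have one: "\<omega> ^ r = 1" unfolding \<omega> by (rule unity_root_power[OF r0])
  have "real r * y i = Y 0 + \<omega> ^ i * Y 1" if i: "i < r" for i
  proof -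
    have orth: "(\<Sum>k<r. \<omega> ^ (i * k) * inverse \<omega> ^ (j * k)) = (if i = j then of_nat r else 0)" if j: "j < r" for j
    proof -
      let ?z = "\<omega> ^ i * inverse \<omega> ^ j"
      have "\<omega> ^ (i * k) * inverse \<omega> ^ (j * k) = ?z ^ k" for k
        by (simp add: power_mult power_mult_distrib)
      then have eq: "(\<Sum>k<r. \<omega> ^ (i * k) * inverse \<omega> ^ (j * k)) = (\<Sum>k<r. ?z ^ k)" by simp
      show ?thesis
      proof (cases "i = j")
        case True
        then show ?thesis unfolding eq using nz by (simp flip: power_mult_distrib)
      next
        case False
        have "(\<omega> ^ i) ^ r = 1" "(\<omega> ^ j) ^ r = 1"
          using one by (simp_all add: power_mult[symmetric] mult.commute[of _ r] power_mult)
        then have "?z ^ r = 1" by (simp add: power_mult_distrib power_inverse)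
        moreover have "?z \<noteq> 1"
        proof
          assume "?z = 1"
          then have "\<omega> ^ i = \<omega> ^ j" using nz by (simp add: power_inverse field_simps)
          then show False using unity_root_inj[OF r0 i j] False by (simp add: \<omega>)
        qed
        ultimately show ?thesis unfolding eq using sum_unity_root_powers False by simp
      qed
    qed
    have "(\<Sum>k<r. \<omega> ^ (i * k) * Y k) = (\<Sum>j<r. (\<Sum>k<r. \<omega> ^ (i * k) * inverse \<omega> ^ (j * k)) * y j)"
      unfolding Y_def sum_distrib_left sum_distrib_right mult.assoc by (rule sum.swap)
    also have "\<dots> = (\<Sum>j<r. if i = j then of_nat r * y j else 0)"
      by (rule sum.cong) (simp_all add: orth)
    also have "\<dots> = of_nat r * y i" using i by (simp add: sum.delta)
    finally have "of_nat r * y i = (\<Sum>k<r. \<omega> ^ (i * k) * Y k)" by simp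
    also have "\<dots> = (\<Sum>k\<in>{0, 1}. \<omega> ^ (i * k) * Y k)"
    proof (rule sum.mono_neutral_right)
      show "\<forall>k\<in>{..<r} - {0, 1}. \<omega> ^ (i * k) * Y k = 0"
      proof
        fix k assume "k \<in> {..<r} - {0, 1}"
        then have "2 \<le> k" "k < r" by auto
        then show "\<omega> ^ (i * k) * Y k = 0" using vanish by (simp add: Y_def)
      qed
    qed (use r in auto)
    finally show ?thesis by simp
  qed
  then have "y i = Y 0 / of_nat r + \<omega> ^ i * (Y 1 / of_nat r)" if "i < r" for i
    using that r0 by (simp add: field_simps)
  then show ?thesis by blast
qed

section \<open>Real coordinates paired into complex ones\<close>

definition complex_coord :: "(nat \<Rightarrow> 'd) \<Rightarrow> nat \<Rightarrow> real ^ 'd \<Rightarrow> complex" where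
  "complex_coord b m x = Complex (x $ b (2 * m)) (x $ b (2 * m + 1))"

definition complex_vec :: "(nat \<Rightarrow> 'd::finite) \<Rightarrow> nat \<Rightarrow> (nat \<Rightarrow> complex) \<Rightarrow> real ^ 'd" where
  "complex_vec b h Z = (\<chi> i. let e = inv_into {..<2 * h} b i in if even e then Re (Z (e div 2)) else Im (Z (e div 2)))"

context
  fixes b :: "nat \<Rightarrow> 'd::finite" and h :: nat
  assumes b: "bij_betw b {..<2 * h} UNIV"
begin

lemma complex_vec_nth:
  "m < h \<Longrightarrow> complex_vec b h Z $ b (2 * m) = Re (Z m)"
  "m < h \<Longrightarrow> complex_vec b h Z $ b (Suc (2 * m)) = Im (Z m)"
  using bij_betw_inv_into_left[OF b, of "2 * m"] bij_betw_inv_into_left[OF b, of "Suc (2 * m)"]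
  by (simp_all add: complex_vec_def Let_def)

lemma index_cases:
  obtains m where "m < h" "i = b (2 * m) \<or> i = b (Suc (2 * m))"
proof -
  obtain e where e: "e < 2 * h" "i = b e" using b unfolding bij_betw_def by auto
  have "e div 2 < h" using e(1) by linarith
  moreover have "e = 2 * (e div 2) \<or> e = Suc (2 * (e div 2))" by presburger
  ultimately show thesis using that e(2) by metis
qed

lemma complex_vec_eqI:
  assumes "\<And>m. m < h \<Longrightarrow> x $ b (2 * m) = Re (Z m) \<and> x $ b (Suc (2 * m)) = Im (Z m)"
  shows "x = complex_vec b h Z"
  unfolding vec_eq_iff
proof
  fix i
  obtain m where "m < h" "i = b (2 * m) \<or> i = b (Suc (2 * m))" by (rule index_cases)
  then show "x $ i = complex_vec b h Z $ i" using assms[of m] complex_vec_nth by auto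
qed

lemma complex_vec_affine:
  "complex_vec b h (\<lambda>m. A m + cis t * B m)
    = complex_vec b h A + cos t *\<^sub>R complex_vec b h B + sin t *\<^sub>R complex_vec b h (\<lambda>m. \<i> * B m)"
  by (rule complex_vec_eqI[symmetric]) (simp add: complex_vec_nth)

lemma sum_pairs: "(\<Sum>e<2 * k. g e) = (\<Sum>m<k. g (2 * m) + g (Suc (2 * m)))" for g :: "nat \<Rightarrow> real"
  by (induction k) (simp_all add: add.assoc)

lemma inner_complex_vec:
  "inner (complex_vec b h Z) (complex_vec b h W) = (\<Sum>m<h. Re (Z m) * Re (W m) + Im (Z m) * Im (W m))"
proof -
  have "inner (complex_vec b h Z) (complex_vec b h W)
      = (\<Sum>i\<in>UNIV. complex_vec b h Z $ i * complex_vec b h W $ i)"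
    by (simp add: inner_vec_def)
  also have "\<dots> = (\<Sum>e<2 * h. complex_vec b h Z $ b e * complex_vec b h W $ b e)"
    by (rule sum.reindex_bij_betw[OF b, symmetric])
  also have "\<dots> = (\<Sum>m<h. Re (Z m) * Re (W m) + Im (Z m) * Im (W m))"
    unfolding sum_pairs by (rule sum.cong) (simp_all add: complex_vec_nth)
  finally show ?thesis .
qed

text \<open>Multiplication by \<open>\<i>\<close> in every coordinate turns the real vector of
  \<open>B\<close> into an orthogonal one of equal length, so the points run evenly round a circle.
  Radius \<open>0\<close> is the degenerate alternative.\<close>

lemma two_mode_polygon:
  fixes P :: "nat \<Rightarrow> real ^ 'd"
  assumes r: "0 < r"
    and P: "\<And>j m. j < r \<Longrightarrow> m < h \<Longrightarrow> complex_coord b m (P j) = A m + cis (2 * pi / real r) ^ j * B m"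
  shows "(\<forall>j<r. P j = P 0) \<or> regular_polygon_vertices r (P ` {..<r})"
proof -
  let ?U = "complex_vec b h B" and ?W = "complex_vec b h (\<lambda>m. \<i> * B m)" and ?c = "complex_vec b h A"
  have P_eq: "P j = ?c + cos (2 * pi * real j / real r) *\<^sub>R ?U + sin (2 * pi * real j / real r) *\<^sub>R ?W"
    if "j < r" for j
  proof -
    have "P j = complex_vec b h (\<lambda>m. A m + cis (2 * pi * real j / real r) * B m)"
    proof (rule complex_vec_eqI)
      fix m assume "m < h"
      then have "complex_coord b m (P j) = A m + cis (2 * pi * real j / real r) * B m"
        using P[OF that] by (simp add: Complex.DeMoivre mult_ac)
      then show "P j $ b (2 * m) = Re (A m + cis (2 * pi * real j / real r) * B m) \<and>
          P j $ b (Suc (2 * m)) = Im (A m + cis (2 * pi * real j / real r) * B m)"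
        by (simp add: complex_coord_def complex_eq_iff)
    qed
    then show ?thesis by (simp only: complex_vec_affine)
  qed
  have UW: "inner ?U ?W = 0" and WW: "inner ?W ?W = inner ?U ?U"
    by (simp_all add: inner_complex_vec add.commute)
  have norms: "norm ?W = norm ?U" using WW by (simp add: norm_eq_sqrt_inner)
  show ?thesis
  proof (cases "norm ?U = 0")
    case True
    then have "?U = 0" "?W = 0" using norms by auto
    then have "P j = ?c" if "j < r" for j using P_eq[OF that] by simp
    then show ?thesis using r by simp
  next
    case False
    let ?n = "norm ?U"
    have "regular_polygon_vertices r (P ` {..<r})"
      unfolding regular_polygon_vertices_def
    proof (intro exI conjI)
      show "norm (?U /\<^sub>R ?n) = 1" "norm (?W /\<^sub>R ?n) = 1" using False norms by simp_all
      show "inner (?U /\<^sub>R ?n) (?W /\<^sub>R ?n) = 0" using UW by simp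
      show "?n > 0" using False by simp
      show "P ` {..<r} = (\<lambda>k. ?c + ?n *\<^sub>R (cos (2 * pi * real k / real r) *\<^sub>R (?U /\<^sub>R ?n) +
          sin (2 * pi * real k / real r) *\<^sub>R (?W /\<^sub>R ?n))) ` {..<r}"
      proof (rule image_cong)
        have "?n *\<^sub>R (c *\<^sub>R (V /\<^sub>R ?n)) = c *\<^sub>R V" for c and V :: "real ^ 'd"
          using False by (simp add: field_simps)
        then show "P k = ?c + ?n *\<^sub>R (cos (2 * pi * real k / real r) *\<^sub>R (?U /\<^sub>R ?n) +
          sin (2 * pi * real k / real r) *\<^sub>R (?W /\<^sub>R ?n))" if "k \<in> {..<r}" for k
          using P_eq[of k] that by (simp only: scaleR_add_right add.assoc lessThan_iff)
      qed simp
    qed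
    then show ?thesis ..
  qed
qed

end

section \<open>Orbits of the shift and their Fourier modes\<close>

context rainbow_shift
begin

lemma \<tau>_funpow_inj: "inj (\<tau> ^^ j)"
proof -
  have "inj \<tau>" by (rule injI) (metis \<tau>_inverse(1))
  then show ?thesis by (rule inj_fn)
qed

lemma \<tau>_funpow_image_class: "i \<in> {1..n} \<Longrightarrow> (\<tau> ^^ j) ` C i = C i"
  using \<tau>_funpow_class class_subset[of i] finite_subset[of "C i" "{..N}"]
  by (intro endo_inj_surj) (auto intro: inj_on_subset[OF \<tau>_funpow_inj])

lemma \<tau>_funpow_le: "v \<le> N \<Longrightarrow> (\<tau> ^^ j) v \<le> N"
  using class_ex[of v] \<tau>_funpow_class class_subset by blast

lemma \<tau>_funpow_outside: "N < v \<Longrightarrow> (\<tau> ^^ j) v = v"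
  by (induction j) (simp_all add: \<tau>_outside)

lemma sum_\<tau>_funpow: "(\<Sum>v\<le>N. g ((\<tau> ^^ j) v)) = (\<Sum>v\<le>N. g v)" for g :: "nat \<Rightarrow> 'b::comm_monoid_add"
proof (rule sum.reindex_bij_betw)
  have "(\<tau> ^^ j) ` {..N} = {..N}"
    using \<tau>_funpow_le by (intro endo_inj_surj) (auto intro: inj_on_subset[OF \<tau>_funpow_inj])
  then show "bij_betw (\<tau> ^^ j) {..N} {..N}"
    by (simp add: bij_betw_def inj_on_subset[OF \<tau>_funpow_inj])
qed

lemma \<tau>_funpow_neq:
  assumes "v \<le> N" "i < j" "j - i < r"
  shows "(\<tau> ^^ i) v \<noteq> (\<tau> ^^ j) v"
proof
  assume eq: "(\<tau> ^^ i) v = (\<tau> ^^ j) v"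
  have "(\<tau> ^^ j) v = (\<tau> ^^ (j - i)) ((\<tau> ^^ i) v)"
    using assms(2) by (simp flip: funpow_add comp_apply[of "\<tau> ^^ (j - i)"])
  then show False using \<tau>_free[OF \<tau>_funpow_le[OF assms(1), of i], of "j - i"] assms eq by simp
qed

text \<open>The \<open>j\<close>-th translate lives on the preimage of \<open>S\<close> under
  \<open>\<tau> ^^ j\<close>, and freeness makes these preimages disjoint for \<open>r\<close>
  consecutive exponents. The exponent \<open>r\<close> plays the role of \<open>0\<close>.\<close>

lemma equal_rainbow_points_shift:
  assumes S: "rainbow N n C S" and x: "x \<in> simplex_face N S"
  shows "equal_rainbow_points N n r C (\<lambda>j. (shift ^^ j) x)"
proof -
  define T where "T j = {v. v \<le> N \<and> (\<tau> ^^ j) v \<in> S}" for j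
  have "\<forall>i\<in>{1..n}. \<exists>s. S \<inter> C i = {s}"
    using S by (auto simp: rainbow_def card_1_singleton_iff)
  from bchoice[OF this] obtain s where s: "\<And>i. i \<in> {1..n} \<Longrightarrow> S \<inter> C i = {s i}" by blast
  have Tc: "(\<tau> ^^ j) v = s i" if "i \<in> {1..n}" "v \<in> T j \<inter> C i" for i j v
    using s[OF that(1)] \<tau>_funpow_class[OF that(1), of v j] that(2) by (auto simp: T_def)
  have rT: "rainbow N n C (T j)" for j
    unfolding rainbow_def
  proof (intro conjI ballI)
    show "T j \<subseteq> {..N}" by (auto simp: T_def)
    fix i assume i: "i \<in> {1..n}"
    have "s i \<in> C i" "s i \<in> S" using s[OF i] by auto
    then have "s i \<in> (\<tau> ^^ j) ` C i" by (simp only: \<tau>_funpow_image_class[OF i])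
    then obtain v where v: "v \<in> C i" "(\<tau> ^^ j) v = s i" by (elim imageE) (rule that, simp_all)
    have "T j \<inter> C i = {v}"
    proof
      show "T j \<inter> C i \<subseteq> {v}"
      proof
        fix u assume "u \<in> T j \<inter> C i"
        then have "(\<tau> ^^ j) u = (\<tau> ^^ j) v" using Tc[OF i] v(2) by simp
        then have "u = v" by (rule injD[OF \<tau>_funpow_inj])
        then show "u \<in> {v}" by simp
      qed
      show "{v} \<subseteq> T j \<inter> C i" using v \<open>s i \<in> S\<close> class_subset[OF i] by (auto simp: T_def)
    qed
    then show "card (T j \<inter> C i) = 1" by simp
  qed
  have face: "(shift ^^ j) x \<in> simplex_face N (T j)" for j
    unfolding simplex_face_def standard_simplex_def mem_Collect_eq
  proof (intro conjI allI impI)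
    have x': "x \<in> standard_simplex N" "\<And>v. v \<notin> S \<Longrightarrow> x v = 0" using x by (auto simp: simplex_face_def)
    show "0 \<le> (shift ^^ j) x v" "(shift ^^ j) x v \<le> 1" for v
      using x'(1) by (simp_all add: shift_funpow standard_simplex_def)
    show "(shift ^^ j) x v = 0" if "N < v" for v
      using x'(1) that by (simp add: shift_funpow \<tau>_funpow_outside standard_simplex_def)
    show "(\<Sum>v\<le>N. (shift ^^ j) x v) = 1"
      using x'(1) by (simp add: shift_funpow sum_\<tau>_funpow standard_simplex_def)
    show "(shift ^^ j) x v = 0" if "v \<notin> T j" for v
    proof (cases "v \<le> N")
      case True
      then show ?thesis using that x'(2) by (simp add: shift_funpow T_def)
    next
      case False
      then show ?thesis using x'(1) by (simp add: shift_funpow \<tau>_funpow_outside standard_simplex_def)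
    qed
  qed
  have disj: "simplex_face N (T i) \<inter> simplex_face N (T j) = {}"
    if ij: "i \<in> {1..r}" "j \<in> {1..r}" "i < j" for i j
  proof -
    have "T i \<inter> T j = {}"
    proof (rule ccontr)
      assume "T i \<inter> T j \<noteq> {}"
      then obtain v where v: "v \<in> T i" "v \<in> T j" by blast
      then have "v \<le> N" by (simp add: T_def)
      then obtain c where c: "c \<in> {1..n}" "v \<in> C c" using class_ex by blast
      have "(\<tau> ^^ i) v = (\<tau> ^^ j) v" using Tc[OF c(1), of v] v c(2) by simp
      moreover have "j - i < r" using ij by auto
      ultimately show False using \<tau>_funpow_neq[OF \<open>v \<le> N\<close> ij(3)] by blast
    qed
    then have "z v = 0" if "z \<in> simplex_face N (T i)" "z \<in> simplex_face N (T j)" for z v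
      using that by (cases "v \<in> T i") (auto simp: simplex_face_def)
    moreover have "(\<Sum>v\<le>N. z v) = 1" if "z \<in> simplex_face N (T i)" for z
      using that by (simp add: simplex_face_def standard_simplex_def)
    ultimately show ?thesis by fastforce
  qed
  have "disjoint_family_on (\<lambda>j. simplex_face N (T j)) {1..r}"
    unfolding disjoint_family_on_def
  proof (intro ballI impI)
    fix i j assume "i \<in> {1..r}" "j \<in> {1..r}" "i \<noteq> j"
    then show "simplex_face N (T i) \<inter> simplex_face N (T j) = {}"
      using disj[of i j] disj[of j i] by (cases i j rule: linorder_cases) (auto simp: Int_commute)
  qed
  moreover have "(shift ^^ j) x v = x (s i)" if "i \<in> {1..n}" "v \<in> T j \<inter> C i" for i j v
    using Tc[OF that] by (simp add: shift_funpow)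
  ultimately show ?thesis
    unfolding equal_rainbow_points_def using rT face
    by (intro exI[of _ T] conjI exI[of _ "\<lambda>i. x (s i)"]) auto
qed

definition fourier_coeff :: "(nat \<Rightarrow> 'd) \<Rightarrow> ((nat \<Rightarrow> real) \<Rightarrow> real ^ 'd) \<Rightarrow> nat \<Rightarrow> nat \<Rightarrow> (nat \<Rightarrow> real) \<Rightarrow> complex" where
  "fourier_coeff b f k m x =
     (\<Sum>j<r. inverse (cis (2 * pi / real r)) ^ (j * k) * complex_coord b m (f ((shift ^^ j) x)))"

lemma shift_funpow_period: "(shift ^^ r) x = x"
  by (rule ext) (simp only: shift_funpow \<tau>_period)

text \<open>Reindexing a cyclic sum by one step: the end terms agree since the \<open>r\<close>-th
  power of the root and the \<open>r\<close>-fold shift are both trivial.\<close>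

lemma fourier_coeff_shift:
  "fourier_coeff b f k m (shift x) = cis (2 * pi / real r) ^ k * fourier_coeff b f k m x"
proof -
  define w where "w = cis (2 * pi / real r)"
  define g where "g j = inverse w ^ (j * k) * complex_coord b m (f ((shift ^^ j) x))" for j
  have w: "w \<noteq> 0" "w ^ r = 1" using unity_root_power[of r] r by (simp_all add: w_def)
  have "g r = g 0" by (simp add: g_def shift_funpow_period power_mult power_inverse w)
  then have "(\<Sum>j<r. g (Suc j) - g j) = 0" by (subst sum_lessThan_telescope) simp
  then have shift_sum: "(\<Sum>j<r. g (Suc j)) = (\<Sum>j<r. g j)" by (simp add: sum_subtractf)
  have unit: "w ^ k * inverse w ^ k = 1" by (simp add: power_inverse w)
  have "inverse w ^ (j * k) * complex_coord b m (f ((shift ^^ j) (shift x))) = w ^ k * g (Suc j)" for j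
  proof -
    have "inverse w ^ (Suc j * k) = inverse w ^ k * inverse w ^ (j * k)" by (simp add: power_add)
    then have "w ^ k * g (Suc j) = (w ^ k * inverse w ^ k) * (inverse w ^ (j * k) * complex_coord b m (f ((shift ^^ Suc j) x)))"
      unfolding g_def by (simp only: mult.assoc)
    then show ?thesis unfolding unit by (simp only: mult_1 funpow_Suc_right comp_apply)
  qed
  then have "fourier_coeff b f k m (shift x) = w ^ k * (\<Sum>j<r. g (Suc j))"
    unfolding fourier_coeff_def sum_distrib_left by (simp add: w_def)
  then show ?thesis unfolding shift_sum by (simp add: g_def fourier_coeff_def w_def)
qed

lemma fourier_zero_polygon:
  fixes f :: "(nat \<Rightarrow> real) \<Rightarrow> real ^ 'd::finite"
  assumes b: "bij_betw b {..<2 * h} UNIV"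
    and zero: "\<And>k m. \<lbrakk>2 \<le> k; k < r; m < h\<rbrakk> \<Longrightarrow> fourier_coeff b f k m x = 0"
  shows "(\<forall>j. f ((shift ^^ j) x) = f x) \<or> regular_polygon_vertices r ((\<lambda>j. f ((shift ^^ j) x)) ` {1..r})"
proof -
  let ?w = "cis (2 * pi / real r)"
  define P where "P j = f ((shift ^^ j) x)" for j
  have r0: "0 < r" using r by simp
  have "\<exists>A B. \<forall>j<r. complex_coord b m (P j) = A + ?w ^ j * B" if m: "m < h" for m
    by (rule two_mode_inversion[OF r refl]) (use zero m in \<open>simp add: P_def fourier_coeff_def\<close>)
  then obtain A B where AB: "\<And>m j. m < h \<Longrightarrow> j < r \<Longrightarrow> complex_coord b m (P j) = A m + ?w ^ j * B m" by metis
  have dich: "(\<forall>j<r. P j = P 0) \<or> regular_polygon_vertices r (P ` {..<r})"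
    by (rule two_mode_polygon[OF b r0]) (rule AB)
  have Pr: "P r = P 0" by (simp add: P_def shift_funpow_period)
  have "P ` {1..r} = P ` {..<r}"
  proof -
    have "{1..r} = insert r {1..<r}" "{..<r} = insert 0 {1..<r}" using r0 by auto
    then show ?thesis using Pr by simp
  qed
  moreover have "P j = P (j mod r)" for j
  proof -
    have "(shift ^^ j) x = (shift ^^ (j mod r)) x"
      using funpow_mod_eq[where f = shift and n = r and x = x and m = j] shift_funpow_period by simp
    then show ?thesis by (simp add: P_def)
  qed
  then have "(\<forall>j<r. P j = P 0) \<longrightarrow> (\<forall>j. P j = P 0)" using r0 by (metis mod_less_divisor)
  ultimately show ?thesis using dich by (auto simp: P_def)
qed

end

section \<open>Existence of equivariant zeros\<close>

lemma rainbow_shift_exists: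
  assumes C: "color_classes N n r C" and r: "2 \<le> r"
  shows "\<exists>\<tau>. rainbow_shift N n r C \<tau>"
proof -
  have fin: "finite (C i)" and card: "card (C i) = r" if "i \<in> {1..n}" for i
  proof -
    show "card (C i) = r" using C that unfolding color_classes_def by blast
    then show "finite (C i)" using r by (simp add: card_ge_0_finite)
  qed
  have "\<exists>h. bij_betw h {0..<r} (C i)" if "i \<in> {1..n}" for i
    using ex_bij_betw_nat_finite[OF fin[OF that]] card[OF that] by simp
  then have "\<forall>i\<in>{1..n}. \<exists>h. bij_betw h {0..<r} (C i)" by blast
  from bchoice[OF this] obtain h where h: "\<And>i. i \<in> {1..n} \<Longrightarrow> bij_betw (h i) {0..<r} (C i)" by blast
  define cls where "cls v = (SOME i. i \<in> {1..n} \<and> v \<in> C i)" for v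
  define \<tau> where "\<tau> v = (if v \<le> N then h (cls v) (Suc (inv_into {0..<r} (h (cls v)) v) mod r) else v)" for v
  have sub: "C i \<subseteq> {..N}" if "i \<in> {1..n}" for i using C that unfolding color_classes_def by blast
  have disj: "i = j" if "i \<in> {1..n}" "j \<in> {1..n}" "v \<in> C i" "v \<in> C j" for i j v
    using C that unfolding color_classes_def disjoint_family_on_def by blast
  have cls: "cls v = i" if "i \<in> {1..n}" "v \<in> C i" for i v
    unfolding cls_def by (rule some_equality) (use that disj in blast)+
  have mem: "h i e \<in> C i" if "i \<in> {1..n}" "e < r" for i e
    using bij_betwE[OF h[OF that(1)]] that(2) by simp
  have \<tau>h: "\<tau> (h i e) = h i (Suc e mod r)" if i: "i \<in> {1..n}" and e: "e < r" for i e
  proof -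
    have "h i e \<le> N" using mem[OF i e] sub[OF i] by auto
    moreover have "inv_into {0..<r} (h i) (h i e) = e"
      using bij_betw_inv_into_left[OF h[OF i]] e by simp
    ultimately show ?thesis by (simp only: \<tau>_def cls[OF i mem[OF i e]] if_True)
  qed
  have pow: "(\<tau> ^^ j) (h i e) = h i ((e + j) mod r)" if i: "i \<in> {1..n}" and e: "e < r" for i e j
  proof (induction j)
    case 0
    then show ?case using e by simp
  next
    case (Suc j)
    have "(e + j) mod r < r" using e by simp
    then have "\<tau> (h i ((e + j) mod r)) = h i (Suc ((e + j) mod r) mod r)" by (rule \<tau>h[OF i])
    then show ?case by (simp only: funpow.simps(2) comp_apply Suc mod_Suc_eq add_Suc_right)
  qed
  have form: "\<exists>i e. i \<in> {1..n} \<and> e < r \<and> v = h i e" if "v \<le> N" for v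
  proof -
    have "v \<in> (\<Union>i\<in>{1..n}. C i)" using C that by (simp add: color_classes_def)
    then obtain i where i: "i \<in> {1..n}" "v \<in> C i" by blast
    then have "v \<in> h i ` {0..<r}" using h[OF i(1)] by (simp add: bij_betw_def)
    then obtain e where "e < r" "v = h i e" by auto
    then show ?thesis using i(1) by blast
  qed
  have out: "(\<tau> ^^ j) v = v" if "N < v" for j v
    by (induction j) (use that in \<open>simp_all add: \<tau>_def\<close>)
  have "rainbow_shift N n r C \<tau>"
  proof
    show "color_classes N n r C" "2 \<le> r" by fact+
    show "\<tau> v \<in> C i" if i: "i \<in> {1..n}" and v: "v \<in> C i" for i v
    proof -
      have "v \<in> h i ` {0..<r}" using h[OF i] v by (simp add: bij_betw_def)
      then obtain e where e: "e < r" "v = h i e" by auto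
      show ?thesis unfolding e(2) \<tau>h[OF i e(1)] by (rule mem[OF i]) (use r in simp)
    qed
    show "\<tau> v = v" if "N < v" for v using that by (simp add: \<tau>_def)
    show "(\<tau> ^^ r) v = v" for v
    proof (cases "v \<le> N")
      case True
      then obtain i e where "i \<in> {1..n}" "e < r" "v = h i e" using form by blast
      then show ?thesis using pow by simp
    next
      case False
      then show ?thesis using out by simp
    qed
    show "(\<tau> ^^ j) v \<noteq> v" if v: "v \<le> N" and j: "0 < j" "j < r" for v j
    proof
      assume eq: "(\<tau> ^^ j) v = v"
      obtain i e where ie: "i \<in> {1..n}" "e < r" "v = h i e" using form[OF v] by blast
      have "h i ((e + j) mod r) = h i e" using eq pow ie by simp
      moreover have "inj_on (h i) {0..<r}" using h[OF ie(1)] by (simp add: bij_betw_def)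
      ultimately have "(e + j) mod r = e" using ie(2) by (simp add: inj_on_def)
      moreover have "(e + j) mod r = e + j - r" if "\<not> e + j < r"
        using that j ie(2) by (simp add: le_mod_geq)
      ultimately show False using j ie(2) by (cases "e + j < r") auto
    qed
  qed
  then show ?thesis by blast
qed

lemma continuous_on_complex_coord: "continuous_on S (complex_coord b m)"
  unfolding complex_coord_def Complex_eq by (intro continuous_intros)

lemma complex_coord_sum:
  "complex_coord b m (\<Sum>v\<in>A. c v *\<^sub>R p v) = (\<Sum>v\<in>A. of_real (c v) * complex_coord b m (p v))"
  by (simp add: complex_coord_def complex_eq_iff)

context rainbow_shift
begin

lemma shift_funpow_simplex: "x \<in> standard_simplex N \<Longrightarrow> (shift ^^ j) x \<in> standard_simplex N"
proof -
  assume x: "x \<in> standard_simplex N"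
  have "(shift ^^ j) x v = 0" if "N < v" for v
    using x that by (simp add: shift_funpow \<tau>_funpow_outside standard_simplex_def)
  moreover have "(\<Sum>v\<le>N. (shift ^^ j) x v) = 1"
    using x by (simp add: shift_funpow sum_\<tau>_funpow standard_simplex_def)
  ultimately show ?thesis using x by (simp add: shift_funpow standard_simplex_def)
qed

lemma continuous_on_fourier_coeff:
  assumes f: "continuous_on (standard_simplex N) f"
  shows "continuous_on (standard_simplex N) (fourier_coeff b f k m)"
proof -
  have "continuous_on (standard_simplex N) (shift ^^ j)" for j
    by (intro continuous_on_coordinatewise_then_product)
      (simp add: shift_funpow continuous_on_subset[OF continuous_on_product_coordinates])
  then have "continuous_on (standard_simplex N) (\<lambda>x. f ((shift ^^ j) x))" for j
    by (rule continuous_on_compose2[OF f]) (use shift_funpow_simplex in auto)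
  then have "continuous_on (standard_simplex N) (\<lambda>x. complex_coord b m (f ((shift ^^ j) x)))" for j
    by (rule continuous_on_compose2[OF continuous_on_complex_coord[of UNIV]]) auto
  then show ?thesis unfolding fourier_coeff_def
    by (intro continuous_on_sum continuous_on_mult continuous_on_const)
qed

lemma prime_fourier_zero:
  fixes f :: "(nat \<Rightarrow> real) \<Rightarrow> real ^ 'd"
  assumes "prime r" "0 < h" and n: "n = (r - 2) * (2 * h) + 1"
    and f: "continuous_on (standard_simplex N) f"
  shows "\<exists>x\<in>rainbow_complex. \<forall>k m. 2 \<le> k \<longrightarrow> k < r \<longrightarrow> m < h \<longrightarrow> fourier_coeff b f k m x = 0"
proof -
  define M where "M = (r - 2) * h"
  \<comment> \<open>Pairs of mode and coordinate are numbered in blocks of length \<open>h\<close>;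
    modes \<open>0\<close> and \<open>1\<close> are left free, hence the offset
    \<open>2\<close>.\<close>
  define \<Phi> where "\<Phi> l = fourier_coeff b f (2 + l div h) (l mod h)" for l
  have "\<exists>x\<in>rainbow_complex. \<forall>l<M. \<Phi> l x = 0"
  proof (rule equivariant_zero[where k = "\<lambda>l. 2 + l div h"])
    show "2 * M < n" by (simp add: M_def n)
    show "coprime (2 + l div h) r" if "l < M" for l
    proof -
      have "l div h < r - 2" using that \<open>0 < h\<close> by (simp add: M_def less_mult_imp_div_less)
      then have "\<not> r dvd 2 + l div h" by (intro nat_dvd_not_less) auto
      then have "coprime r (2 + l div h)" by (rule prime_imp_coprime[OF \<open>prime r\<close>])
      then show ?thesis by (simp add: coprime_commute)
    qed
    show "\<Phi> l (shift x) = cis (2 * pi / real r) ^ (2 + l div h) * \<Phi> l x" for l x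
      unfolding \<Phi>_def by (rule fourier_coeff_shift)
    show "continuous_on (standard_simplex N) (\<Phi> l)" for l
      unfolding \<Phi>_def by (rule continuous_on_fourier_coeff[OF f])
  qed
  then obtain x where x: "x \<in> rainbow_complex" "\<And>l. l < M \<Longrightarrow> \<Phi> l x = 0" by blast
  have "fourier_coeff b f k m x = 0" if km: "2 \<le> k" "k < r" "m < h" for k m
  proof -
    let ?l = "(k - 2) * h + m"
    have "?l < (k - 2) * h + h" using km by simp
    also have "\<dots> = Suc (k - 2) * h" by simp
    also have "\<dots> \<le> M" unfolding M_def by (rule mult_le_mono1) (use km in simp)
    finally have "\<Phi> ?l x = 0" by (rule x(2))
    moreover have "2 + ?l div h = k" "?l mod h = m" using km by simp_all
    ultimately show ?thesis unfolding \<Phi>_def by (simp only:)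
  qed
  then show ?thesis using x(1) by blast
qed

text \<open>Each mode is linear in the barycentric coordinates, so a zero on a rainbow face is a
  linear relation among vectors attached to its vertices.\<close>

lemma fourier_coeff_affine:
  "fourier_coeff b (affine_simplex_map N p) k m x
    = (\<Sum>v\<le>N. of_real (x v) * fourier_coeff b (affine_simplex_map N p) k m (vertex_point v))"
proof -
  let ?c = "\<lambda>j. inverse (cis (2 * pi / real r)) ^ (j * k)" and ?g = "\<lambda>u. complex_coord b m (p u)"
  have coeff: "fourier_coeff b (affine_simplex_map N p) k m x
      = (\<Sum>j<r. \<Sum>u\<le>N. of_real (x ((\<tau> ^^ j) u)) * (?c j * ?g u))" for x
    unfolding fourier_coeff_def affine_simplex_map_def complex_coord_sum shift_funpow sum_distrib_left
    by (simp only: mult.left_commute)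
  have "of_real (x ((\<tau> ^^ j) u)) * (?c j * ?g u)
      = (\<Sum>v\<le>N. of_real (x v) * (of_real (vertex_point v ((\<tau> ^^ j) u)) * (?c j * ?g u)))"
    if "u \<le> N" for j u
  proof -
    have "(\<Sum>v\<le>N. of_real (x v) * (of_real (vertex_point v ((\<tau> ^^ j) u)) * (?c j * ?g u)))
        = (\<Sum>v\<le>N. if v = (\<tau> ^^ j) u then of_real (x v) * (?c j * ?g u) else 0)"
      by (rule sum.cong) (auto simp: vertex_point_def)
    then show ?thesis using \<tau>_funpow_le[OF that, of j] by simp
  qed
  then have "fourier_coeff b (affine_simplex_map N p) k m x
     = (\<Sum>j<r. \<Sum>u\<le>N. \<Sum>v\<le>N. of_real (x v) * (of_real (vertex_point v ((\<tau> ^^ j) u)) * (?c j * ?g u)))"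
    unfolding coeff by simp
  also have "\<dots> = (\<Sum>j<r. \<Sum>v\<le>N. \<Sum>u\<le>N. of_real (x v) * (of_real (vertex_point v ((\<tau> ^^ j) u)) * (?c j * ?g u)))"
    by (rule sum.cong[OF refl]) (rule sum.swap)
  also have "\<dots> = (\<Sum>v\<le>N. \<Sum>j<r. \<Sum>u\<le>N. of_real (x v) * (of_real (vertex_point v ((\<tau> ^^ j) u)) * (?c j * ?g u)))"
    by (rule sum.swap)
  finally show ?thesis unfolding coeff sum_distrib_left .
qed

text \<open>The shift permutes the class and multiplies the sum by a root of unity other than
  \<open>1\<close>. Coprimality with \<open>r\<close> plays no part, so composite \<open>r\<close>
  is covered for affine maps.\<close>

lemma fourier_coeff_class_sum:
  assumes i: "i \<in> {1..n}" and k: "0 < k" "k < r"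
  shows "(\<Sum>v\<in>C i. fourier_coeff b f k m (vertex_point v)) = 0"
proof -
  let ?w = "cis (2 * pi / real r)" and ?F = "\<lambda>v. fourier_coeff b f k m (vertex_point v)"
  have "bij_betw (\<tau> ^^ (r - 1)) (C i) (C i)"
    by (simp add: bij_betw_def inj_on_subset[OF \<tau>_funpow_inj] \<tau>_funpow_image_class[OF i])
  then have "(\<Sum>v\<in>C i. ?F v) = (\<Sum>v\<in>C i. ?F ((\<tau> ^^ (r - 1)) v))"
    by (rule sum.reindex_bij_betw[symmetric])
  also have "\<dots> = ?w ^ k * (\<Sum>v\<in>C i. ?F v)"
    by (simp only: shift_vertex_point[symmetric] fourier_coeff_shift sum_distrib_left)
  finally have "(1 - ?w ^ k) * (\<Sum>v\<in>C i. ?F v) = 0" by (simp add: left_diff_distrib)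
  moreover have "?w ^ k \<noteq> 1"
  proof
    assume "?w ^ k = 1"
    then have "?w ^ k = ?w ^ 0" by simp
    then have "k = 0" using k by (intro unity_root_inj[of r]) auto
    then show False using k by simp
  qed
  ultimately show ?thesis by simp
qed

text \<open>Real and imaginary parts make \<open>n - 1\<close> real equations, the dimension in
  which the colourful Caratheodory theorem takes exactly \<open>n\<close> classes; its index
  \<open>i\<close> stands for colour \<open>Suc i\<close>.\<close>

lemma affine_fourier_zero:
  assumes "0 < h" and n: "n = (r - 2) * (2 * h) + 1"
  shows "\<exists>x\<in>rainbow_complex. \<forall>k m. 2 \<le> k \<longrightarrow> k < r \<longrightarrow> m < h \<longrightarrow>
    fourier_coeff b (affine_simplex_map N p) k m x = 0"
proof -
  define q where "q = (r - 2) * (2 * h)"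
  let ?F = "fourier_coeff b (affine_simplex_map N p)"
  define I where "I = {2..<r} \<times> {..<h} \<times> (UNIV :: bool set)"
  define a where "a v = (\<lambda>(k, m, e). if e then Re (?F k m (vertex_point v)) else Im (?F k m (vertex_point v)))" for v
  have "\<exists>\<sigma> t. (\<forall>i\<le>q. \<sigma> i \<in> C (Suc i)) \<and> t \<in> standard_simplex q \<and> (\<forall>e\<in>I. (\<Sum>i\<le>q. t i * a (\<sigma> i) e) = 0)"
  proof (rule colourful_caratheodory)
    show "finite I" "card I = q" by (simp_all add: I_def q_def card_cartesian_product)
    show "finite (C (Suc i)) \<and> C (Suc i) \<noteq> {}" if "i \<le> q" for i
      using that class_subset[of "Suc i"] class_nonempty[of "Suc i"] finite_subset[of "C (Suc i)" "{..N}"]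
      by (simp add: n q_def)
    show "(\<Sum>v\<in>C (Suc i). a v e) = 0" if ie: "i \<le> q" "e \<in> I" for i e
    proof -
      obtain k m s where e: "e = (k, m, s)" "2 \<le> k" "k < r" using ie(2) by (auto simp: I_def)
      have z: "(\<Sum>v\<in>C (Suc i). ?F k m (vertex_point v)) = 0"
        using ie(1) e by (intro fourier_coeff_class_sum) (auto simp: n q_def)
      show ?thesis using arg_cong[OF z, of Re] arg_cong[OF z, of Im]
        by (cases s) (simp_all add: a_def e)
    qed
  qed
  then obtain \<sigma> t where \<sigma>: "\<And>i. i \<le> q \<Longrightarrow> \<sigma> i \<in> C (Suc i)" and t: "t \<in> standard_simplex q"
    and zero: "\<And>e. e \<in> I \<Longrightarrow> (\<Sum>i\<le>q. t i * a (\<sigma> i) e) = 0" by blast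
  define S where "S = (\<lambda>i. \<sigma> (i - 1)) ` {1..n}"
  define x where "x u = (\<Sum>i\<le>q. t i * vertex_point (\<sigma> i) u)" for u
  have mem: "\<sigma> (i - 1) \<in> C i" if "i \<in> {1..n}" for i
    using \<sigma>[of "i - 1"] that by (auto simp: n q_def)
  then have S: "rainbow N n C S" unfolding S_def by (rule rainbow_range)
  have \<sigma>S: "\<sigma> i \<in> S" "\<sigma> i \<le> N" if "i \<le> q" for i
  proof -
    show "\<sigma> i \<in> S" unfolding S_def using that by (intro image_eqI[of _ _ "Suc i"]) (auto simp: n q_def)
    then show "\<sigma> i \<le> N" using S by (auto simp: rainbow_def)
  qed
  have t0: "0 \<le> t i" and t1: "sum t {..q} = 1" for i using t by (auto simp: standard_simplex_def)
  have vp: "0 \<le> vertex_point v u" "vertex_point v u \<le> 1" for v u by (simp_all add: vertex_point_def)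
  have sum_x: "(\<Sum>u\<le>N. of_real (x u) * g u) = (\<Sum>i\<le>q. of_real (t i) * g (\<sigma> i))"
    for g :: "nat \<Rightarrow> 'b :: real_algebra_1"
  proof -
    have "(\<Sum>u\<le>N. of_real (x u) * g u) = (\<Sum>i\<le>q. \<Sum>u\<le>N. of_real (t i * vertex_point (\<sigma> i) u) * g u)"
      unfolding x_def of_real_sum sum_distrib_right by (rule sum.swap)
    also have "\<dots> = (\<Sum>i\<le>q. of_real (t i) * g (\<sigma> i))"
    proof (rule sum.cong[OF refl])
      fix i assume "i \<in> {..q}"
      then have "\<sigma> i \<in> {..N}" using \<sigma>S by simp
      moreover have "(\<Sum>u\<le>N. of_real (t i * vertex_point (\<sigma> i) u) * g u)
          = (\<Sum>u\<le>N. if u = \<sigma> i then of_real (t i) * g u else 0)"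
        by (rule sum.cong) (auto simp: vertex_point_def)
      ultimately show "(\<Sum>u\<le>N. of_real (t i * vertex_point (\<sigma> i) u) * g u) = of_real (t i) * g (\<sigma> i)"
        by simp
    qed
    finally show ?thesis .
  qed
  have "x \<in> simplex_face N S"
    unfolding simplex_face_def standard_simplex_def mem_Collect_eq
  proof (intro conjI allI impI)
    show "0 \<le> x u" for u unfolding x_def by (intro sum_nonneg mult_nonneg_nonneg t0 vp)
    have "x u \<le> (\<Sum>i\<le>q. t i * 1)" for u unfolding x_def by (intro sum_mono mult_left_mono t0 vp)
    then show "x u \<le> 1" for u using t1 by simp
    show zero_out: "x u = 0" if "u \<notin> S" for u
      unfolding x_def by (rule sum.neutral) (use that \<sigma>S in \<open>auto simp: vertex_point_def\<close>)
    show "x u = 0" if "N < u" for u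
      by (rule zero_out) (use that S in \<open>auto simp: rainbow_def\<close>)
    show "sum x {..N} = 1" using sum_x[of "\<lambda>_. 1 :: real"] t1 by simp
  qed
  then have "x \<in> rainbow_complex" using S by (auto simp: rainbow_complex_def)
  moreover have "?F k m x = 0" if km: "2 \<le> k" "k < r" "m < h" for k m
  proof -
    have eq: "?F k m x = (\<Sum>i\<le>q. of_real (t i) * ?F k m (vertex_point (\<sigma> i)))"
      by (subst fourier_coeff_affine) (rule sum_x)
    have "(k, m, True) \<in> I" "(k, m, False) \<in> I" using km by (auto simp: I_def)
    from zero[OF this(1)] zero[OF this(2)] show ?thesis
      unfolding eq by (simp add: complex_eq_iff a_def)
  qed
  ultimately show ?thesis by blast
qed

end

section \<open>Generic affine maps\<close>

text \<open>Fubini in the single coordinate \<open>i\<close>, where each slice of the zero set lies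
  in a hyperplane with normal \<open>c\<close>.\<close>

lemma emeasure_affine_coordinate_zero:
  fixes L :: "(nat \<Rightarrow> real ^ 'd::finite) \<Rightarrow> real"
  assumes J: "finite J" "i \<notin> J"
    and meas: "L \<in> borel_measurable (Pi\<^sub>M (insert i J) (\<lambda>_. lborel))"
    and c: "c \<noteq> 0" and L: "\<And>y q. L (y(i := q)) = inner c q + K y"
  shows "emeasure (Pi\<^sub>M (insert i J) (\<lambda>_. lborel)) {y \<in> space (Pi\<^sub>M (insert i J) (\<lambda>_. lborel)). L y = 0} = 0"
proof -
  interpret product_sigma_finite "\<lambda>_ :: nat. lborel :: (real ^ 'd) measure"
    by (intro product_sigma_finite.intro lborel.sigma_finite_measure_axioms)
  let ?M = "Pi\<^sub>M (insert i J) (\<lambda>_. lborel :: (real ^ 'd) measure)"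
  define A where "A = {y \<in> space ?M. L y = 0}"
  have A: "A \<in> sets ?M"
    unfolding A_def by (rule borel_measurable_eq[OF meas borel_measurable_const])
  have inner0: "(\<integral>\<^sup>+ q. indicator A (y(i := q)) \<partial>lborel) = 0" for y
  proof -
    have "{q. inner c q = - K y} \<in> sets borel" by (intro borel_closed closed_hyperplane)
    moreover have "negligible {q. inner c q = - K y}" using c by (intro negligible_hyperplane) simp
    ultimately have null: "{q. inner c q = - K y} \<in> null_sets lborel"
      by (simp add: negligible_iff_null_sets null_sets_completion_iff)
    have "(\<integral>\<^sup>+ q. indicator A (y(i := q)) \<partial>lborel) \<le> (\<integral>\<^sup>+ q. indicator {q. inner c q = - K y} q \<partial>lborel)"
      by (rule nn_integral_mono) (auto simp: A_def L indicator_def)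
    also have "\<dots> = 0" using null by (simp add: null_sets_def)
    finally show ?thesis by simp
  qed
  have "emeasure ?M A = (\<integral>\<^sup>+ y. indicator A y \<partial>?M)" using A by simp
  also have "\<dots> = (\<integral>\<^sup>+ y. (\<integral>\<^sup>+ q. indicator A (y(i := q)) \<partial>lborel) \<partial>Pi\<^sub>M J (\<lambda>_. lborel))"
    by (rule product_nn_integral_insert[OF J]) (use A in simp)
  also have "\<dots> = 0" unfolding inner0 by simp
  finally show ?thesis unfolding A_def .
qed

section \<open>Degenerate vertex assignments form a null set\<close>

context rainbow_shift
begin

text \<open>Over \<open>1 \<le> j < r\<close>, row \<open>i\<close> is a vector of dimension
  \<open>(r - 1) * d\<close>. If an affine map is constant on the orbit of a point, its barycentric
  coordinates are a linear relation among the \<open>n\<close> rows.\<close>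

definition row_difference :: "(nat \<Rightarrow> nat) \<Rightarrow> (nat \<Rightarrow> 'a::ab_group_add) \<Rightarrow> nat \<Rightarrow> nat \<Rightarrow> 'a" where
  "row_difference w p i j = p ((\<tau> ^^ j) (w i)) - p (w i)"

text \<open>A measurable superset of the set of degenerate vertex assignments. Asking only for
  approximate rational solutions makes measurability evident, and a functional vanishing on the
  other rows still turns this condition into the equation of a hyperplane.\<close>

definition degenerate_closure :: "(nat \<Rightarrow> nat) \<Rightarrow> nat \<Rightarrow> (nat \<Rightarrow> real ^ 'd::finite) set" where
  "degenerate_closure w i0 = {p \<in> space (Pi\<^sub>M {..N} (\<lambda>_. lborel :: (real ^ 'd) measure)).
     \<forall>m::nat. \<exists>t\<in>PiE {1..n} (\<lambda>_. \<rat>). \<forall>j\<in>{1..<r}.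
       norm (\<Sum>i\<in>{1..n}. (t(i0 := 1)) i *\<^sub>R row_difference w p i j) \<le> 1 / real (Suc m)}"

lemma sets_degenerate_closure:
  assumes w: "\<And>i. i \<in> {1..n} \<Longrightarrow> w i \<in> C i"
  shows "degenerate_closure w i0 \<in> sets (Pi\<^sub>M {..N} (\<lambda>_. lborel :: (real ^ 'd::finite) measure))"
proof -
  let ?M = "Pi\<^sub>M {..N} (\<lambda>_. lborel :: (real ^ 'd) measure)"
  have comp: "(\<lambda>p. p v) \<in> borel_measurable ?M" if "v \<le> N" for v
    using measurable_component_singleton[of v "{..N}" "\<lambda>_. lborel :: (real ^ 'd) measure"] that by simp
  have row: "(\<lambda>p. row_difference w p i j) \<in> borel_measurable ?M" if "i \<in> {1..n}" for i j
  proof -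
    have "w i \<le> N" using w[OF that] class_subset[OF that] by auto
    then show ?thesis unfolding row_difference_def
      by (intro borel_measurable_diff comp \<tau>_funpow_le)
  qed
  have set1: "{p \<in> space ?M. norm (\<Sum>i\<in>{1..n}. (t(i0 := 1)) i *\<^sub>R row_difference w p i j) \<le> c} \<in> sets ?M" for t j c
  proof -
    have "(\<lambda>p. norm (\<Sum>i\<in>{1..n}. (t(i0 := 1)) i *\<^sub>R row_difference w p i j)) \<in> borel_measurable ?M"
      by (intro measurable_compose[OF _ borel_measurable_norm] borel_measurable_sum borel_measurable_scaleR borel_measurable_const row)
    then show ?thesis by (rule borel_measurable_le[OF _ borel_measurable_const])
  qed
  have "countable (PiE {1..n} (\<lambda>_. \<rat> :: real set))"
    by (intro countable_PiE countable_rat) simp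
  moreover have "{1..<r} \<noteq> {}" using r by simp
  ultimately show ?thesis unfolding degenerate_closure_def
    by (intro sets.sets_Collect_countable_All sets.sets_Collect_countable_Ex' sets.sets_Collect_finite_All'
        set1 finite_atLeastLessThan)
qed

lemma degenerate_closureI:
  fixes p :: "nat \<Rightarrow> real ^ 'd::finite"
  assumes p: "p \<in> space (Pi\<^sub>M {..N} (\<lambda>_. lborel))" and t1: "t i0 = 1"
    and t: "\<And>j. j \<in> {1..<r} \<Longrightarrow> (\<Sum>i\<in>{1..n}. t i *\<^sub>R row_difference w p i j) = 0"
  shows "p \<in> degenerate_closure w i0"
  unfolding degenerate_closure_def mem_Collect_eq
proof (intro conjI p allI)
  fix m :: nat
  let ?u = "row_difference w p"
  define c where "c = 1 + (\<Sum>j\<in>{1..<r}. \<Sum>i\<in>{1..n}. norm (?u i j))"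
  have c: "0 < c" unfolding c_def by (intro add_pos_nonneg sum_nonneg) simp_all
  \<comment> \<open>The tolerance for the rational coefficients, chosen so that the total error
    stays below \<open>1 / real (Suc m)\<close>; the \<open>1 +\<close> in \<open>c\<close> keeps
    the divisor positive.\<close>
  define \<eta> where "\<eta> = 1 / real (Suc m) / c"
  have \<eta>: "0 < \<eta>" using c by (simp add: \<eta>_def)
  have "\<exists>s. s \<in> \<rat> \<and> \<bar>s - t i\<bar> < \<eta>" for i
  proof -
    obtain s where "s \<in> \<rat>" "t i - \<eta> < s" "s < t i + \<eta>"
      using Rats_dense_in_real[of "t i - \<eta>" "t i + \<eta>"] \<eta> by auto
    then show ?thesis by (intro exI[of _ s] conjI) (simp_all add: abs_less_iff)
  qed
  then have "\<forall>i. \<exists>s. s \<in> \<rat> \<and> \<bar>s - t i\<bar> < \<eta>" by blast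
  from choice[OF this] obtain q where q: "\<And>i. q i \<in> \<rat>" "\<And>i. \<bar>q i - t i\<bar> < \<eta>" by blast
  define s where "s = (restrict q {1..n})(i0 := 1)"
  have s: "\<bar>s i - t i\<bar> \<le> \<eta>" if "i \<in> {1..n}" for i
    using q(2)[of i] \<eta> t1 that by (auto simp: s_def)
  have "norm (\<Sum>i\<in>{1..n}. s i *\<^sub>R ?u i j) \<le> 1 / real (Suc m)" if j: "j \<in> {1..<r}" for j
  proof -
    have eq: "(\<Sum>i\<in>{1..n}. s i *\<^sub>R ?u i j) = (\<Sum>i\<in>{1..n}. (s i - t i) *\<^sub>R ?u i j)"
      using t[OF j] by (simp add: scaleR_left_diff_distrib sum_subtractf)
    have "norm (\<Sum>i\<in>{1..n}. s i *\<^sub>R ?u i j) \<le> (\<Sum>i\<in>{1..n}. norm ((s i - t i) *\<^sub>R ?u i j))"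
      unfolding eq by (rule norm_sum)
    also have "\<dots> \<le> (\<Sum>i\<in>{1..n}. \<eta> * norm (?u i j))"
      by (rule sum_mono) (use s in \<open>simp add: mult_right_mono\<close>)
    also have "\<dots> = \<eta> * (\<Sum>i\<in>{1..n}. norm (?u i j))" by (simp add: sum_distrib_left)
    also have "\<dots> \<le> \<eta> * c"
    proof (rule mult_left_mono)
      have "(\<Sum>i\<in>{1..n}. norm (?u i j)) \<le> (\<Sum>j\<in>{1..<r}. \<Sum>i\<in>{1..n}. norm (?u i j))"
        by (rule member_le_sum[OF j, of "\<lambda>j. \<Sum>i\<in>{1..n}. norm (?u i j)"]) (auto intro: sum_nonneg)
      then show "(\<Sum>i\<in>{1..n}. norm (?u i j)) \<le> c" by (simp add: c_def)
    qed (use \<eta> in simp)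
    also have "\<dots> = 1 / real (Suc m)" using c by (simp add: \<eta>_def)
    finally show ?thesis .
  qed
  moreover have "restrict q {1..n} \<in> PiE {1..n} (\<lambda>_. \<rat>)" using q(1) by auto
  ultimately show "\<exists>t\<in>PiE {1..n} (\<lambda>_. \<rat>). \<forall>j\<in>{1..<r}.
      norm (\<Sum>i\<in>{1..n}. (t(i0 := 1)) i *\<^sub>R ?u i j) \<le> 1 / real (Suc m)"
    unfolding s_def by blast
qed

text \<open>The approximating coefficients of the other rows may be unbounded in \<open>m\<close>,
  but the functional removes those rows. Row \<open>i0\<close> has coefficient \<open>1\<close>, so
  its value is bounded by an error tending to \<open>0\<close>.\<close>

lemma degenerate_closure_functional:
  fixes p :: "nat \<Rightarrow> real ^ 'd::finite"
  assumes p: "p \<in> degenerate_closure w i0" and i0: "i0 \<in> {1..n}"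
    and \<phi>: "\<And>i. i \<in> {1..n} - {i0} \<Longrightarrow> (\<Sum>j\<in>{1..<r}. inner (\<phi> j) (row_difference w p i j)) = 0"
  shows "(\<Sum>j\<in>{1..<r}. inner (\<phi> j) (row_difference w p i0 j)) = 0"
proof -
  let ?u = "row_difference w p"
  define S where "S = (\<Sum>j\<in>{1..<r}. inner (\<phi> j) (?u i0 j))"
  define c where "c = (\<Sum>j\<in>{1..<r}. norm (\<phi> j))"
  have "\<bar>S\<bar> \<le> c / real (Suc m)" for m
  proof -
    obtain t where t: "\<And>j. j \<in> {1..<r} \<Longrightarrow> norm (\<Sum>i\<in>{1..n}. (t(i0 := 1)) i *\<^sub>R ?u i j) \<le> 1 / real (Suc m)"
      using p unfolding degenerate_closure_def by blast
    let ?t = "t(i0 := 1)"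
    have "(\<Sum>j\<in>{1..<r}. inner (\<phi> j) (\<Sum>i\<in>{1..n}. ?t i *\<^sub>R ?u i j))
        = (\<Sum>j\<in>{1..<r}. \<Sum>i\<in>{1..n}. ?t i * inner (\<phi> j) (?u i j))"
      by (simp add: inner_sum_right)
    also have "\<dots> = (\<Sum>i\<in>{1..n}. ?t i * (\<Sum>j\<in>{1..<r}. inner (\<phi> j) (?u i j)))"
      unfolding sum_distrib_left by (rule sum.swap)
    also have "\<dots> = (\<Sum>i\<in>{i0}. ?t i * (\<Sum>j\<in>{1..<r}. inner (\<phi> j) (?u i j)))"
      by (rule sum.mono_neutral_right) (use i0 \<phi> in auto)
    also have "\<dots> = S" by (simp add: S_def)
    finally have S: "(\<Sum>j\<in>{1..<r}. inner (\<phi> j) (\<Sum>i\<in>{1..n}. ?t i *\<^sub>R ?u i j)) = S" .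
    have "\<bar>S\<bar> \<le> (\<Sum>j\<in>{1..<r}. \<bar>inner (\<phi> j) (\<Sum>i\<in>{1..n}. ?t i *\<^sub>R ?u i j)\<bar>)"
      unfolding S[symmetric] by (rule sum_abs)
    also have "\<dots> \<le> (\<Sum>j\<in>{1..<r}. norm (\<phi> j) * (1 / real (Suc m)))"
    proof (rule sum_mono)
      fix j assume j: "j \<in> {1..<r}"
      have "\<bar>inner (\<phi> j) (\<Sum>i\<in>{1..n}. ?t i *\<^sub>R ?u i j)\<bar> \<le> norm (\<phi> j) * norm (\<Sum>i\<in>{1..n}. ?t i *\<^sub>R ?u i j)"
        by (rule Cauchy_Schwarz_ineq2)
      also have "\<dots> \<le> norm (\<phi> j) * (1 / real (Suc m))" by (rule mult_left_mono[OF t[OF j]]) simp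
      finally show "\<bar>inner (\<phi> j) (\<Sum>i\<in>{1..n}. ?t i *\<^sub>R ?u i j)\<bar> \<le> norm (\<phi> j) * (1 / real (Suc m))" .
    qed
    also have "\<dots> = c / real (Suc m)" by (simp add: c_def sum_divide_distrib)
    finally show ?thesis .
  qed
  moreover have "(\<lambda>m. c / real (Suc m)) \<longlonglongrightarrow> 0" by (rule LIMSEQ_Suc[OF lim_const_over_n])
  ultimately have "\<bar>S\<bar> \<le> 0" by (intro LIMSEQ_le_const) auto
  then show ?thesis by (simp add: S_def)
qed

text \<open>Fix the points outside class \<open>i0\<close>. The other \<open>n - 1\<close> rows are
  too few to span, so a nonzero functional kills them, and row \<open>i0\<close> must then lie in
  its kernel: a null condition on the points of that class.\<close>

lemma null_degenerate_closure:
  assumes w: "\<And>i. i \<in> {1..n} \<Longrightarrow> w i \<in> C i" and i0: "i0 \<in> {1..n}"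
    and n: "n \<le> (r - 1) * CARD('d)"
  shows "degenerate_closure w i0 \<in> null_sets (Pi\<^sub>M {..N} (\<lambda>_. lborel :: (real ^ 'd::finite) measure))"
proof -
  interpret product_sigma_finite "\<lambda>_ :: nat. lborel :: (real ^ 'd) measure"
    by (intro product_sigma_finite.intro lborel.sigma_finite_measure_axioms)
  let ?B = "degenerate_closure w i0 :: (nat \<Rightarrow> real ^ 'd) set"
  define A where "A = {..N} - C i0"
  define v0 where "v0 = w i0"
  have v0: "v0 \<in> C i0" using w[OF i0] by (simp add: v0_def)
  have union: "A \<union> C i0 = {..N}" and disj: "A \<inter> C i0 = {}" using class_subset[OF i0] by (auto simp: A_def)
  have fin: "finite A" "finite (C i0)" using class_subset[OF i0] finite_subset by (auto simp: A_def)
  have slice: "(\<integral>\<^sup>+ y. indicator ?B (merge A (C i0) (x, y)) \<partial>Pi\<^sub>M (C i0) (\<lambda>_. lborel :: (real ^ 'd) measure)) = 0" for x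
  proof -
    let ?I = "{1..n} - {i0}" and ?J = "{1..<r} \<times> (UNIV :: 'd set)"
    define a where "a i e = row_difference w x i (fst e) $ snd e" for i e
    have "0 < n" using i0 by simp
    then have "n - 1 < (r - 1) * CARD('d)" using n by linarith
    then have "card ?I < card ?J" using i0 by (simp add: card_cartesian_product)
    then have "\<exists>\<psi>. (\<exists>e\<in>?J. \<psi> e \<noteq> 0) \<and> (\<forall>i\<in>?I. (\<Sum>e\<in>?J. a i e * \<psi> e) = 0)"
      by (intro homogeneous_system) simp_all
    then obtain \<psi> where \<psi>: "\<exists>e\<in>?J. \<psi> e \<noteq> 0" "\<forall>i\<in>?I. (\<Sum>e\<in>?J. a i e * \<psi> e) = 0" by blast
    define \<phi> :: "nat \<Rightarrow> real ^ 'd" where "\<phi> j = (\<chi> l. \<psi> (j, l))" for j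
    obtain j0 l0 where j0: "j0 \<in> {1..<r}" and l0: "\<psi> (j0, l0) \<noteq> 0" using \<psi>(1) by blast
    have "\<phi> j0 $ l0 \<noteq> 0" using l0 by (simp add: \<phi>_def)
    then have \<phi>0: "\<phi> j0 \<noteq> 0" by auto
    have \<phi>: "(\<Sum>j\<in>{1..<r}. inner (\<phi> j) (row_difference w x i j)) = 0" if "i \<in> ?I" for i
    proof -
      have "(\<Sum>j\<in>{1..<r}. inner (\<phi> j) (row_difference w x i j)) = (\<Sum>j\<in>{1..<r}. \<Sum>l\<in>UNIV. a i (j, l) * \<psi> (j, l))"
        by (simp add: inner_vec_def \<phi>_def a_def mult.commute)
      also have "\<dots> = (\<Sum>e\<in>?J. a i e * \<psi> e)" by (simp add: sum.cartesian_product)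
      finally show ?thesis using bspec[OF \<psi>(2) that] by simp
    qed
    define L where "L y = (\<Sum>j\<in>{1..<r}. inner (\<phi> j) (y ((\<tau> ^^ j) v0) - y v0))" for y :: "nat \<Rightarrow> real ^ 'd"
    \<comment> \<open>The vertex \<open>c\<close> enters \<open>L\<close> only through the summand
      \<open>j0\<close>, with normal \<open>\<phi> j0\<close>, so \<open>L\<close> is affine and
      nonconstant in the image of \<open>c\<close>.\<close>
    define c where "c = (\<tau> ^^ j0) v0"
    have mem: "(\<tau> ^^ j) v0 \<in> C i0" for j by (rule \<tau>_funpow_class[OF i0 v0])
    have v0N: "v0 \<le> N" using v0 class_subset[OF i0] by auto
    have inj: "(\<tau> ^^ j) v0 = c \<longleftrightarrow> j = j0" if "j \<in> {1..<r}" for j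
    proof
      assume eq: "(\<tau> ^^ j) v0 = c"
      show "j = j0"
      proof -
        have "j0 - j < r" "j - j0 < r" using that j0 by auto
        then show ?thesis
          using \<tau>_funpow_neq[OF v0N, of j j0] \<tau>_funpow_neq[OF v0N, of j0 j] eq
          by (cases j j0 rule: linorder_cases) (auto simp: c_def)
      qed
    qed (simp add: c_def)
    have av0: "c \<noteq> v0" using \<tau>_free[OF v0N, of j0] j0 by (simp add: c_def)
    have L_step: "L (y(c := q)) = inner (\<phi> j0) q
        + (\<Sum>j\<in>{1..<r}. inner (\<phi> j) ((if j = j0 then 0 else y ((\<tau> ^^ j) v0)) - y v0))" for y q
    proof -
      have "L (y(c := q)) = (\<Sum>j\<in>{1..<r}. (if j = j0 then inner (\<phi> j) q else 0)
         + inner (\<phi> j) ((if j = j0 then 0 else y ((\<tau> ^^ j) v0)) - y v0))"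
        unfolding L_def by (rule sum.cong) (use inj av0 in \<open>auto simp: inner_diff_right\<close>)
      then show ?thesis using j0 by (simp add: sum.distrib)
    qed
    have ins: "insert c (C i0 - {c}) = C i0" using mem[of j0] by (auto simp: c_def)
    have comp: "(\<lambda>y. y v) \<in> borel_measurable (Pi\<^sub>M (C i0) (\<lambda>_. lborel :: (real ^ 'd) measure))" if "v \<in> C i0" for v
      using measurable_component_singleton[OF that, of "\<lambda>_. lborel :: (real ^ 'd) measure"] by simp
    have measL: "L \<in> borel_measurable (Pi\<^sub>M (insert c (C i0 - {c})) (\<lambda>_. lborel :: (real ^ 'd) measure))"
      unfolding L_def ins
      by (intro borel_measurable_sum borel_measurable_inner borel_measurable_diff borel_measurable_const comp mem v0)
    let ?Z = "{y \<in> space (Pi\<^sub>M (C i0) (\<lambda>_. lborel :: (real ^ 'd) measure)). L y = 0}"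
    have null: "emeasure (Pi\<^sub>M (C i0) (\<lambda>_. lborel :: (real ^ 'd) measure)) ?Z = 0"
      using emeasure_affine_coordinate_zero[OF _ _ measL \<phi>0 L_step] fin(2) unfolding ins by simp
    have Zsets: "?Z \<in> sets (Pi\<^sub>M (C i0) (\<lambda>_. lborel :: (real ^ 'd) measure))"
      using borel_measurable_eq[OF measL borel_measurable_const] unfolding ins .
    have "(\<integral>\<^sup>+ y. indicator ?B (merge A (C i0) (x, y)) \<partial>Pi\<^sub>M (C i0) (\<lambda>_. lborel))
        \<le> (\<integral>\<^sup>+ y. indicator ?Z y \<partial>Pi\<^sub>M (C i0) (\<lambda>_. lborel))"
    proof (rule nn_integral_mono)
      fix y :: "nat \<Rightarrow> real ^ 'd" assume y: "y \<in> space (Pi\<^sub>M (C i0) (\<lambda>_. lborel))"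
      show "indicator ?B (merge A (C i0) (x, y)) \<le> (indicator ?Z y :: ennreal)"
      proof (cases "merge A (C i0) (x, y) \<in> ?B")
        case True
        let ?p = "merge A (C i0) (x, y)"
        have pA: "?p v = x v" if "v \<in> C i" "i \<in> ?I" for v i
        proof -
          have "v \<in> A" using that class_subset[of i] class_eq[of i i0 v] i0 by (auto simp: A_def)
          then show ?thesis by (simp add: merge_def)
        qed
        have pC: "?p v = y v" if "v \<in> C i0" for v using that disj by (auto simp: merge_def)
        have "row_difference w ?p i j = row_difference w x i j" if "i \<in> ?I" for i j
          unfolding row_difference_def using pA[OF _ that] w[of i] \<tau>_funpow_class[of i "w i" j] that by simp
        then have "(\<Sum>j\<in>{1..<r}. inner (\<phi> j) (row_difference w ?p i0 j)) = 0"
          using \<phi> by (intro degenerate_closure_functional[OF True i0]) (simp only:)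
        moreover have "row_difference w ?p i0 j = y ((\<tau> ^^ j) v0) - y v0" for j
          unfolding row_difference_def v0_def[symmetric] using pC[OF mem] pC[OF v0] by simp
        ultimately have "L y = 0" by (simp add: L_def)
        then show ?thesis using y by (simp add: indicator_def)
      qed simp
    qed
    also have "\<dots> = 0" using null Zsets by simp
    finally show ?thesis by simp
  qed
  have B: "?B \<in> sets (Pi\<^sub>M {..N} (\<lambda>_. lborel))" by (rule sets_degenerate_closure[OF w])
  have "emeasure (Pi\<^sub>M {..N} (\<lambda>_. lborel)) ?B = (\<integral>\<^sup>+ p. indicator ?B p \<partial>Pi\<^sub>M (A \<union> C i0) (\<lambda>_. lborel))"
    using B by (simp add: union)
  also have "\<dots> = (\<integral>\<^sup>+ x. (\<integral>\<^sup>+ y. indicator ?B (merge A (C i0) (x, y)) \<partial>Pi\<^sub>M (C i0) (\<lambda>_. lborel)) \<partial>Pi\<^sub>M A (\<lambda>_. lborel))"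
    by (rule product_nn_integral_fold[OF disj fin]) (use B in \<open>simp add: union\<close>)
  also have "\<dots> = 0" unfolding slice by simp
  finally show ?thesis using B by (rule null_setsI)
qed

text \<open>Finitely many null sets suffice: one for each choice \<open>w\<close> of a vertex in
  every class and each colour \<open>i0\<close> whose weight is nonzero.\<close>

lemma AE_affine_nondegenerate:
  assumes n: "n \<le> (r - 1) * CARD('d)"
  shows "AE p in Pi\<^sub>M {..N} (\<lambda>_. lborel :: (real ^ 'd::finite) measure). \<forall>x\<in>rainbow_complex.
    \<exists>j. affine_simplex_map N p ((shift ^^ j) x) \<noteq> affine_simplex_map N p x"
proof -
  let ?M = "Pi\<^sub>M {..N} (\<lambda>_. lborel :: (real ^ 'd) measure)"
  have fin: "finite (PiE {1..n} C)"
    using class_subset finite_subset by (intro finite_PiE) (simp, blast)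
  have "AE p in ?M. \<forall>w\<in>PiE {1..n} C. \<forall>i0\<in>{1..n}. p \<notin> degenerate_closure w i0"
    unfolding AE_finite_all[OF fin] AE_finite_all[OF finite_atLeastAtMost]
    by (intro ballI AE_not_in null_degenerate_closure n) auto
  then show ?thesis
  proof (rule AE_mp, intro AE_I2 impI ballI)
    fix p x
    assume p: "p \<in> space ?M" and good: "\<forall>w\<in>PiE {1..n} C. \<forall>i0\<in>{1..n}. p \<notin> degenerate_closure w i0"
      and x: "x \<in> rainbow_complex"
    show "\<exists>j. affine_simplex_map N p ((shift ^^ j) x) \<noteq> affine_simplex_map N p x"
    proof (rule ccontr)
      assume "\<not> ?thesis"
      then have eq: "affine_simplex_map N p ((shift ^^ j) x) = affine_simplex_map N p x" for j by blast
      obtain S where S: "rainbow N n C S" "x \<in> simplex_face N S" using x by (auto simp: rainbow_complex_def)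
      have "\<forall>i\<in>{1..n}. \<exists>s. S \<inter> C i = {s}" using S(1) by (auto simp: rainbow_def card_1_singleton_iff)
      from bchoice[OF this] obtain s where s: "\<And>i. i \<in> {1..n} \<Longrightarrow> S \<inter> C i = {s i}" by blast
      define w where "w = restrict s {1..n}"
      have wS: "S \<inter> C i = {w i}" if "i \<in> {1..n}" for i using s[OF that] that by (simp add: w_def)
      have "\<forall>i\<in>{1..n}. s i \<in> C i"
      proof
        fix i assume "i \<in> {1..n}"
        then have "s i \<in> S \<inter> C i" by (simp only: s singletonI)
        then show "s i \<in> C i" by (rule IntD2)
      qed
      then have w: "w \<in> PiE {1..n} C" by (simp only: w_def restrict_PiE_iff)
      have wC: "w i \<in> C i" if "i \<in> {1..n}" for i using PiE_mem[OF w that] .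
      have winj: "inj_on w {1..n}"
      proof (rule inj_onI)
        fix i k assume ik: "i \<in> {1..n}" "k \<in> {1..n}" "w i = w k"
        have "w i \<in> C k" unfolding ik(3) by (rule wC[OF ik(2)])
        then show "i = k" by (rule class_eq[OF ik(1,2) wC[OF ik(1)]])
      qed
      have wN: "w ` {1..n} \<subseteq> {..N}" using subsetD[OF class_subset wC] by (intro image_subsetI)
      have x0: "x v = 0" if "v \<in> {..N} - w ` {1..n}" for v
      proof -
        have "v \<le> N" using that by simp
        then obtain i where i: "i \<in> {1..n}" "v \<in> C i" using class_ex by blast
        have "v \<notin> S"
        proof
          assume "v \<in> S"
          then have "v \<in> {w i}" unfolding wS[OF i(1), symmetric] using i(2) by (rule IntI)
          then have "v \<in> w ` {1..n}" using i(1) by simp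
          then show False using that by simp
        qed
        then show ?thesis using S(2) by (simp add: simplex_face_def)
      qed
      have red: "(\<Sum>v\<le>N. x v *\<^sub>R g v) = (\<Sum>i\<in>{1..n}. x (w i) *\<^sub>R g (w i))" for g :: "nat \<Rightarrow> 'b::real_vector"
      proof -
        have "(\<Sum>v\<le>N. x v *\<^sub>R g v) = (\<Sum>v\<in>w ` {1..n}. x v *\<^sub>R g v)"
        proof (rule sum.mono_neutral_right[OF finite_atMost wN])
          show "\<forall>v\<in>{..N} - w ` {1..n}. x v *\<^sub>R g v = 0" using x0 by simp
        qed
        also have "\<dots> = (\<Sum>i\<in>{1..n}. x (w i) *\<^sub>R g (w i))"
          by (subst sum.reindex[OF winj]) simp
        finally show ?thesis .
      qed
      have "(\<Sum>v\<le>N. x v) = 1" using S(2) by (simp add: simplex_face_def standard_simplex_def)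
      then have "(\<Sum>i\<in>{1..n}. x (w i)) = 1" using red[of "\<lambda>_. 1 :: real"] by simp
      then have "\<not> (\<forall>i\<in>{1..n}. x (w i) = 0)" using sum.neutral[of "{1..n}" "\<lambda>i. x (w i)"] by linarith
      then obtain i0 where i0: "i0 \<in> {1..n}" "x (w i0) \<noteq> 0" by blast
      define t where "t i = x (w i) / x (w i0)" for i
      have row: "(\<Sum>i\<in>{1..n}. t i *\<^sub>R row_difference w p i j) = 0" if j: "j \<in> {1..<r}" for j
      proof -
        have inv: "(\<tau> ^^ (r - j)) ((\<tau> ^^ j) v) = v" for v
        proof -
          have "(\<tau> ^^ (r - j)) ((\<tau> ^^ j) v) = (\<tau> ^^ ((r - j) + j)) v" by (simp only: funpow_add comp_apply)
          then show ?thesis using j \<tau>_period[of v] by simp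
        qed
        \<comment> \<open>Reindexing transfers the permutation from the coordinates of
          \<open>x\<close> to the vertex images; the exponent \<open>r - j\<close> inverts
          \<open>j\<close>.\<close>
        have "affine_simplex_map N p ((shift ^^ (r - j)) x)
            = (\<Sum>v\<le>N. x ((\<tau> ^^ (r - j)) ((\<tau> ^^ j) v)) *\<^sub>R p ((\<tau> ^^ j) v))"
          unfolding affine_simplex_map_def shift_funpow
          by (rule sum_\<tau>_funpow[of "\<lambda>v. x ((\<tau> ^^ (r - j)) v) *\<^sub>R p v", symmetric])
        then have "(\<Sum>v\<le>N. x v *\<^sub>R p ((\<tau> ^^ j) v)) = (\<Sum>v\<le>N. x v *\<^sub>R p v)"
          using eq[of "r - j"] by (simp only: inv affine_simplex_map_def)
        then have "(\<Sum>i\<in>{1..n}. x (w i) *\<^sub>R p ((\<tau> ^^ j) (w i))) = (\<Sum>i\<in>{1..n}. x (w i) *\<^sub>R p (w i))"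
          by (simp only: red[of "\<lambda>v. p ((\<tau> ^^ j) v)"] red[of p])
        then have zero: "(\<Sum>i\<in>{1..n}. x (w i) *\<^sub>R row_difference w p i j) = 0"
          by (simp only: row_difference_def scaleR_right_diff_distrib sum_subtractf right_minus_eq)
        have "(\<Sum>i\<in>{1..n}. t i *\<^sub>R row_difference w p i j)
            = (\<Sum>i\<in>{1..n}. (1 / x (w i0)) *\<^sub>R (x (w i) *\<^sub>R row_difference w p i j))"
          by (simp add: t_def)
        also have "\<dots> = 0" unfolding scaleR_sum_right[symmetric] zero by simp
        finally show ?thesis .
      qed
      have "t i0 = 1" using i0(2) by (simp add: t_def)
      then have "p \<in> degenerate_closure w i0" by (rule degenerate_closureI[where t = t, OF p]) (rule row)
      then show False using good w i0(1) by blast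
    qed
  qed
qed

end

section \<open>Regular polygons on rainbow faces\<close>

theorem theorem6p5:
  fixes r d n N :: nat and C :: "nat \<Rightarrow> nat set"
  assumes "r \<ge> 3"
    and "d \<ge> 2" and "even d" and "CARD('d::finite) = d"
    and "n = (r - 2) * d + 1" and "N = r * n - 1"
    and "color_classes N n r C"
  shows "(AE p in Pi\<^sub>M {..N} (\<lambda>_. lborel :: (real ^ 'd) measure).
            \<exists>x. equal_rainbow_points N n r C x \<and>
                regular_polygon_vertices r ((\<lambda>j. affine_simplex_map N p (x j)) ` {1..r}))
       \<and> (prime r \<and> odd r \<longrightarrow>
            (\<forall>f :: (nat \<Rightarrow> real) \<Rightarrow> real ^ 'd.
               continuous_on (standard_simplex N) f \<and> soberon_generic N n r C f \<longrightarrow>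
               (\<exists>x. equal_rainbow_points N n r C x \<and>
                    regular_polygon_vertices r ((\<lambda>j. f (x j)) ` {1..r}))))"
proof -
  have d2: "2 \<le> d" and evd: "even d" and card: "CARD('d) = d" and r3: "3 \<le> r" using assms by blast+
  define h where "h = d div 2"
  have dh: "d = 2 * h" and h: "0 < h" using d2 evd by (auto simp: h_def)
  have n: "n = (r - 2) * (2 * h) + 1" using assms(5) unfolding dh .
  obtain \<tau> where "rainbow_shift N n r C \<tau>" using rainbow_shift_exists[OF assms(7)] r3 by auto
  then interpret rainbow_shift N n r C \<tau> .
  obtain b :: "nat \<Rightarrow> 'd" where b: "bij_betw b {..<2 * h} UNIV"
    using ex_bij_betw_nat_finite[of "UNIV :: 'd set"] unfolding card dh atLeast0LessThan by auto
  \<comment> \<open>Common to both claims. They differ only in how the constant orbit is excluded: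
    by the generic choice of vertex images or by Sober\<acute>on-type genericity of
    \<open>f\<close>, that is, \<open>soberon_generic\<close>.\<close>
  have polygon: "(\<forall>j. f ((shift ^^ j) x) = f x) \<or>
      equal_rainbow_points N n r C (\<lambda>j. (shift ^^ j) x) \<and>
      regular_polygon_vertices r ((\<lambda>j. f ((shift ^^ j) x)) ` {1..r})"
    if x: "x \<in> rainbow_complex"
      and zero: "\<forall>k m. 2 \<le> k \<longrightarrow> k < r \<longrightarrow> m < h \<longrightarrow> fourier_coeff b f k m x = 0"
    for x and f :: "(nat \<Rightarrow> real) \<Rightarrow> real ^ 'd"
  proof -
    obtain S where "rainbow N n C S" "x \<in> simplex_face N S" using x by (auto simp: rainbow_complex_def)
    then have "equal_rainbow_points N n r C (\<lambda>j. (shift ^^ j) x)" by (rule equal_rainbow_points_shift)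
    moreover have "(\<forall>j. f ((shift ^^ j) x) = f x) \<or> regular_polygon_vertices r ((\<lambda>j. f ((shift ^^ j) x)) ` {1..r})"
      by (rule fourier_zero_polygon[OF b]) (use zero in blast)
    ultimately show ?thesis by blast
  qed
  have "n \<le> (r - 1) * CARD('d)"
  proof -
    have "r - 1 = Suc (r - 2)" using r3 by simp
    then have "(r - 1) * CARD('d) = (r - 2) * d + d" unfolding card by simp
    then show ?thesis using assms(5) d2 by linarith
  qed
  then have "AE p in Pi\<^sub>M {..N} (\<lambda>_. lborel :: (real ^ 'd) measure). \<forall>x\<in>rainbow_complex.
      \<exists>j. affine_simplex_map N p ((shift ^^ j) x) \<noteq> affine_simplex_map N p x"
    by (rule AE_affine_nondegenerate)
  then have affine: "AE p in Pi\<^sub>M {..N} (\<lambda>_. lborel :: (real ^ 'd) measure).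
      \<exists>x. equal_rainbow_points N n r C x \<and>
        regular_polygon_vertices r ((\<lambda>j. affine_simplex_map N p (x j)) ` {1..r})"
  proof (rule AE_mp, intro AE_I2 impI)
    fix p :: "nat \<Rightarrow> real ^ 'd"
    assume good: "\<forall>x\<in>rainbow_complex. \<exists>j. affine_simplex_map N p ((shift ^^ j) x) \<noteq> affine_simplex_map N p x"
    obtain x where x: "x \<in> rainbow_complex"
      "\<forall>k m. 2 \<le> k \<longrightarrow> k < r \<longrightarrow> m < h \<longrightarrow> fourier_coeff b (affine_simplex_map N p) k m x = 0"
      using affine_fourier_zero[OF h n] by blast
    have "\<not> (\<forall>j. affine_simplex_map N p ((shift ^^ j) x) = affine_simplex_map N p x)"
      using bspec[OF good x(1)] by simp
    then have "equal_rainbow_points N n r C (\<lambda>j. (shift ^^ j) x) \<and>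
        regular_polygon_vertices r ((\<lambda>j. affine_simplex_map N p ((shift ^^ j) x)) ` {1..r})"
      using polygon[OF x] by blast
    then show "\<exists>x. equal_rainbow_points N n r C x \<and>
        regular_polygon_vertices r ((\<lambda>j. affine_simplex_map N p (x j)) ` {1..r})"
      by (intro exI[of _ "\<lambda>j. (shift ^^ j) x"])
  qed
  have continuous: "\<exists>x. equal_rainbow_points N n r C x \<and>
      regular_polygon_vertices r ((\<lambda>j. f (x j)) ` {1..r})"
    if "prime r" and f: "continuous_on (standard_simplex N) f" "soberon_generic N n r C f"
    for f :: "(nat \<Rightarrow> real) \<Rightarrow> real ^ 'd"
  proof -
    obtain x where x: "x \<in> rainbow_complex"
      "\<forall>k m. 2 \<le> k \<longrightarrow> k < r \<longrightarrow> m < h \<longrightarrow> fourier_coeff b f k m x = 0"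
      using prime_fourier_zero[OF \<open>prime r\<close> h n f(1)] by blast
    obtain S where "rainbow N n C S" "x \<in> simplex_face N S" using x(1) by (auto simp: rainbow_complex_def)
    then have points: "equal_rainbow_points N n r C (\<lambda>j. (shift ^^ j) x)" by (rule equal_rainbow_points_shift)
    have "\<not> (\<forall>j. f ((shift ^^ j) x) = f x)"
    proof
      assume "\<forall>j. f ((shift ^^ j) x) = f x"
      then have "\<forall>j\<in>{1..r}. \<forall>k\<in>{1..r}. f ((shift ^^ j) x) = f ((shift ^^ k) x)" by simp
      then show False using f(2) points unfolding soberon_generic_def by blast
    qed
    then have "regular_polygon_vertices r ((\<lambda>j. f ((shift ^^ j) x)) ` {1..r})"
      using polygon[OF x] by blast
    then show ?thesis using points by (intro exI[of _ "\<lambda>j. (shift ^^ j) x"] conjI)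
  qed
  show ?thesis using affine continuous by blast
qed

end
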